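(* Let $\Omega\subseteq\mathbb{R}^d$, $d\ge2$, be a bounded domain, $I:=(0,T)$, $T<\infty$, $Q_T:=I\times\Omega$ and $p\in C^0(\overline{Q_T})$ with $p^->1$. Then there exists a constant $c>0$ such that every $\boldsymbol{u}\in\mathcal{X}^{2,p}_{\varepsilon}(Q_T)\cap\mathcal{Y}^\infty(Q_T)$ satisfies $\boldsymbol{u}\in L^{p(\cdot,\cdot)}(Q_T)^d$ with $$\|\boldsymbol{u}\|_{L^{p(\cdot,\cdot)}(Q_T)^d}\le c\big(\|\boldsymbol{\varepsilon}(\boldsymbol{u})\|_{L^{p(\cdot,\cdot)}(Q_T)^{d\times d}}+\|\boldsymbol{u}\|_{\mathcal{Y}^\infty(Q_T)}\big),$$ i.e. the embedding $\mathcal{X}^{2,p}_{\varepsilon}(Q_T)\cap\mathcal{Y}^\infty(Q_T)\hookrightarrow L^{p(\cdot,\cdot)}(Q_T)^d$ holds.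
   Context: For a measurable bounded exponent $p$ on a bounded measurable set $G$ with values in $[1,\infty)$, $p^-$ and $p^+$ denote its essential infimum and supremum; $L^{p(\cdot)}(G)$ is the space of measurable $f$ with finite modular $\rho_{p(\cdot)}(f):=\int_G|f(x)|^{p(x)}dx$, with the Luxemburg norm $\|f\|:=\inf\{\lambda>0:\rho_{p(\cdot)}(f/\lambda)\le1\}$ (likewise for vector- and matrix-valued functions). $\mathbb{M}^{d\times d}_{\mathrm{sym}}$ denotes the symmetric real $d\times d$ matrices and $\boldsymbol{\varepsilon}(\mathbf{u}):=\frac12(\nabla\mathbf{u}+\nabla\mathbf{u}^\top)$ (gradient in the space variable, in the distributional sense). For $t\in I$, $X^{2,p}_{\varepsilon}(t)$ is the closure of $C_0^\infty(\Omega)^d$ in $\{\mathbf{f}\in L^2(\Omega)^d:\boldsymbol{\varepsilon}(\mathbf{f})\in L^{p(t,\cdot)}(\Omega,\mathbb{M}^{d\times d}_{\mathrm{sym}})\}$ with respect to the norm $\|\cdot\|_{L^2(\Omega)^d}+\|\boldsymbol{\varepsilon}(\cdot)\|_{L^{p(t,\cdot)}(\Omega)^{d\times d}}$. $\mathcal{X}^{2,p}_{\varepsilon}(Q_T):=\{\boldsymbol{u}\in L^2(Q_T)^d:\boldsymbol{\varepsilon}(\boldsymbol{u})\in L^{p(\cdot,\cdot)}(Q_T,\mathbb{M}^{d\times d}_{\mathrm{sym}}),\ \boldsymbol{u}(t)\in X^{2,p}_{\varepsilon}(t)\text{ for a.e. }t\in I\}$ with norm $\|\cdot\|_{L^2(Q_T)^d}+\|\boldsymbol{\varepsilon}(\cdot)\|_{L^{p(\cdot,\cdot)}(Q_T)^{d\times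 d}}$. $Y:=L^2(\Omega)^d$ and $\mathcal{Y}^\infty(Q_T):=L^\infty(I,Y)$; the intersection carries the sum of the norms. *)

theory Defs
  imports "HOL-Analysis.Analysis" "HOL-Probability.Essential_Supremum"
begin

text \<open>Elements of function spaces are represented by functions; the memberships and norms
  below depend only on the values of a function on its domain, up to null sets. The norm on matrices
  \<open>real^'n^'n\<close> is the Frobenius norm.\<close>

definition ess_inf :: "'a::euclidean_space set \<Rightarrow> ('a \<Rightarrow> real) \<Rightarrow> ereal" where
  "ess_inf G p = - esssup (lebesgue_on G) (\<lambda>x. ereal (- p x))"

definition modular ::
  "'a::euclidean_space set \<Rightarrow> ('a \<Rightarrow> real) \<Rightarrow> ('a \<Rightarrow> 'b::euclidean_space) \<Rightarrow> ennreal" where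
  "modular G p f = (\<integral>\<^sup>+x. ennreal (norm (f x) powr p x) \<partial>lebesgue_on G)"

definition Lp_space ::
  "'a::euclidean_space set \<Rightarrow> ('a \<Rightarrow> real) \<Rightarrow> ('a \<Rightarrow> 'b::euclidean_space) set" where
  "Lp_space G p = {f \<in> borel_measurable (lebesgue_on G). modular G p f < \<infinity>}"

definition Lp_norm ::
  "'a::euclidean_space set \<Rightarrow> ('a \<Rightarrow> real) \<Rightarrow> ('a \<Rightarrow> 'b::euclidean_space) \<Rightarrow> real" where
  "Lp_norm G p f = Inf {l. l > 0 \<and> modular G p (\<lambda>x. f x /\<^sub>R l) \<le> 1}"

definition L2_space :: "'a::euclidean_space set \<Rightarrow> ('a \<Rightarrow> 'b::euclidean_space) set" where
  "L2_space G = {f \<in> borel_measurable (lebesgue_on G).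
     integrable (lebesgue_on G) (\<lambda>x. (norm (f x))\<^sup>2)}"

definition L2_norm :: "'a::euclidean_space set \<Rightarrow> ('a \<Rightarrow> 'b::euclidean_space) \<Rightarrow> real" where
  "L2_norm G f = sqrt (LINT x|lebesgue_on G. (norm (f x))\<^sup>2)"

text \<open>\<open>Ck k f\<close> says that \<open>f\<close> is \<open>k\<close> times continuously differentiable on the whole space;
  elements of \<open>test_functions U\<close> are extended by zero outside \<open>U\<close>.\<close>

primrec Ck :: "nat \<Rightarrow> ('a::euclidean_space \<Rightarrow> 'b::euclidean_space) \<Rightarrow> bool" where
  "Ck 0 f = continuous_on UNIV f"
| "Ck (Suc k) f = (f differentiable_on UNIV \<and>
     (\<forall>b\<in>Basis. Ck k (\<lambda>x. frechet_derivative f (at x) b)))"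

definition test_functions ::
  "'a::euclidean_space set \<Rightarrow> ('a \<Rightarrow> 'b::euclidean_space) set" where
  "test_functions U = {\<phi>. (\<forall>k. Ck k \<phi>) \<and>
     compact (closure {x. \<phi> x \<noteq> 0}) \<and> closure {x. \<phi> x \<noteq> 0} \<subseteq> U}"

text \<open>A family \<open>e\<close> lists the directions of differentiation, so that one definition covers both
  functions on \<open>\<Omega>\<close> and functions on \<open>I \<times> \<Omega>\<close>, where only spatial derivatives are taken.\<close>

definition dirs :: "'n::finite \<Rightarrow> real^'n" where
  "dirs j = axis j 1"

definition space_dirs :: "'n::finite \<Rightarrow> real \<times> (real^'n)" where
  "space_dirs j = (0, axis j 1)"

definition dist_deriv ::
  "'a::euclidean_space set \<Rightarrow> 'a \<Rightarrow> ('a \<Rightarrow> real) \<Rightarrow> ('a \<Rightarrow> real) \<Rightarrow> real" where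
  "dist_deriv U v g \<phi> = - (LINT x|lebesgue_on U. g x * frechet_derivative \<phi> (at x) v)"

definition dist_sym_grad ::
  "('n::finite \<Rightarrow> 'a::euclidean_space) \<Rightarrow> 'a set \<Rightarrow> ('a \<Rightarrow> real^'n) \<Rightarrow> 'n \<Rightarrow> 'n \<Rightarrow>
     ('a \<Rightarrow> real) \<Rightarrow> real" where
  "dist_sym_grad e U u i j \<phi> =
     (dist_deriv U (e j) (\<lambda>x. u x $ i) \<phi> + dist_deriv U (e i) (\<lambda>x. u x $ j) \<phi>) / 2"

definition locally_integrable ::
  "'a::euclidean_space set \<Rightarrow> ('a \<Rightarrow> 'b::euclidean_space) \<Rightarrow> bool" where
  "locally_integrable U f \<longleftrightarrow> (\<forall>K. compact K \<longrightarrow> K \<subseteq> U \<longrightarrow> integrable (lebesgue_on K) f)"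

definition has_sym_grad ::
  "('n::finite \<Rightarrow> 'a::euclidean_space) \<Rightarrow> 'a set \<Rightarrow> ('a \<Rightarrow> real^'n) \<Rightarrow> ('a \<Rightarrow> real^'n^'n) \<Rightarrow>
     bool" where
  "has_sym_grad e U u E \<longleftrightarrow>
     locally_integrable U u \<and> locally_integrable U E \<and> (\<forall>x\<in>U. transpose (E x) = E x) \<and>
     (\<forall>\<phi>\<in>test_functions U. \<forall>i j.
        (LINT x|lebesgue_on U. E x $ i $ j * \<phi> x) = dist_sym_grad e U u i j \<phi>)"

text \<open>On an open set \<open>U\<close> the function representing the distribution is unique up to null sets,
  so the choice of representative is immaterial. \<open>sym_grad\<close> is only meaningful where such a
  function exists.\<close>

definition sym_grad ::
  "('n::finite \<Rightarrow> 'a::euclidean_space) \<Rightarrow> 'a set \<Rightarrow> ('a \<Rightarrow> real^'n) \<Rightarrow> 'a \<Rightarrow> real^'n^'n" where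
  "sym_grad e U u = (SOME E. has_sym_grad e U u E)"

definition L2p_space ::
  "('n::finite \<Rightarrow> 'a::euclidean_space) \<Rightarrow> 'a set \<Rightarrow> ('a \<Rightarrow> real) \<Rightarrow> ('a \<Rightarrow> real^'n) set" where
  "L2p_space e U q = {u \<in> L2_space U. \<exists>E \<in> Lp_space U q. has_sym_grad e U u E}"

definition L2p_norm ::
  "('n::finite \<Rightarrow> 'a::euclidean_space) \<Rightarrow> 'a set \<Rightarrow> ('a \<Rightarrow> real) \<Rightarrow> ('a \<Rightarrow> real^'n) \<Rightarrow> real" where
  "L2p_norm e U q u = L2_norm U u + Lp_norm U q (sym_grad e U u)"

definition X_slice ::
  "(real^'n::finite) set \<Rightarrow> (real \<times> (real^'n) \<Rightarrow> real) \<Rightarrow> real \<Rightarrow> (real^'n \<Rightarrow> real^'n) set" where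
  "X_slice \<Omega> p t = {f \<in> L2p_space dirs \<Omega> (\<lambda>x. p (t, x)).
     \<forall>\<delta>>0. \<exists>\<phi>\<in>test_functions \<Omega>. L2p_norm dirs \<Omega> (\<lambda>x. p (t, x)) (\<lambda>x. f x - \<phi> x) < \<delta>}"

definition X_space ::
  "real set \<Rightarrow> (real^'n::finite) set \<Rightarrow> (real \<times> (real^'n) \<Rightarrow> real) \<Rightarrow>
     (real \<times> (real^'n) \<Rightarrow> real^'n) set" where
  "X_space I \<Omega> p = {u \<in> L2p_space space_dirs (I \<times> \<Omega>) p.
     AE t in lebesgue_on I. (\<lambda>x. u (t, x)) \<in> X_slice \<Omega> p t}"

text \<open>\<open>L\<^sup>\<infinity>(I, L\<^sup>2(\<Omega>)\<^sup>d)\<close>: the first condition is Bochner measurability, i.e. approximability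
  almost everywhere in \<open>L\<^sup>2(\<Omega>)\<^sup>d\<close> by simple functions \<open>s k\<close>.\<close>

definition Bochner_measurable ::
  "real set \<Rightarrow> (real^'n::finite) set \<Rightarrow> (real \<times> (real^'n) \<Rightarrow> real^'n) \<Rightarrow> bool" where
  "Bochner_measurable I \<Omega> u \<longleftrightarrow>
     (AE t in lebesgue_on I. (\<lambda>x. u (t, x)) \<in> L2_space \<Omega>) \<and>
     (\<exists>s :: nat \<Rightarrow> real \<Rightarrow> (real^'n \<Rightarrow> real^'n).
        (\<forall>k. finite (s k ` I) \<and> s k ` I \<subseteq> L2_space \<Omega> \<and>
             (\<forall>g. {t \<in> I. s k t = g} \<in> sets lebesgue)) \<and>
        (AE t in lebesgue_on I. (\<lambda>k. L2_norm \<Omega> (\<lambda>x. s k t x - u (t, x))) \<longlonglongrightarrow> 0))"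

definition Y_esssup ::
  "real set \<Rightarrow> (real^'n::finite) set \<Rightarrow> (real \<times> (real^'n) \<Rightarrow> real^'n) \<Rightarrow> ereal" where
  "Y_esssup I \<Omega> u = esssup (lebesgue_on I) (\<lambda>t. ereal (L2_norm \<Omega> (\<lambda>x. u (t, x))))"

definition Y_inf_space ::
  "real set \<Rightarrow> (real^'n::finite) set \<Rightarrow> (real \<times> (real^'n) \<Rightarrow> real^'n) set" where
  "Y_inf_space I \<Omega> = {u. Bochner_measurable I \<Omega> u \<and> Y_esssup I \<Omega> u < \<infinity>}"

definition Y_inf_norm ::
  "real set \<Rightarrow> (real^'n::finite) set \<Rightarrow> (real \<times> (real^'n) \<Rightarrow> real^'n) \<Rightarrow> real" where
  "Y_inf_norm I \<Omega> u = real_of_ereal (Y_esssup I \<Omega> u)"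

end

theory Submission
  imports Defs
begin

text \<open>
  Write \<open>d\<close> for the dimension of the space. The proof works slice by slice in time. A pointwise bound takes the
  place of Korn's inequality, which for variable exponents requires more than continuity.

  For a smooth compactly supported vector field \<open>\<phi>\<close> the function \<open>\<tau> \<mapsto> z \<bullet> \<phi> (x + \<tau> z)\<close> has the derivative
  \<open>z \<bullet> \<epsilon>(\<phi>) z\<close>, evaluated at \<open>x + \<tau> z\<close>: only the symmetric gradient enters. Integrating over the directions \<open>z\<close> in a
  ball of radius \<open>R\<close> bounds \<open>\<bar>\<phi> x\<bar>\<close> by the mean of \<open>\<bar>\<phi>\<bar>\<close> over the ball around \<open>x\<close> and the mean of \<open>\<bar>\<epsilon>(\<phi>)\<bar>\<close> over all
  segments from \<open>x\<close> into it (lemma \<open>test_function_ray_bound\<close>). By density the bound holds almost everywhere for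
  every member of \<open>X_slice\<close>, extended by zero (lemma \<open>X_slice_ray_bound\<close>).

  Choose \<open>R\<close> so small that \<open>p\<close> oscillates by at most \<open>1/d\<close> at distance \<open>R\<close>. Let \<open>v\<close> be the modulus of a slice with
  \<open>L\<^sup>2\<close> norm at most one, \<open>g\<close> that of its symmetric gradient, and \<open>q\<close> the exponent on the slice. At a point \<open>x\<close> with
  \<open>v x \<ge> 1\<close> split \<open>v\<^sup>q \<le> v\<^sup>1\<^sup>/\<^sup>d v\<^sup>s\<close> with \<open>s = max 1 (q x - 1/d)\<close>. Since \<open>s\<close> does not exceed \<open>q\<close> near
  \<open>x\<close>, convexity bounds \<open>v\<^sup>s\<close> by a segment mean of \<open>1 + g\<^sup>q\<close>. The segment mean is a self-adjoint operator, so
  integrating the product moves it onto \<open>v\<^sup>1\<^sup>/\<^sup>d\<close>, and the segment mean of \<open>v\<^sup>1\<^sup>/\<^sup>d\<close> is bounded in terms of the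
  \<open>L\<^sup>2\<close> norm alone (lemma \<open>ray_int_powr_le\<close>). Hence the modular of a slice is bounded by a constant times one
  plus the modular of its symmetric gradient (lemma \<open>modular_le_of_ray_bound\<close>), and one integrates in time.

  To integrate in time one has to know that for almost every \<open>t\<close> the slice of the space-time symmetric gradient is
  the symmetric gradient of the slice (lemma \<open>AE_slice_sym_grad\<close>). This rests on a fundamental lemma of the calculus
  of variations with countably many explicit test functions (lemma \<open>AE_zero_of_bumps\<close>). The norm inequality follows
  from the modular one by homogeneity.
\<close>

section \<open>Smooth bump functions\<close>

lemma Ck_mono_Suc: "Ck (Suc k) f \<Longrightarrow> Ck k f"
proof (induction k arbitrary: f)
  case 0
  then show ?case by (simp add: differentiable_imp_continuous_on)
next
  case (Suc k)
  then show ?case by (metis Ck.simps(2))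
qed

lemma Ck_differentiable:
  assumes "Ck (Suc k) f"
  shows "(f has_derivative frechet_derivative f (at x)) (at x)"
  using assms frechet_derivative_works[of f "at x"]
  by (auto simp: differentiable_on_def)

text \<open>The recursion in \<open>Ck\<close> speaks of \<open>frechet_derivative\<close>, a choice; this rule lets every closure
  property of \<open>Ck\<close> be proved from an explicit formula for the derivative.\<close>
lemma Ck_SucI:
  assumes "\<And>x. (f has_derivative f' x) (at x)" "\<And>b. b \<in> Basis \<Longrightarrow> Ck k (\<lambda>x. f' x b)"
  shows "Ck (Suc k) f"
proof -
  have "frechet_derivative f (at x) = f' x" for x
    using frechet_derivative_at[OF assms(1)] by simp
  then show ?thesis
    using assms by (auto simp: differentiable_on_def intro: differentiableI)
qed

lemma Ck_const: "Ck k (\<lambda>x. c)"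
proof (induction k arbitrary: c)
  case (Suc k)
  show ?case by (rule Ck_SucI[where f' = "\<lambda>x v. 0"]) (auto intro: derivative_eq_intros Suc)
qed simp

lemma Ck_add: "Ck k f \<Longrightarrow> Ck k g \<Longrightarrow> Ck k (\<lambda>x. f x + g x)"
proof (induction k arbitrary: f g)
  case (Suc k)
  show ?case
    by (rule Ck_SucI, rule has_derivative_add[OF Ck_differentiable[OF Suc.prems(1)] Ck_differentiable[OF Suc.prems(2)]])
      (use Suc in auto)
qed (auto intro: continuous_intros)

lemma Ck_bounded_linear_comp:
  assumes L: "bounded_linear L"
  shows "Ck k f \<Longrightarrow> Ck k (\<lambda>x. L (f x))"
proof (induction k arbitrary: f)
  case 0
  then show ?case using L by (auto intro: bounded_linear.continuous_on)
next
  case (Suc k)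
  show ?case
    by (rule Ck_SucI, rule bounded_linear.has_derivative[OF L Ck_differentiable[OF Suc.prems(1)]])
      (use Suc in auto)
qed

lemma Ck_mult:
  fixes f g :: "'a::euclidean_space \<Rightarrow> real"
  shows "Ck k f \<Longrightarrow> Ck k g \<Longrightarrow> Ck k (\<lambda>x. f x * g x)"
proof (induction k arbitrary: f g)
  case (Suc k)
  have "Ck k f" "Ck k g" using Suc.prems Ck_mono_Suc by blast+
  then show ?case
    by (intro Ck_SucI[OF has_derivative_mult[OF Ck_differentiable[OF Suc.prems(1)] Ck_differentiable[OF Suc.prems(2)]]])
      (use Suc in \<open>auto intro!: Ck_add\<close>)
qed (auto intro: continuous_intros)

lemma Ck_comp_affine:
  fixes g :: "real \<Rightarrow> real" and v :: "'a::euclidean_space"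
  shows "Ck k g \<Longrightarrow> Ck k (\<lambda>x. g (r * (x \<bullet> v) + a))"
proof (induction k arbitrary: g)
  case 0
  then show ?case by (auto intro!: continuous_on_compose2[of UNIV g] continuous_intros)
next
  case (Suc k)
  let ?D = "\<lambda>x. frechet_derivative g (at x) 1"
  have D: "(g has_real_derivative ?D y) (at y)" for y
  proof -
    have h: "(g has_derivative frechet_derivative g (at y)) (at y)"
      by (rule Ck_differentiable[OF Suc.prems])
    have "frechet_derivative g (at y) = (*) (?D y)"
    proof
      fix r
      show "frechet_derivative g (at y) r = ?D y * r"
        using linear_scale[OF has_derivative_linear[OF h], of r 1] by simp
    qed
    with h show ?thesis by (simp add: has_field_derivative_def)
  qed
  have "((\<lambda>x. g (r * (x \<bullet> v) + a)) has_derivative (\<lambda>h. (r * (h \<bullet> v)) * ?D (r * (x \<bullet> v) + a))) (at x)" for x :: 'a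
    by (rule has_derivative_eq_rhs, rule has_derivative_compose[OF _ D[unfolded has_field_derivative_def]])
      (auto intro!: derivative_eq_intros)
  then show ?case
    by (rule Ck_SucI) (use Suc in \<open>auto intro!: Ck_mult Ck_const\<close>)
qed

lemma Ck_prod:
  fixes f :: "'i \<Rightarrow> 'a::euclidean_space \<Rightarrow> real"
  assumes "finite S" "\<And>i. i \<in> S \<Longrightarrow> Ck k (f i)"
  shows "Ck k (\<lambda>x. \<Prod>i\<in>S. f i x)"
  using assms by (induction S rule: finite_induct) (auto intro!: Ck_mult Ck_const)

lemma Ck_comp_projection:
  fixes f :: "'a::euclidean_space \<Rightarrow> 'c::euclidean_space" and \<pi> :: "'b::euclidean_space \<Rightarrow> 'a"
  assumes \<pi>: "bounded_linear \<pi>" "\<And>b. b \<in> Basis \<Longrightarrow> \<pi> b = 0 \<or> \<pi> b \<in> Basis"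
  shows "Ck k f \<Longrightarrow> Ck k (\<lambda>z. f (\<pi> z))"
proof (induction k arbitrary: f)
  case 0
  then show ?case
    by (auto intro!: continuous_on_compose2[of UNIV f] bounded_linear.continuous_on[OF \<pi>(1)])
next
  case (Suc k)
  note D = Ck_differentiable[OF Suc.prems]
  have "((\<lambda>z. f (\<pi> z)) has_derivative (\<lambda>h. frechet_derivative f (at (\<pi> z)) (\<pi> h))) (at z)" for z
    by (rule has_derivative_compose[OF bounded_linear.has_derivative[OF \<pi>(1) has_derivative_ident] D])
  then show ?case
  proof (rule Ck_SucI)
    fix b :: 'b assume "b \<in> Basis"
    with \<pi>(2) consider "\<pi> b = 0" | "\<pi> b \<in> Basis" by blast
    then show "Ck k (\<lambda>z. frechet_derivative f (at (\<pi> z)) (\<pi> b))"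
    proof cases
      case 1
      have "frechet_derivative f (at x) 0 = 0" for x by (rule linear_0[OF has_derivative_linear[OF D]])
      then show ?thesis using 1 Ck_const[of k 0] by simp
    next
      case 2
      then have "Ck k (\<lambda>x. frechet_derivative f (at x) (\<pi> b))" using Suc.prems by simp
      then show ?thesis by (rule Suc.IH)
    qed
  qed
qed

text \<open>For \<open>j = 0\<close> this is the classical smooth function that vanishes to infinite order at \<open>0\<close>. The
  negative powers are included because differentiation maps the linear span of the family \<open>j = 0, 1, \<dots>\<close> into
  itself, so that one induction proves the smoothness of all of them.\<close>
definition flat :: "real \<Rightarrow> nat \<Rightarrow> real \<Rightarrow> real" where
  "flat c j s = (if s > 0 then (1 / s) ^ j * exp (- (c / s)) else 0)"

lemma flat_has_derivative:
  assumes c: "c > 0"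
  shows "(flat c j has_real_derivative (c * flat c (j + 2) s - real j * flat c (j + 1) s)) (at s)"
proof (cases "s = 0")
  case False
  have pos: "((\<lambda>s. (1 / s) ^ j * exp (- (c / s))) has_real_derivative
      (c * flat c (j + 2) s - real j * flat c (j + 1) s)) (at s)" if s: "s > 0"
  proof -
    have *: "real j * (1 / s) ^ (j - 1) * (1 / (s * s)) = real j * (1/s) ^ (j + 1)"
      using s by (cases j) (auto simp: field_simps)
    show ?thesis
      using s apply (auto intro!: derivative_eq_intros)
      using * by (simp add: flat_def field_simps)
  qed
  show ?thesis
  proof (cases "s > 0")
    case True
    show ?thesis
      by (rule DERIV_cong_ev[THEN iffD1, OF refl _ refl pos[OF True]])
        (use True in \<open>auto simp: flat_def eventually_nhds intro!: exI[of _ "{0<..}"]\<close>)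
  next
    case False
    with \<open>s \<noteq> 0\<close> have "s < 0" by simp
    show ?thesis
      by (rule DERIV_cong_ev[THEN iffD1, OF refl, of "\<lambda>_. 0" _ _ 0])
        (use \<open>s < 0\<close> in \<open>auto simp: flat_def eventually_nhds intro!: exI[of _ "{..<0}"]\<close>)
  qed
next
  case True
  have "((\<lambda>h. flat c j h / h) \<longlongrightarrow> 0) (at_right 0)"
  proof (rule Lim_transform_eventually)
    have "filterlim (\<lambda>h. c * inverse h) at_top (at_right (0::real))"
      by (rule filterlim_tendsto_pos_mult_at_top[OF tendsto_const c filterlim_inverse_at_top_right])
    from filterlim_compose[OF tendsto_power_div_exp_0[of "j + 1"] this]
    have "((\<lambda>h. (1 / c) ^ (j + 1) * ((c * inverse h) ^ (j + 1) / exp (c * inverse h))) \<longlongrightarrow> (1 / c) ^ (j + 1) * 0) (at_right 0)"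
      by (rule tendsto_mult[OF tendsto_const])
    moreover have "(1 / c) ^ (j + 1) * ((c * inverse h) ^ (j + 1) / exp (c * inverse h)) = (1 / h) ^ (j + 1) * exp (- (c / h))" for h
      using c by (simp add: power_mult_distrib exp_minus divide_simps)
    ultimately show "((\<lambda>h. (1 / h) ^ (j + 1) * exp (- (c / h))) \<longlongrightarrow> 0) (at_right 0)"
      by simp
    show "\<forall>\<^sub>F h in at_right 0. (1 / h) ^ (j + 1) * exp (- (c / h)) = flat c j h / h"
      unfolding eventually_at_filter by (auto simp: flat_def)
  qed
  moreover have "((\<lambda>h. flat c j h / h) \<longlongrightarrow> 0) (at_left 0)"
    by (rule Lim_transform_eventually[where f = "\<lambda>_. 0"])
      (auto simp: flat_def eventually_at_filter)
  ultimately have "((\<lambda>h. flat c j h / h) \<longlongrightarrow> 0) (at 0)"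
    using filterlim_split_at by blast
  then show ?thesis
    using True by (simp add: DERIV_def flat_def)
qed

lemma Ck_flat: "c > 0 \<Longrightarrow> Ck k (flat c j)"
proof (induction k arbitrary: j)
  case 0
  show ?case
    unfolding Ck.simps by (rule DERIV_continuous_on[OF flat_has_derivative[OF 0]])
next
  case (Suc k)
  have "Ck k (\<lambda>s. (c * flat c (j + 2) s) + (- real j) * flat c (j + 1) s)"
    by (intro Ck_add Ck_mult Ck_const Suc)
  then show ?case
    by (intro Ck_SucI[OF flat_has_derivative[OF Suc.prems, unfolded has_field_derivative_def]]) 
       (auto simp: algebra_simps)
qed

text \<open>The factors converge to \<open>1\<close> at positive arguments as \<open>m\<close> grows, so the functions
  \<open>bump a b m\<close> approximate the indicator of \<open>box a b\<close> from inside; a countable family of test functions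
  indexed by rational boxes is rich enough to detect null functions.\<close>
definition bump :: "'a::euclidean_space \<Rightarrow> 'a \<Rightarrow> nat \<Rightarrow> 'a \<Rightarrow> real" where
  "bump a b m x = (\<Prod>i\<in>Basis. flat (1 / Suc m) 0 (x \<bullet> i - a \<bullet> i) * flat (1 / Suc m) 0 (b \<bullet> i - x \<bullet> i))"

lemma flat_0_bounds: "c > 0 \<Longrightarrow> 0 \<le> flat c 0 s \<and> flat c 0 s \<le> 1"
  by (simp add: flat_def)

lemma bump_bounds: "0 \<le> bump a b m x" "bump a b m x \<le> 1"
  using flat_0_bounds[of "1 / Suc m"]
  by (simp_all add: bump_def prod_nonneg prod_le_1 mult_le_one)

lemma bump_outside: "x \<notin> box a b \<Longrightarrow> bump a b m x = 0"
proof -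
  assume "x \<notin> box a b"
  then obtain i where i: "i \<in> Basis" "\<not> (a \<bullet> i < x \<bullet> i \<and> x \<bullet> i < b \<bullet> i)"
    by (auto simp: mem_box)
  have "\<exists>i\<in>Basis. flat (1 / Suc m) 0 (x \<bullet> i - a \<bullet> i) * flat (1 / Suc m) 0 (b \<bullet> i - x \<bullet> i) = 0"
    using i by (intro bexI[of _ i]) (auto simp: flat_def)
  then show ?thesis
    unfolding bump_def by (subst prod_zero_iff) auto
qed

lemma bump_smooth: "Ck k (bump a b m)"
proof -
  have *: "Ck k (\<lambda>x. flat (1 / Suc m) 0 (x \<bullet> i - a \<bullet> i))" for i :: 'a
    using Ck_comp_affine[OF Ck_flat[of "1/Suc m" k 0], of 1 i "- (a \<bullet> i)"] by simp
  have **: "Ck k (\<lambda>x. flat (1 / Suc m) 0 (b \<bullet> i - x \<bullet> i))" for i :: 'a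
    using Ck_comp_affine[OF Ck_flat[of "1/Suc m" k 0], of "-1" i "b \<bullet> i"] by simp
  show ?thesis
    unfolding bump_def[abs_def] by (rule Ck_prod[OF finite_Basis Ck_mult[OF * **]])
qed

lemma bump_test_function:
  assumes "cbox a b \<subseteq> U"
  shows "bump a b m \<in> test_functions U"
proof -
  have "{x. bump a b m x \<noteq> 0} \<subseteq> cbox a b"
    using bump_outside[of _ a b m] box_subset_cbox[of a b] by auto
  then have c: "closure {x. bump a b m x \<noteq> 0} \<subseteq> cbox a b"
    by (rule closure_minimal[OF _ closed_cbox])
  then have "compact (closure {x. bump a b m x \<noteq> 0})"
    using bounded_subset[OF bounded_cbox] by (simp add: compact_eq_bounded_closed)
  then show ?thesis using c assms bump_smooth by (auto simp: test_functions_def)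
qed

lemma bump_tendsto: "(\<lambda>m. bump a b m x) \<longlonglongrightarrow> indicator (box a b) x"
proof (cases "x \<in> box a b")
  case True
  have "(\<lambda>m. flat (1 / Suc m) 0 s) \<longlonglongrightarrow> 1" if "s > 0" for s
  proof -
    have "(\<lambda>m. exp (- (1 / real (Suc m) / s))) \<longlonglongrightarrow> exp (- (0 / s))"
      using that by (intro tendsto_intros LIMSEQ_Suc[OF lim_1_over_n]) auto
    then show ?thesis using that by (simp add: flat_def)
  qed
  then have "(\<lambda>m. bump a b m x) \<longlonglongrightarrow> (\<Prod>i\<in>(Basis::'a set). 1 * 1)"
    unfolding bump_def using True by (intro tendsto_prod tendsto_mult) (auto simp: mem_box)
  then show ?thesis using True by simp
qed (simp add: bump_outside)

section \<open>Uniqueness of weak symmetric gradients\<close>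

text \<open>Only countably many test functions can be handled simultaneously outside one null set of times.
  This is why uniqueness is derived below from tests with rational boxes alone.\<close>
definition rational_points :: "'a::euclidean_space set" where
  "rational_points = {a. \<forall>i\<in>Basis. a \<bullet> i \<in> \<rat>}"

lemma countable_rational_points: "countable (rational_points :: 'a::euclidean_space set)"
proof -
  let ?f = "\<lambda>f::'a \<Rightarrow> real. \<Sum>i\<in>Basis. f i *\<^sub>R i"
  have "rational_points \<subseteq> ?f ` (Basis \<rightarrow>\<^sub>E \<rat>)"
  proof
    fix a :: 'a assume "a \<in> rational_points"
    then have "(\<lambda>i\<in>Basis. a \<bullet> i) \<in> Basis \<rightarrow>\<^sub>E \<rat>" by (auto simp: rational_points_def)
    moreover have "a = ?f (\<lambda>i\<in>Basis. a \<bullet> i)" by (simp add: euclidean_representation)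
    ultimately show "a \<in> ?f ` (Basis \<rightarrow>\<^sub>E \<rat>)" by blast
  qed
  moreover have "countable (Basis \<rightarrow>\<^sub>E \<rat> :: ('a \<Rightarrow> real) set)"
    by (rule countable_PiE[OF finite_Basis countable_rat])
  ultimately show ?thesis by (rule countable_subset[OF _ countable_image])
qed

lemma rational_box_basis:
  "topological_basis {box a b | a b::'a::euclidean_space. a \<in> rational_points \<and> b \<in> rational_points}"
proof (rule topological_basisI)
  fix U :: "'a set" and x assume "open U" "x \<in> U"
  then obtain e where e: "e > 0" "ball x e \<subseteq> U" by (meson openE)
  obtain a b where "\<forall>i\<in>Basis. a \<bullet> i \<in> \<rat> \<and> b \<bullet> i \<in> \<rat>" "x \<in> box a b" "box a b \<subseteq> ball x e"
    using rational_boxes[OF e(1), of x] by auto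
  then show "\<exists>B'\<in>{box a b |a b. a \<in> rational_points \<and> b \<in> rational_points}. x \<in> B' \<and> B' \<subseteq> U"
    using e(2) unfolding rational_points_def by blast
qed auto

lemma borel_eq_rational_boxes:
  "borel = sigma UNIV {box a b | a b::'a::euclidean_space. a \<in> rational_points \<and> b \<in> rational_points}"
proof (rule borel_eq_countable_basis[OF _ rational_box_basis])
  have "{box a b | a b::'a. a \<in> rational_points \<and> b \<in> rational_points}
      = (\<lambda>(a, b). box a b) ` (rational_points \<times> rational_points)" by auto
  then show "countable {box a b | a b::'a. a \<in> rational_points \<and> b \<in> rational_points}"
    by (simp add: countable_rational_points)
qed

text \<open>The densities \<open>h\<^sup>+\<close> and \<open>h\<^sup>-\<close> define two measures which agree on the rational boxes, an
  intersection-stable generator of the Borel sets; hence they agree, and densities are unique.\<close>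
lemma AE_eq_zero_box:
  fixes h :: "'a::euclidean_space \<Rightarrow> real"
  assumes h: "integrable lborel h"
    and zero: "\<And>a b. a \<in> rational_points \<Longrightarrow> b \<in> rational_points \<Longrightarrow>
      (LINT x|lborel. h x * indicator (box a b) x) = 0"
  shows "AE x in lborel. h x = 0"
proof -
  have [measurable]: "h \<in> borel_measurable borel" using h by auto
  let ?M = "\<lambda>s::real. density lborel (\<lambda>x. ennreal (s * h x))"
  let ?E = "{box a b | a b::'a. a \<in> rational_points \<and> b \<in> rational_points}"
  have nn: "(\<integral>\<^sup>+x. ennreal (s * h x) * indicator (box a b) x \<partial>lborel)
      = ennreal (LINT x|lborel. max 0 (s * h x) * indicator (box a b) x)" if "s = 1 \<or> s = -1" for a b s
  proof -
    have "(\<integral>\<^sup>+x. ennreal (s * h x) * indicator (box a b) x \<partial>lborel)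
      = (\<integral>\<^sup>+x. ennreal (max 0 (s * h x) * indicator (box a b) x) \<partial>lborel)"
      by (intro nn_integral_cong) (auto simp: indicator_def max_def ennreal_neg)
    also have "\<dots> = ennreal (LINT x|lborel. max 0 (s * h x) * indicator (box a b) x)"
      by (rule nn_integral_eq_integral)
        (use h that in \<open>auto intro!: integrable_real_mult_indicator integrable_max\<close>)
    finally show ?thesis .
  qed
  have "?M 1 = ?M (-1)"
  proof (rule measure_eqI_generator_eq)
    show "Int_stable ?E"
    proof (rule Int_stableI)
      fix X Y assume "X \<in> ?E" "Y \<in> ?E"
      then obtain a b c d where *: "X = box a b" "Y = box c d" "a \<in> rational_points"
        "b \<in> rational_points" "c \<in> rational_points" "d \<in> rational_points" by auto
      show "X \<inter> Y \<in> ?E"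
        unfolding * box_Int_box
        using *(3-) by (auto simp: rational_points_def max_def min_def intro!: exI)
    qed
    show "emeasure (?M 1) X = emeasure (?M (-1)) X" if "X \<in> ?E" for X
    proof -
      obtain a b where ab: "X = box a b" "a \<in> rational_points" "b \<in> rational_points" using \<open>X \<in> ?E\<close> by auto
      have "(LINT x|lborel. max 0 (1 * h x) * indicator (box a b) x)
          - (LINT x|lborel. max 0 (- 1 * h x) * indicator (box a b) x)
         = (LINT x|lborel. max 0 (1 * h x) * indicator (box a b) x - max 0 (- 1 * h x) * indicator (box a b) x)"
        by (rule Bochner_Integration.integral_diff[symmetric])
          (use h in \<open>auto intro!: integrable_real_mult_indicator integrable_max\<close>)
      also have "\<dots> = (LINT x|lborel. h x * indicator (box a b) x)"
        by (intro Bochner_Integration.integral_cong) (auto simp: indicator_def max_def)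
      finally have "(LINT x|lborel. max 0 (1 * h x) * indicator (box a b) x)
          = (LINT x|lborel. max 0 (- 1 * h x) * indicator (box a b) x)"
        using zero[OF ab(2,3)] by simp
      then show ?thesis
        using nn[of 1 a b] nn[of "-1" a b] unfolding ab(1) by (simp add: emeasure_density)
    qed
    show "sets (?M 1) = sigma_sets UNIV ?E" "sets (?M (-1)) = sigma_sets UNIV ?E"
      by (simp_all add: borel_eq_rational_boxes)
    let ?A = "\<lambda>n::nat. box (- (real n *\<^sub>R One)) (real n *\<^sub>R One) :: 'a set"
    have "real n *\<^sub>R One \<in> rational_points" "- (real n *\<^sub>R One) \<in> (rational_points :: 'a set)" for n
      by (auto simp: rational_points_def)
    then show "range ?A \<subseteq> ?E" by blast
    show "(\<Union>i. ?A i) = UNIV" by (rule UN_box_eq_UNIV)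
    show "emeasure (?M 1) (?A i) \<noteq> \<infinity>" for i
      using nn[of 1 "- (real i *\<^sub>R One)" "real i *\<^sub>R One"] by (simp add: emeasure_density)
  qed auto
  then have "AE x in lborel. ennreal (1 * h x) = ennreal (- 1 * h x)"
    by (intro sigma_finite_measure.density_unique[OF sigma_finite_lborel]) auto
  then show ?thesis
  proof eventually_elim
    case (elim x)
    then show ?case by (cases "h x \<ge> 0") (auto simp: ennreal_neg)
  qed
qed

lemma locally_integrable_linear:
  assumes "locally_integrable U f" "bounded_linear L"
  shows "locally_integrable U (\<lambda>x. L (f x))"
  using assms unfolding locally_integrable_def by (auto intro: integrable_bounded_linear)

lemma locally_integrable_diff:
  assumes "locally_integrable U f" "locally_integrable U g"
  shows "locally_integrable U (\<lambda>x. f x - g x)"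
  using assms unfolding locally_integrable_def by auto

lemma continuous_imp_lebesgue_measurable:
  fixes f :: "'a::euclidean_space \<Rightarrow> 'b::topological_space"
  shows "continuous_on UNIV f \<Longrightarrow> f \<in> borel_measurable lebesgue"
  by (rule measurable_completion) (simp add: borel_measurable_continuous_onI)

text \<open>The fundamental lemma of the calculus of variations, for countably many tests: as the bumps increase to
  indicators of boxes, dominated convergence turns the hypothesis into vanishing integrals over all rational boxes
  inside a given box, and \<open>U\<close> is a countable union of boxes.\<close>
lemma AE_zero_of_bumps:
  fixes g :: "'a::euclidean_space \<Rightarrow> real"
  assumes U: "open U" and g: "locally_integrable U g"
    and zero: "\<And>a b m. a \<in> rational_points \<Longrightarrow> b \<in> rational_points \<Longrightarrow> cbox a b \<subseteq> U \<Longrightarrow>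
      (LINT x|lebesgue_on U. g x * bump a b m x) = 0"
  shows "AE x in lebesgue_on U. g x = 0"
proof -
  have [measurable]: "U \<in> sets lebesgue" using U by auto
  have on_box: "AE x in lebesgue. x \<in> box c d \<longrightarrow> g x = 0"
    if cd: "c \<in> rational_points" "d \<in> rational_points" "cbox c d \<subseteq> U" for c d
  proof -
    define G where "G x = g x * indicator (box c d) x" for x
    have "integrable (lebesgue_on (cbox c d)) g"
      using g cd by (auto simp: locally_integrable_def)
    then have "integrable lebesgue (\<lambda>x. indicator (cbox c d) x *\<^sub>R g x)"
      by (subst (asm) integrable_restrict_space) auto
    then have "integrable lebesgue (\<lambda>x. (indicator (cbox c d) x *\<^sub>R g x) * indicator (box c d) x)"
      by (intro integrable_real_mult_indicator) auto
    moreover have "(indicator (cbox c d) x *\<^sub>R g x) * indicator (box c d) x = G x" for x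
      using box_subset_cbox[of c d] by (auto simp: indicator_def G_def)
    ultimately have G: "integrable lebesgue G" by simp
    then have [measurable]: "G \<in> borel_measurable lebesgue" by auto
    have [measurable]: "box a b \<in> sets lebesgue" for a b :: 'a by auto
    have Gzero: "(LINT x|lebesgue. G x * indicator (box a b) x) = 0"
      if ab: "a \<in> rational_points" "b \<in> rational_points" for a b
    proof -
      obtain a' b' where ab': "a' \<in> rational_points" "b' \<in> rational_points" "cbox a' b' \<subseteq> U"
        "box c d \<inter> box a b = box a' b'"
      proof
        let ?a = "\<Sum>i\<in>Basis. max (c \<bullet> i) (a \<bullet> i) *\<^sub>R i" and ?b = "\<Sum>i\<in>Basis. min (d \<bullet> i) (b \<bullet> i) *\<^sub>R i"
        show "?a \<in> rational_points" "?b \<in> rational_points"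
          using ab cd by (auto simp: rational_points_def max_def min_def)
        show "box c d \<inter> box a b = box ?a ?b" by (rule box_Int_box)
        have "cbox ?a ?b = cbox c d \<inter> cbox a b" by (simp add: Int_interval)
        then show "cbox ?a ?b \<subseteq> U" using cd by auto
      qed
      have meas: "bump a' b' m \<in> borel_measurable lebesgue" for m
        using bump_smooth[of 0 a' b' m] by (simp add: continuous_imp_lebesgue_measurable)
      have "(\<lambda>m. LINT x|lebesgue. G x * bump a' b' m x) \<longlonglongrightarrow> (LINT x|lebesgue. G x * indicator (box a' b') x)"
      proof (rule integral_dominated_convergence[where w = "\<lambda>x. \<bar>G x\<bar>"])
        show "AE x in lebesgue. (\<lambda>m. G x * bump a' b' m x) \<longlonglongrightarrow> G x * indicator (box a' b') x"
          by (intro AE_I2 tendsto_mult bump_tendsto tendsto_const)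
        show "AE x in lebesgue. norm (G x * bump a' b' m x) \<le> \<bar>G x\<bar>" for m
          by (intro AE_I2) (auto simp: abs_mult bump_bounds intro!: mult_left_le)
      qed (use G meas in auto)
      moreover have "(LINT x|lebesgue. G x * bump a' b' m x) = 0" for m
      proof -
        have "(LINT x|lebesgue. G x * bump a' b' m x) = (LINT x|lebesgue. indicator U x *\<^sub>R (g x * bump a' b' m x))"
        proof (intro Bochner_Integration.integral_cong refl)
          fix x
          show "G x * bump a' b' m x = indicator U x *\<^sub>R (g x * bump a' b' m x)"
            using bump_outside[of x a' b' m] ab'(3,4) box_subset_cbox[of a' b']
            by (cases "x \<in> box a' b'") (auto simp: G_def indicator_def)
        qed
        also have "\<dots> = (LINT x|lebesgue_on U. g x * bump a' b' m x)"
          by (subst integral_restrict_space) auto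
        finally show ?thesis using zero ab' by simp
      qed
      ultimately have "(LINT x|lebesgue. G x * indicator (box a' b') x) = 0"
        by (simp add: LIMSEQ_const_iff)
      moreover have "G x * indicator (box a' b') x = G x * indicator (box a b) x" for x
        using ab'(4) by (auto simp: G_def indicator_def)
      ultimately show ?thesis by simp
    qed
    obtain h where h[measurable]: "h \<in> borel_measurable lborel" and Gh: "AE x in lborel. G x = h x"
      using completion_ex_borel_measurable_real[of G lborel] by auto
    have [measurable]: "h \<in> borel_measurable lebesgue" by (rule measurable_completion[OF h])
    have Gh': "AE x in lebesgue. G x = h x" using Gh by (simp add: AE_completion_iff)
    have "integrable lebesgue h"
      using G Gh' by (subst integrable_cong_AE[of _ _ G]) auto
    then have hi: "integrable lborel h" by (simp add: integrable_completion)
    have "AE x in lborel. h x = 0"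
    proof (rule AE_eq_zero_box[OF hi])
      fix a b :: 'a assume ab: "a \<in> rational_points" "b \<in> rational_points"
      have "(LINT x|lborel. h x * indicator (box a b) x) = (LINT x|lebesgue. h x * indicator (box a b) x)"
        by (subst integral_completion) auto
      also have "\<dots> = (LINT x|lebesgue. G x * indicator (box a b) x)"
        using Gh' by (intro integral_cong_AE) auto
      finally show "(LINT x|lborel. h x * indicator (box a b) x) = 0" using Gzero[OF ab] by simp
    qed
    with Gh have "AE x in lborel. x \<in> box c d \<longrightarrow> g x = 0"
      by eventually_elim (auto simp: G_def)
    then show ?thesis by (rule AE_completion)
  qed
  define \<D> where "\<D> = {(c, d). c \<in> rational_points \<and> d \<in> rational_points \<and> cbox c d \<subseteq> U}"
  have "countable \<D>"
    by (rule countable_subset[of _ "rational_points \<times> rational_points"])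
      (auto simp: \<D>_def countable_rational_points)
  moreover have "\<forall>q\<in>\<D>. AE x in lebesgue. x \<in> box (fst q) (snd q) \<longrightarrow> g x = 0"
    using on_box by (auto simp: \<D>_def)
  ultimately have "AE x in lebesgue. \<forall>q\<in>\<D>. x \<in> box (fst q) (snd q) \<longrightarrow> g x = 0"
    by (simp only: AE_ball_countable)
  then have "AE x in lebesgue. x \<in> U \<longrightarrow> g x = 0"
  proof eventually_elim
    case (elim x)
    show ?case
    proof
      assume "x \<in> U"
      then obtain e where e: "e > 0" "ball x e \<subseteq> U" using U by (meson openE)
      obtain c d where cd: "\<forall>i\<in>Basis. c \<bullet> i \<in> \<rat> \<and> d \<bullet> i \<in> \<rat>" "x \<in> box c d" "box c d \<subseteq> ball x (e/2)"
        using rational_boxes[of "e/2" x] e by auto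
      have "cbox c d = closure (box c d)" using cd(2) by (subst closure_box) auto
      also have "\<dots> \<subseteq> cball x (e/2)" using cd(3) by (intro closure_minimal) (auto simp: subset_eq)
      also have "\<dots> \<subseteq> ball x e" using e by auto
      finally have "(c, d) \<in> \<D>" using cd(1) e by (auto simp: \<D>_def rational_points_def)
      then show "g x = 0" using bspec[OF elim] cd(2) by fastforce
    qed
  qed
  then show ?thesis by (subst AE_restrict_space_iff) auto
qed

lemma integrable_mult_compact_support:
  fixes g \<psi> :: "'a::euclidean_space \<Rightarrow> real"
  assumes U: "open U" and g: "locally_integrable U g"
    and \<psi>: "continuous_on UNIV \<psi>" "compact K" "K \<subseteq> U" "\<And>x. x \<notin> K \<Longrightarrow> \<psi> x = 0"
  shows "integrable (lebesgue_on U) (\<lambda>x. g x * \<psi> x)"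
proof -
  have K: "K \<in> sets lebesgue" using \<psi>(2) by (simp add: borel_compact)
  have UL: "U \<in> sets lebesgue" using U by auto
  have "integrable (lebesgue_on K) g" using g \<psi> by (auto simp: locally_integrable_def)
  then have *: "integrable lebesgue (\<lambda>x. indicator K x *\<^sub>R g x)"
    using K by (subst (asm) integrable_restrict_space) auto
  have "bounded (\<psi> ` K)"
    using \<psi> by (intro compact_imp_bounded compact_continuous_image) (auto intro: continuous_on_subset)
  then obtain B where B: "\<And>x. x \<in> K \<Longrightarrow> \<bar>\<psi> x\<bar> \<le> B" by (auto simp: bounded_iff)
  have m: "\<psi> \<in> borel_measurable lebesgue"
    using \<psi>(1) by (rule continuous_imp_lebesgue_measurable)
  have "integrable lebesgue (\<lambda>x. (indicator K x *\<^sub>R g x) * \<psi> x)"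
  proof (rule Bochner_Integration.integrable_bound[OF integrable_mult_left[OF *, of B]])
    show "AE x in lebesgue. norm ((indicator K x *\<^sub>R g x) * \<psi> x) \<le> norm ((indicator K x *\<^sub>R g x) * B)"
    proof (intro AE_I2)
      fix x
      show "norm ((indicator K x *\<^sub>R g x) * \<psi> x) \<le> norm ((indicator K x *\<^sub>R g x) * B)"
        using B[of x] by (cases "x \<in> K") (auto simp: abs_mult intro!: mult_left_mono)
    qed
    show "(\<lambda>x. (indicator K x *\<^sub>R g x) * \<psi> x) \<in> borel_measurable lebesgue"
      using borel_measurable_integrable[OF *] m by (rule borel_measurable_times)
  qed
  moreover have "(\<lambda>x. (indicator K x *\<^sub>R g x) * \<psi> x) = (\<lambda>x. indicator U x *\<^sub>R (g x * \<psi> x))"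
    using \<psi>(3,4) by (fastforce simp: indicator_def)
  ultimately show ?thesis using UL by (subst integrable_restrict_space) simp_all
qed

lemma test_functions_support:
  "\<phi> \<in> test_functions U \<Longrightarrow> x \<notin> closure {x. \<phi> x \<noteq> 0} \<Longrightarrow> \<phi> x = 0"
  using closure_subset[of "{x. \<phi> x \<noteq> 0}"] by auto

lemma integrable_mult_test_function:
  assumes U: "open U" and g: "locally_integrable U g" and \<phi>: "\<phi> \<in> test_functions U"
  shows "integrable (lebesgue_on U) (\<lambda>x. g x * \<phi> x :: real)"
proof (rule integrable_mult_compact_support[OF U g])
  have "Ck 0 \<phi>" using \<phi> unfolding test_functions_def by blast
  then show "continuous_on UNIV \<phi>" by simp
  show "compact (closure {x. \<phi> x \<noteq> 0})" "closure {x. \<phi> x \<noteq> 0} \<subseteq> U"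
    using \<phi> unfolding test_functions_def by blast+
  show "\<phi> x = 0" if "x \<notin> closure {x. \<phi> x \<noteq> 0}" for x
    using test_functions_support[OF \<phi> that] .
qed

lemma bounded_linear_matrix_entry: "bounded_linear (\<lambda>E::real^'n::finite^'m::finite. E $ i $ j)"
  by (rule bounded_linear_compose[OF bounded_linear_vec_nth bounded_linear_vec_nth])

lemma matrix_AE_eqI:
  fixes E F :: "'a \<Rightarrow> real^'n::finite^'m::finite"
  assumes "\<And>i j. AE x in M. E x $ i $ j = F x $ i $ j"
  shows "AE x in M. E x = F x"
proof -
  have "AE x in M. \<forall>i j. E x $ i $ j = F x $ i $ j"
    by (intro eventually_all_finite assms)
  then show ?thesis by (simp add: vec_eq_iff)
qed

text \<open>All memberships and norms involving \<open>sym_grad\<close> are therefore independent of the choice that its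
  definition makes.\<close>
lemma has_sym_grad_unique:
  assumes U: "open U" and E: "has_sym_grad e U u E" and F: "has_sym_grad e U u F"
  shows "AE x in lebesgue_on U. E x = F x"
proof (rule matrix_AE_eqI)
  fix i j
  have li: "locally_integrable U (\<lambda>x. E x $ i $ j)" "locally_integrable U (\<lambda>x. F x $ i $ j)"
    using E F by (auto simp: has_sym_grad_def intro: locally_integrable_linear[OF _ bounded_linear_matrix_entry])
  have "AE x in lebesgue_on U. E x $ i $ j - F x $ i $ j = 0"
  proof (rule AE_zero_of_bumps[OF U locally_integrable_diff[OF li]])
    fix a b m assume "cbox a b \<subseteq> U"
    then have t: "bump a b m \<in> test_functions U" by (rule bump_test_function)
    have "(LINT x|lebesgue_on U. (E x $ i $ j - F x $ i $ j) * bump a b m x)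
      = (LINT x|lebesgue_on U. E x $ i $ j * bump a b m x) - (LINT x|lebesgue_on U. F x $ i $ j * bump a b m x)"
      unfolding left_diff_distrib
      by (intro Bochner_Integration.integral_diff integrable_mult_test_function[OF U _ t] li)
    also have "\<dots> = 0" using E F t by (simp add: has_sym_grad_def)
    finally show "(LINT x|lebesgue_on U. (E x $ i $ j - F x $ i $ j) * bump a b m x) = 0" .
  qed
  then show "AE x in lebesgue_on U. E x $ i $ j = F x $ i $ j" by simp
qed

section \<open>Averages over balls and over segments\<close>

lemma nn_integral_lborel_translate:
  fixes f :: "'a::euclidean_space \<Rightarrow> ennreal"
  assumes [measurable]: "f \<in> borel_measurable borel"
  shows "(\<integral>\<^sup>+x. f (x + a) \<partial>lborel) = (\<integral>\<^sup>+x. f x \<partial>lborel)"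
proof -
  have "(\<integral>\<^sup>+x. f x \<partial>lborel) = (\<integral>\<^sup>+x. f x \<partial>distr lborel borel ((+) a))"
    by (simp only: lborel_distr_plus)
  also have "\<dots> = (\<integral>\<^sup>+x. f (x + a) \<partial>lborel)"
    by (subst nn_integral_distr) (auto simp: add.commute)
  finally show ?thesis by simp
qed

lemma nn_integral_lborel_scale:
  fixes f :: "'a::euclidean_space \<Rightarrow> ennreal"
  assumes [measurable]: "f \<in> borel_measurable borel" and c: "c \<noteq> 0"
  shows "(\<integral>\<^sup>+z. ennreal (\<bar>c\<bar> ^ DIM('a)) * f (y + c *\<^sub>R z) \<partial>lborel) = (\<integral>\<^sup>+x. f x \<partial>lborel)"
proof -
  have "(\<integral>\<^sup>+x. f x \<partial>lborel) = (\<integral>\<^sup>+x. f x \<partial>density (distr lborel borel (\<lambda>x. y + c *\<^sub>R x)) (\<lambda>_. \<bar>c\<bar> ^ DIM('a)))"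
    by (simp only: lborel_affine[OF c, symmetric])
  also have "\<dots> = (\<integral>\<^sup>+z. ennreal (\<bar>c\<bar> ^ DIM('a)) * f (y + c *\<^sub>R z) \<partial>lborel)"
    by (simp add: nn_integral_density nn_integral_distr)
  finally show ?thesis by simp
qed

definition near_int :: "real \<Rightarrow> ('a::euclidean_space \<Rightarrow> ennreal) \<Rightarrow> 'a \<Rightarrow> ennreal" where
  "near_int R g x = (\<integral>\<^sup>+z. g (x + z) * indicator (ball 0 R) z \<partial>lborel)"

text \<open>In dimension \<open>d \<ge> 2\<close> this is bounded by a multiple of the Riesz potential
  \<open>\<integral> g y \<bar>x - y\<bar>\<^sup>1\<^sup>-\<^sup>d dy\<close> truncated at distance \<open>R\<close>. Keeping the parameter \<open>\<tau>\<close> along the segments avoids the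
  singular kernel: all estimates reduce to the translation and scaling behaviour of Lebesgue measure.\<close>
definition ray_int :: "real \<Rightarrow> ('a::euclidean_space \<Rightarrow> ennreal) \<Rightarrow> 'a \<Rightarrow> ennreal" where
  "ray_int R g x = (\<integral>\<^sup>+\<tau>. (\<integral>\<^sup>+z. g (x + \<tau> *\<^sub>R z) * indicator (ball 0 R) z \<partial>lborel)
      * indicator {0<..1} \<tau> \<partial>lborel)"

lemma indicator_ball_measurable[measurable]:
  "(indicator (ball a R) :: 'a::euclidean_space \<Rightarrow> ennreal) \<in> borel_measurable borel"
  by (rule borel_measurable_indicator) auto

lemma indicator_unit_measurable[measurable]:
  "(indicator {0<..1::real} :: real \<Rightarrow> ennreal) \<in> borel_measurable borel"
  by (rule borel_measurable_indicator) auto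

lemma near_int_measurable[measurable]:
  assumes [measurable]: "g \<in> borel_measurable borel"
  shows "near_int R g \<in> borel_measurable borel"
  unfolding near_int_def[abs_def] by measurable

lemma ray_int_measurable[measurable]:
  assumes [measurable]: "g \<in> borel_measurable borel"
  shows "ray_int R g \<in> borel_measurable borel"
  unfolding ray_int_def[abs_def] by measurable

lemma near_int_add:
  assumes [measurable]: "f \<in> borel_measurable borel" "g \<in> borel_measurable borel"
  shows "near_int R (\<lambda>x. f x + g x) x = near_int R f x + near_int R g x"
  unfolding near_int_def distrib_right by (rule nn_integral_add; measurable)

lemma ray_int_add:
  assumes [measurable]: "f \<in> borel_measurable borel" "g \<in> borel_measurable borel"
  shows "ray_int R (\<lambda>x. f x + g x) x = ray_int R f x + ray_int R g x"
proof -
  have "(\<integral>\<^sup>+z. (f (x + \<tau> *\<^sub>R z) + g (x + \<tau> *\<^sub>R z)) * indicator (ball 0 R) z \<partial>lborel)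
    = (\<integral>\<^sup>+z. f (x + \<tau> *\<^sub>R z) * indicator (ball 0 R) z \<partial>lborel)
      + (\<integral>\<^sup>+z. g (x + \<tau> *\<^sub>R z) * indicator (ball 0 R) z \<partial>lborel)" for \<tau>
    unfolding distrib_right by (rule nn_integral_add; measurable)
  then show ?thesis
    unfolding ray_int_def by (simp only: distrib_right) (rule nn_integral_add; measurable)
qed

lemma near_int_cmult:
  assumes [measurable]: "f \<in> borel_measurable borel"
  shows "near_int R (\<lambda>x. c * f x) x = c * near_int R f x"
  unfolding near_int_def mult.assoc by (rule nn_integral_cmult; measurable)

lemma ray_int_cmult:
  assumes [measurable]: "f \<in> borel_measurable borel"
  shows "ray_int R (\<lambda>x. c * f x) x = c * ray_int R f x"
proof -
  have "(\<integral>\<^sup>+z. c * f (x + \<tau> *\<^sub>R z) * indicator (ball 0 R) z \<partial>lborel)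
    = c * (\<integral>\<^sup>+z. f (x + \<tau> *\<^sub>R z) * indicator (ball 0 R) z \<partial>lborel)" for \<tau>
    unfolding mult.assoc by (rule nn_integral_cmult; measurable)
  then show ?thesis
    unfolding ray_int_def by (simp only: mult.assoc) (rule nn_integral_cmult; measurable)
qed

lemma near_int_mono: "(\<And>y. f y \<le> g y) \<Longrightarrow> near_int R f x \<le> near_int R g x"
  unfolding near_int_def by (intro nn_integral_mono mult_right_mono) auto

text \<open>The points \<open>x + \<tau> z\<close> that enter \<open>ray_int R f x\<close> stay at distance less than \<open>R\<close> from \<open>x\<close>, where a
  continuous exponent is almost constant. This locality is what makes the variable exponent manageable.\<close>
lemma ray_int_mono:
  assumes "\<And>y. dist x y < R \<Longrightarrow> f y \<le> g y"
  shows "ray_int R f x \<le> ray_int R g x"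
  unfolding ray_int_def
proof (intro nn_integral_mono)
  fix \<tau> :: real
  show "(\<integral>\<^sup>+z. f (x + \<tau> *\<^sub>R z) * indicator (ball 0 R) z \<partial>lborel) * indicator {0<..1} \<tau>
     \<le> (\<integral>\<^sup>+z. g (x + \<tau> *\<^sub>R z) * indicator (ball 0 R) z \<partial>lborel) * indicator {0<..1} \<tau>"
  proof (cases "\<tau> \<in> {0<..1}")
    case True
    have "f (x + \<tau> *\<^sub>R z) * indicator (ball 0 R) z \<le> g (x + \<tau> *\<^sub>R z) * indicator (ball 0 R) z" for z
    proof (cases "norm z < R")
      case nz: True
      have "dist x (x + \<tau> *\<^sub>R z) = \<tau> * norm z" using True by (simp add: dist_norm)
      also have "\<dots> \<le> 1 * norm z" using True by (intro mult_right_mono) auto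
      finally show ?thesis using assms nz by (simp add: mult_right_mono)
    qed auto
    then show ?thesis by (intro mult_right_mono[OF nn_integral_mono]) auto
  qed simp
qed

lemma ray_int_const: "ray_int R (\<lambda>_. c) (x::'a::euclidean_space) = c * emeasure lborel (ball (0::'a) R)"
  unfolding ray_int_def by (simp add: nn_integral_cmult nn_integral_cmult_indicator)

lemma near_int_le: 
  assumes [measurable]: "g \<in> borel_measurable borel"
  shows "near_int R g x \<le> (\<integral>\<^sup>+x. g x \<partial>lborel)"
proof -
  have "near_int R g x \<le> (\<integral>\<^sup>+z. g (z + x) \<partial>lborel)"
    unfolding near_int_def by (intro nn_integral_mono) (auto simp: indicator_def add.commute)
  then show ?thesis by (simp add: nn_integral_lborel_translate)
qed

lemma nn_integral_near_int:
  fixes g :: "'a::euclidean_space \<Rightarrow> ennreal"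
  assumes [measurable]: "g \<in> borel_measurable borel"
  shows "(\<integral>\<^sup>+x. near_int R g x \<partial>lborel) = (\<integral>\<^sup>+x. g x \<partial>lborel) * emeasure lborel (ball (0::'a) R)"
proof -
  have "(\<integral>\<^sup>+x. near_int R g x \<partial>lborel) = (\<integral>\<^sup>+z. (\<integral>\<^sup>+x. g (x + z) * indicator (ball 0 R) z \<partial>lborel) \<partial>lborel)"
    unfolding near_int_def by (rule lborel_pair.Fubini') measurable
  also have "\<dots> = (\<integral>\<^sup>+z. (\<integral>\<^sup>+x. g x \<partial>lborel) * indicator (ball (0::'a) R) z \<partial>lborel)"
    by (simp add: nn_integral_multc nn_integral_lborel_translate[OF assms])
  finally show ?thesis by (simp add: nn_integral_cmult_indicator)
qed

lemma powr_le_one_plus_powr: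
  fixes a s q :: real
  assumes "0 \<le> a" "0 \<le> s" "s \<le> q"
  shows "a powr s \<le> 1 + a powr q"
proof (cases "a \<le> 1")
  case True
  then have "a powr s \<le> 1" using assms by (intro powr_le1) auto
  then show ?thesis using powr_ge_zero[of a q] by linarith
next
  case False
  then have "a powr s \<le> a powr q" using assms by (intro powr_mono) auto
  then show ?thesis by simp
qed

text \<open>The substitute for Jensen's inequality: integrated against a probability measure it bounds the mean of
  \<open>a\<close> by \<open>\<gamma>\<close> plus a multiple of the mean of \<open>a\<^sup>s\<close>, and \<open>\<gamma>\<close> can be absorbed if it is a small fraction of that mean.\<close>
lemma le_truncation:
  fixes a \<gamma> s :: real
  assumes "0 \<le> a" "0 < \<gamma>" "1 \<le> s"
  shows "a \<le> \<gamma> + \<gamma> powr (1 - s) * a powr s"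
proof (cases "a \<le> \<gamma>")
  case True then show ?thesis by (simp add: add_increasing2)
next
  case False
  then have "a = a powr (1 - s) * a powr s" using assms by (simp flip: powr_add)
  also have "\<dots> \<le> \<gamma> powr (1 - s) * a powr s"
    using False assms by (intro mult_right_mono powr_mono2') auto
  finally show ?thesis using assms by simp
qed

text \<open>Convexity of the power: \<open>le_truncation\<close> is averaged with \<open>\<gamma>\<close> a small multiple of \<open>b\<close>, so that its
  first term can be absorbed. The dominating function \<open>h\<close> lets the exponent at \<open>x\<close> be replaced by the exponents
  at the points where \<open>g\<close> is evaluated.\<close>
lemma powr_le_of_ray_int:
  fixes g :: "'a::euclidean_space \<Rightarrow> real" and h :: "'a \<Rightarrow> ennreal"
  assumes [measurable]: "g \<in> borel_measurable borel" "h \<in> borel_measurable borel"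
    and g: "\<And>y. 0 \<le> g y" and B: "emeasure lborel (ball (0::'a) R) = ennreal B" "0 \<le> B"
    and c: "0 < c" and b: "0 \<le> b" and s: "1 \<le> s" "s \<le> P"
    and N: "N = (2 * B + 2) / c"
    and bnd: "ennreal (c * b) \<le> ennreal (B + 1) + ray_int R (\<lambda>y. ennreal (g y)) x"
    and gh: "\<And>y. dist x y < R \<Longrightarrow> ennreal (g y powr s) \<le> h y"
  shows "ennreal (b powr s) \<le> ennreal (max 1 (N powr P)) * (1 + ray_int R h x)"
proof (cases "b = 0 \<or> ray_int R h x = \<infinity>")
  case True
  then show ?thesis
  proof
    assume "ray_int R h x = \<infinity>"
    moreover have "0 < max 1 (N powr P)" by (simp add: less_max_iff_disj)
    then have "ennreal (max 1 (N powr P)) \<noteq> 0" by (simp only: ennreal_eq_0_iff not_le)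
    ultimately show ?thesis by (simp add: ennreal_mult_top)
  qed simp
next
  case False
  then have b: "b > 0" and fin: "ray_int R h x < \<infinity>" using b by (auto simp: less_top)
  define H where "H = enn2real (ray_int R h x)"
  have H: "ray_int R h x = ennreal H" "0 \<le> H" using fin by (auto simp: H_def)
  have N0: "N > 0" using N B c by simp
  \<comment> \<open>\<open>N\<close> is chosen such that \<open>c b = (2 B + 2) \<gamma>\<close>: for \<open>\<gamma> \<ge> 1\<close> this exceeds \<open>\<gamma> B + (B + 1)\<close> by at
    least \<open>\<gamma>\<close>.\<close>
  define \<gamma> where "\<gamma> = b / N"
  have \<gamma>: "\<gamma> > 0" using b N0 by (simp add: \<gamma>_def)
  have "ray_int R (\<lambda>y. ennreal (g y)) x \<le> ray_int R (\<lambda>y. ennreal \<gamma> + ennreal (\<gamma> powr (1 - s)) * h y) x"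
  proof (rule ray_int_mono)
    fix y assume y: "dist x y < R"
    have "ennreal (g y) \<le> ennreal (\<gamma> + \<gamma> powr (1 - s) * g y powr s)"
      using le_truncation[OF g \<gamma> s(1)] by (intro ennreal_leI)
    also have "\<dots> = ennreal \<gamma> + ennreal (\<gamma> powr (1 - s)) * ennreal (g y powr s)"
      using \<gamma> by (simp add: ennreal_plus ennreal_mult)
    also have "\<dots> \<le> ennreal \<gamma> + ennreal (\<gamma> powr (1 - s)) * h y"
      using gh[OF y] by (intro add_left_mono mult_left_mono) auto
    finally show "ennreal (g y) \<le> ennreal \<gamma> + ennreal (\<gamma> powr (1 - s)) * h y" .
  qed
  also have "\<dots> = ennreal (\<gamma> * B + \<gamma> powr (1 - s) * H)"
    using \<gamma> B(2) H(2) by (simp add: ray_int_add ray_int_cmult ray_int_const B(1) H(1) ennreal_plus ennreal_mult)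
  finally have "ennreal (c * b) \<le> ennreal (B + 1) + ennreal (\<gamma> * B + \<gamma> powr (1 - s) * H)"
    using bnd by (meson add_left_mono order_trans)
  also have "\<dots> = ennreal (B + 1 + (\<gamma> * B + \<gamma> powr (1 - s) * H))"
    using \<gamma> B(2) H(2) by (intro ennreal_plus[symmetric]) auto
  finally have "c * b \<le> B + 1 + (\<gamma> * B + \<gamma> powr (1 - s) * H)"
    using \<gamma> B(2) H(2) by (subst (asm) ennreal_le_iff) auto
  moreover have "2 * B + 2 = N * c" using N c by simp
  then have "c * b = (2 * B + 2) * \<gamma>" using N0 by (simp add: \<gamma>_def)
  ultimately have main: "(B + 2) * \<gamma> \<le> B + 1 + \<gamma> powr (1 - s) * H" by (simp add: algebra_simps)
  have "\<gamma> powr s \<le> 1 + H"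
  proof (cases "\<gamma> \<le> 1")
    case True
    then have "\<gamma> powr s \<le> 1" using \<gamma> s by (intro powr_le1) auto
    then show ?thesis using H by simp
  next
    case False
    then have "B + 1 \<le> (B + 1) * \<gamma>" using B(2) by (simp add: mult_left_le)
    then have "\<gamma> \<le> \<gamma> powr (1 - s) * H" using main by (simp add: algebra_simps)
    then have "\<gamma> powr (s - 1) * \<gamma> \<le> \<gamma> powr (s - 1) * (\<gamma> powr (1 - s) * H)"
      by (intro mult_left_mono) auto
    also have "\<dots> = H" using \<gamma> by (simp flip: mult.assoc powr_add)
    also have "\<gamma> powr (s - 1) * \<gamma> = \<gamma> powr s"
      using \<gamma> by (simp add: powr_diff)
    finally show ?thesis by simp
  qed
  moreover have "b powr s = N powr s * \<gamma> powr s"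
    using N0 b by (simp add: \<gamma>_def powr_mult[symmetric])
  moreover have "N powr s \<le> max 1 (N powr P)"
    using N0 s by (cases "N \<le> 1") (auto simp: le_max_iff_disj intro: powr_le1 powr_mono)
  ultimately have "b powr s \<le> max 1 (N powr P) * (1 + H)"
    by (auto intro!: mult_mono)
  then have "ennreal (b powr s) \<le> ennreal (max 1 (N powr P) * (1 + H))" by (rule ennreal_leI)
  also have "\<dots> = ennreal (max 1 (N powr P)) * (1 + ennreal H)"
    using H(2) by (simp add: ennreal_mult ennreal_plus)
  finally show ?thesis by (simp add: H)
qed


text \<open>Substituting \<open>y = x + \<tau> z\<close> exchanges the two functions up to the reflection \<open>z \<mapsto> - z\<close>, under
  which the ball is invariant.\<close>
lemma ray_int_self_adjoint:
  fixes w h :: "'a::euclidean_space \<Rightarrow> ennreal"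
  assumes [measurable]: "w \<in> borel_measurable borel" "h \<in> borel_measurable borel"
  shows "(\<integral>\<^sup>+x. w x * ray_int R h x \<partial>lborel) = (\<integral>\<^sup>+y. h y * ray_int R w y \<partial>lborel)"
proof -
  define J where "J \<tau> f x = (\<integral>\<^sup>+z. f (x + \<tau> *\<^sub>R z) * indicator (ball 0 R) z \<partial>lborel)"
    for \<tau> and f :: "'a \<Rightarrow> ennreal" and x
  have J_measurable: "(\<lambda>(x, \<tau>). J \<tau> f x) \<in> borel_measurable (borel \<Otimes>\<^sub>M borel)"
    if [measurable]: "f \<in> borel_measurable borel" for f
    unfolding J_def by measurable
  note [measurable] = J_measurable[OF assms(1)] J_measurable[OF assms(2)]
  have swap: "(\<integral>\<^sup>+x. f x * ray_int R g x \<partial>lborel)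
      = (\<integral>\<^sup>+\<tau>. (\<integral>\<^sup>+x. f x * J \<tau> g x \<partial>lborel) * indicator {0<..1} \<tau> \<partial>lborel)"
    if [measurable]: "f \<in> borel_measurable borel" "g \<in> borel_measurable borel" for f g :: "'a \<Rightarrow> ennreal"
  proof -
    note [measurable] = J_measurable[OF that(2)]
    have "f x * ray_int R g x = (\<integral>\<^sup>+\<tau>. f x * (J \<tau> g x * indicator {0<..1} \<tau>) \<partial>lborel)" for x
      unfolding ray_int_def J_def[symmetric] by (rule nn_integral_cmult[symmetric]) measurable
    then have "(\<integral>\<^sup>+x. f x * ray_int R g x \<partial>lborel)
      = (\<integral>\<^sup>+x. (\<integral>\<^sup>+\<tau>. f x * (J \<tau> g x * indicator {0<..1} \<tau>) \<partial>lborel) \<partial>lborel)"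
      by simp
    also have "\<dots> = (\<integral>\<^sup>+\<tau>. (\<integral>\<^sup>+x. f x * (J \<tau> g x * indicator {0<..1} \<tau>) \<partial>lborel) \<partial>lborel)"
      by (rule lborel_pair.Fubini') measurable
    also have "\<dots> = (\<integral>\<^sup>+\<tau>. (\<integral>\<^sup>+x. f x * J \<tau> g x \<partial>lborel) * indicator {0<..1} \<tau> \<partial>lborel)"
      unfolding mult.assoc[symmetric] by (subst nn_integral_multc) measurable
    finally show ?thesis .
  qed
  have "(\<integral>\<^sup>+x. w x * J \<tau> h x \<partial>lborel) = (\<integral>\<^sup>+x. h x * J \<tau> w x \<partial>lborel)" for \<tau>
  proof -
    have J_eq: "f x * J \<tau> g x = (\<integral>\<^sup>+z. f x * g (x + \<tau> *\<^sub>R z) * indicator (ball 0 R) z \<partial>lborel)"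
      if [measurable]: "g \<in> borel_measurable borel" for f g :: "'a \<Rightarrow> ennreal" and x
      unfolding J_def mult.assoc by (rule nn_integral_cmult[symmetric]) measurable
    have J_swap: "(\<integral>\<^sup>+x. f x * J \<tau> g x \<partial>lborel)
      = (\<integral>\<^sup>+z. (\<integral>\<^sup>+x. f x * g (x + \<tau> *\<^sub>R z) \<partial>lborel) * indicator (ball 0 R) z \<partial>lborel)"
      if [measurable]: "f \<in> borel_measurable borel" "g \<in> borel_measurable borel" for f g :: "'a \<Rightarrow> ennreal"
    proof -
      have "(\<integral>\<^sup>+x. f x * J \<tau> g x \<partial>lborel)
        = (\<integral>\<^sup>+z. (\<integral>\<^sup>+x. f x * g (x + \<tau> *\<^sub>R z) * indicator (ball 0 R) z \<partial>lborel) \<partial>lborel)"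
        unfolding J_eq[OF that(2)] by (rule lborel_pair.Fubini') measurable
      then show ?thesis by (simp add: nn_integral_multc)
    qed
    have shift: "(\<integral>\<^sup>+x. w x * h (x + \<tau> *\<^sub>R z) \<partial>lborel) = (\<integral>\<^sup>+x. h x * w (x - \<tau> *\<^sub>R z) \<partial>lborel)" for z
      using nn_integral_lborel_translate[of "\<lambda>x. h x * w (x - \<tau> *\<^sub>R z)" "\<tau> *\<^sub>R z"]
      by (simp add: mult.commute)
    have "(\<integral>\<^sup>+x. w x * J \<tau> h x \<partial>lborel)
      = (\<integral>\<^sup>+z. (\<integral>\<^sup>+x. h x * w (x - \<tau> *\<^sub>R z) \<partial>lborel) * indicator (ball 0 R) z \<partial>lborel)"
      by (simp add: J_swap shift)
    also have "\<dots> = (\<integral>\<^sup>+z. (\<integral>\<^sup>+x. h x * w (x + \<tau> *\<^sub>R z) \<partial>lborel) * indicator (ball 0 R) z \<partial>lborel)"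
      by (subst nn_integral_lborel_scale[where c = "-1" and y = 0, symmetric])
        (auto simp: indicator_def intro!: nn_integral_cong)
    finally show ?thesis by (simp add: J_swap)
  qed
  then show ?thesis by (simp add: swap)
qed

lemma nn_integral_ray_int:
  fixes g :: "'a::euclidean_space \<Rightarrow> ennreal"
  assumes [measurable]: "g \<in> borel_measurable borel"
  shows "(\<integral>\<^sup>+x. ray_int R g x \<partial>lborel) = (\<integral>\<^sup>+x. g x \<partial>lborel) * emeasure lborel (ball (0::'a) R)"
  using ray_int_self_adjoint[of "\<lambda>_. 1" g R] by (simp add: ray_int_const nn_integral_multc)

lemma nn_integral_inverse_sqrt:
  "(\<integral>\<^sup>+\<tau>. ennreal (\<tau> powr (-1/2)) * indicator {0<..1::real} \<tau> \<partial>lborel) = 2"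
proof -
  \<comment> \<open>The endpoint \<open>0\<close> contributes \<open>0 powr (-1/2) = 0\<close>.\<close>
  have "((\<lambda>\<tau>. \<tau> powr (-1/2)) has_integral 2) {0..1::real}"
    using has_integral_powr_from_0[of "-1/2" 1] by simp
  then have "(\<integral>\<^sup>+\<tau>. ennreal (indicator {0..1} \<tau> * \<tau> powr (-1/2)) \<partial>lborel) = ennreal 2"
    by (intro nn_integral_has_integral_lebesgue) auto
  moreover have "(\<integral>\<^sup>+\<tau>. ennreal (indicator {0..1} \<tau> * \<tau> powr (-1/2)) \<partial>lborel)
    = (\<integral>\<^sup>+\<tau>. ennreal (\<tau> powr (-1/2)) * indicator {0<..1::real} \<tau> \<partial>lborel)"
    by (intro nn_integral_cong) (auto simp: indicator_def)
  ultimately show ?thesis by simp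
qed

lemma near_int_le_measure_plus_one:
  fixes v :: "'a::euclidean_space \<Rightarrow> real"
  assumes [measurable]: "v \<in> borel_measurable borel" and v: "\<And>x. 0 \<le> v x"
    and v2: "(\<integral>\<^sup>+x. ennreal ((v x)\<^sup>2) \<partial>lborel) \<le> 1"
  shows "near_int R (\<lambda>x. ennreal (v x)) x \<le> emeasure lborel (ball (0::'a) R) + 1"
proof -
  have le: "v y \<le> 1 + (v y)\<^sup>2" for y
    using powr_le_one_plus_powr[of "v y" 1 2] v[of y] by simp
  have "near_int R (\<lambda>x. ennreal (v x)) x \<le> near_int R (\<lambda>x. 1 + ennreal ((v x)\<^sup>2)) x"
    using le by (intro near_int_mono) (simp flip: ennreal_1 ennreal_plus add: ennreal_leI)
  also have "\<dots> = near_int R (\<lambda>x. 1) x + near_int R (\<lambda>x. ennreal ((v x)\<^sup>2)) x"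
    by (rule near_int_add) measurable
  also have "near_int R (\<lambda>x. 1) x = emeasure lborel (ball (0::'a) R)" by (simp add: near_int_def)
  also have "near_int R (\<lambda>x. ennreal ((v x)\<^sup>2)) x \<le> 1"
    using near_int_le[of "\<lambda>x. ennreal ((v x)\<^sup>2)" R x] v2 by (auto intro: order_trans)
  finally show ?thesis by (simp add: add_left_mono)
qed

text \<open>At parameter \<open>\<tau>\<close> the substitution \<open>x = y + \<tau> z\<close> costs a factor \<open>\<tau>\<^sup>-\<^sup>d\<close>; applied to
  \<open>v\<^sup>1\<^sup>/\<^sup>d\<close> instead of \<open>v\<^sup>2\<close>, this loss shrinks to \<open>\<tau>\<^sup>-\<^sup>1\<^sup>/\<^sup>2\<close>, which is integrable. This is where the
  admissible oscillation \<open>1/d\<close> of the exponent comes from.\<close>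
lemma ray_int_powr_le:
  fixes v :: "'a::euclidean_space \<Rightarrow> real"
  assumes [measurable]: "v \<in> borel_measurable borel" and v: "\<And>x. 0 \<le> v x"
    and v2: "(\<integral>\<^sup>+x. ennreal ((v x)\<^sup>2) \<partial>lborel) \<le> 1"
  shows "ray_int R (\<lambda>x. ennreal (v x powr (1 / DIM('a)))) y \<le> 2 * (emeasure lborel (ball (0::'a) R) + 1)"
proof -
  let ?d = "DIM('a)" and ?B = "emeasure lborel (ball (0::'a) R)"
  have "(\<integral>\<^sup>+z. ennreal (v (y + \<tau> *\<^sub>R z) powr (1 / ?d)) * indicator (ball 0 R) z \<partial>lborel)
      \<le> ennreal (\<tau> powr (-1/2)) * (?B + 1)" if \<tau>: "\<tau> \<in> {0<..1}" for \<tau>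
  proof -
    have "v x powr (1 / ?d) \<le> \<tau> powr (-1/2) * (1 + \<bar>\<tau>\<bar> ^ ?d * (v x)\<^sup>2)" for x
    proof -
      \<comment> \<open>The weight is such that \<open>w\<^sup>2 = \<tau>\<^sup>d v\<^sup>2\<close>, and its integral over \<open>z\<close> at \<open>y + \<tau> z\<close> does
        not depend on \<open>\<tau>\<close>.\<close>
      define w where "w = \<tau> powr (?d / 2) * v x"
      have w: "w \<ge> 0" using v by (simp add: w_def)
      have "w powr (1 / ?d) = \<tau> powr (1/2) * v x powr (1 / ?d)"
        using v[of x] by (simp add: w_def powr_mult powr_powr)
      moreover have "w powr 2 = \<bar>\<tau>\<bar> ^ ?d * (v x)\<^sup>2"
        using v[of x] \<tau> by (simp add: w_def powr_mult powr_powr powr_realpow[symmetric])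
      moreover have "w powr (1 / ?d) \<le> 1 + w powr 2"
      proof (rule powr_le_one_plus_powr[OF w])
        have "1 / real ?d \<le> 1" using DIM_positive[where 'a='a] by (simp add: Suc_le_eq)
        then show "1 / real ?d \<le> 2" by linarith
      qed simp
      ultimately have "\<tau> powr (-1/2) * (\<tau> powr (1/2) * v x powr (1 / ?d)) \<le> \<tau> powr (-1/2) * (1 + \<bar>\<tau>\<bar> ^ ?d * (v x)\<^sup>2)"
        by (intro mult_left_mono) auto
      then show ?thesis using \<tau> by (simp flip: mult.assoc powr_add)
    qed
    then have "(\<integral>\<^sup>+z. ennreal (v (y + \<tau> *\<^sub>R z) powr (1 / ?d)) * indicator (ball 0 R) z \<partial>lborel)
      \<le> (\<integral>\<^sup>+z. ennreal (\<tau> powr (-1/2)) * (indicator (ball 0 R) z + ennreal (\<bar>\<tau>\<bar> ^ ?d) * ennreal ((v (y + \<tau> *\<^sub>R z))\<^sup>2)) \<partial>lborel)"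
      by (intro nn_integral_mono)
        (auto simp: indicator_def ennreal_leI simp flip: ennreal_mult ennreal_1 ennreal_plus)
    also have "\<dots> = ennreal (\<tau> powr (-1/2)) * (\<integral>\<^sup>+z. (indicator (ball 0 R) z + ennreal (\<bar>\<tau>\<bar> ^ ?d) * ennreal ((v (y + \<tau> *\<^sub>R z))\<^sup>2)) \<partial>lborel)"
      by (rule nn_integral_cmult) measurable
    also have "(\<integral>\<^sup>+z. (indicator (ball 0 R) z + ennreal (\<bar>\<tau>\<bar> ^ ?d) * ennreal ((v (y + \<tau> *\<^sub>R z))\<^sup>2)) \<partial>lborel)
      = ?B + (\<integral>\<^sup>+z. ennreal (\<bar>\<tau>\<bar> ^ ?d) * ennreal ((v (y + \<tau> *\<^sub>R z))\<^sup>2) \<partial>lborel)"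
      by (subst nn_integral_add) auto
    also have "(\<integral>\<^sup>+z. ennreal (\<bar>\<tau>\<bar> ^ ?d) * ennreal ((v (y + \<tau> *\<^sub>R z))\<^sup>2) \<partial>lborel) = (\<integral>\<^sup>+x. ennreal ((v x)\<^sup>2) \<partial>lborel)"
      using \<tau> by (intro nn_integral_lborel_scale) auto
    also have "ennreal (\<tau> powr (-1/2)) * (?B + (\<integral>\<^sup>+x. ennreal ((v x)\<^sup>2) \<partial>lborel)) \<le> ennreal (\<tau> powr (-1/2)) * (?B + 1)"
      using v2 by (intro mult_left_mono add_left_mono) auto
    finally show ?thesis .
  qed
  then have "ray_int R (\<lambda>x. ennreal (v x powr (1 / ?d))) y
    \<le> (\<integral>\<^sup>+\<tau>. (ennreal (\<tau> powr (-1/2)) * indicator {0<..1} \<tau>) * (?B + 1) \<partial>lborel)"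
    unfolding ray_int_def by (intro nn_integral_mono) (auto simp: indicator_def)
  also have "\<dots> = 2 * (?B + 1)"
    by (subst nn_integral_multc, measurable) (simp only: nn_integral_inverse_sqrt)
  finally show ?thesis .
qed

text \<open>The central estimate. Let \<open>s = max 1 (q x - 1/d)\<close>. Where \<open>v \<ge> 1\<close>, one has \<open>v\<^sup>q \<le> v\<^sup>1\<^sup>/\<^sup>d v\<^sup>s\<close>. Since
  \<open>s \<le> q y\<close> for all \<open>y\<close> near \<open>x\<close>, the power \<open>v\<^sup>s\<close> is dominated by one plus the ray integral of
  \<open>h = 1 + g\<^sup>q\<close>. It remains to integrate \<open>v\<^sup>1\<^sup>/\<^sup>d\<close> against the ray integral of \<open>h\<close>; by self-adjointness this is
  the integral of \<open>h\<close> against the ray integral of \<open>v\<^sup>1\<^sup>/\<^sup>d\<close>, which is bounded.\<close>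
lemma modular_le_of_ray_bound:
  fixes v g q :: "'a::euclidean_space \<Rightarrow> real" and \<Omega> :: "'a set"
  assumes [measurable]: "v \<in> borel_measurable borel" "g \<in> borel_measurable borel" "q \<in> borel_measurable borel"
      "\<Omega> \<in> sets borel"
    and v: "\<And>x. 0 \<le> v x" and g: "\<And>x. 0 \<le> g x" "\<And>x. x \<notin> \<Omega> \<Longrightarrow> g x = 0"
    and v2: "(\<integral>\<^sup>+x. ennreal ((v x)\<^sup>2) \<partial>lborel) \<le> 1"
    and bnd: "AE x in lborel. ennreal (c * v x) \<le> near_int R (\<lambda>x. ennreal (v x)) x + ray_int R (\<lambda>x. ennreal (g x)) x"
    and c: "0 < c"
    and q: "\<And>x. x \<in> \<Omega> \<Longrightarrow> 1 \<le> q x" "\<And>x. x \<in> \<Omega> \<Longrightarrow> q x \<le> P"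
      "\<And>x y. x \<in> \<Omega> \<Longrightarrow> y \<in> \<Omega> \<Longrightarrow> dist x y < R \<Longrightarrow> q x - q y \<le> 1 / DIM('a)"
    and B: "emeasure lborel (ball (0::'a) R) = ennreal B" "0 \<le> B"
    and L: "L = max 1 (((2 * B + 2) / c) powr P)"
  shows "(\<integral>\<^sup>+x. ennreal (v x powr q x) * indicator \<Omega> x \<partial>lborel)
    \<le> emeasure lborel \<Omega> + ennreal L * (emeasure lborel \<Omega> + 1)
      + ennreal L * (2 * (ennreal B + 1) * (emeasure lborel \<Omega> + (\<integral>\<^sup>+x. ennreal (g x powr q x) * indicator \<Omega> x \<partial>lborel)))"
proof -
  let ?\<delta> = "1 / real DIM('a)"
  have d: "0 < ?\<delta>" "?\<delta> \<le> 1" using DIM_positive[where 'a='a] by (auto simp: Suc_le_eq)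
  define h where "h y = (1 + ennreal (g y powr q y)) * indicator \<Omega> y" for y
  define w where "w x = ennreal (v x powr ?\<delta>)" for x
  have [measurable]: "h \<in> borel_measurable borel" "w \<in> borel_measurable borel"
    unfolding h_def[abs_def] w_def[abs_def] by measurable
  have L0: "0 \<le> L" using L by simp
  have pointwise: "ennreal (v x powr q x) * indicator \<Omega> x
      \<le> indicator \<Omega> x + ennreal L * (w x * indicator \<Omega> x) + ennreal L * (w x * ray_int R h x)"
    if b: "ennreal (c * v x) \<le> near_int R (\<lambda>x. ennreal (v x)) x + ray_int R (\<lambda>x. ennreal (g x)) x" for x
  proof (cases "x \<in> \<Omega>")
    case x: True
    define s where "s = max 1 (q x - ?\<delta>)"
    have "ennreal (v x powr s) \<le> ennreal (max 1 (((2 * B + 2) / c) powr P)) * (1 + ray_int R h x)"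
    proof (rule powr_le_of_ray_int[where g = g, OF _ _ g(1) B c v _ _ refl])
      show "1 \<le> s" by (simp add: s_def)
      show "s \<le> P" unfolding s_def using q(1,2)[OF x] d by (intro max.boundedI) linarith+
      have "near_int R (\<lambda>x. ennreal (v x)) x \<le> ennreal (B + 1)"
        using near_int_le_measure_plus_one[of v R x] v v2 B by (simp add: ennreal_plus)
      then show "ennreal (c * v x) \<le> ennreal (B + 1) + ray_int R (\<lambda>x. ennreal (g x)) x"
        using b by (meson add_right_mono order_trans)
      fix y assume y: "dist x y < R"
      show "ennreal (g y powr s) \<le> h y"
      proof (cases "y \<in> \<Omega>")
        case True
        then have "s \<le> q y" using q(1)[OF True] q(3)[OF x True y] by (auto simp: s_def)
        then have "g y powr s \<le> 1 + g y powr q y"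
          using g(1) by (intro powr_le_one_plus_powr) (auto simp: s_def)
        then have "ennreal (g y powr s) \<le> ennreal (1 + g y powr q y)" by (rule ennreal_leI)
        also have "\<dots> = h y" using True by (simp add: h_def ennreal_plus)
        finally show ?thesis .
      qed (simp add: g(2))
    qed measurable
    then have s: "ennreal (v x powr s) \<le> ennreal L * (1 + ray_int R h x)" by (simp add: L)
    have "v x powr q x \<le> 1 + v x powr (?\<delta> + s)"
      using v[of x] q(1)[OF x] by (intro powr_le_one_plus_powr) (auto simp: s_def)
    then have "ennreal (v x powr q x) \<le> ennreal (1 + v x powr ?\<delta> * v x powr s)"
      by (intro ennreal_leI) (simp add: powr_add)
    also have "\<dots> = 1 + w x * ennreal (v x powr s)"
      by (simp add: w_def ennreal_plus ennreal_mult)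
    also have "\<dots> \<le> 1 + w x * (ennreal L * (1 + ray_int R h x))"
      using s by (intro add_left_mono mult_left_mono) auto
    also have "\<dots> = 1 + ennreal L * w x + ennreal L * (w x * ray_int R h x)"
      by (simp add: distrib_left mult_ac add_ac)
    finally show ?thesis using x by simp
  qed simp
  have "(\<integral>\<^sup>+x. w x * ray_int R h x \<partial>lborel) = (\<integral>\<^sup>+y. h y * ray_int R w y \<partial>lborel)"
    by (rule ray_int_self_adjoint) measurable
  also have "(\<integral>\<^sup>+y. h y * ray_int R w y \<partial>lborel) \<le> (\<integral>\<^sup>+y. 2 * (ennreal B + 1) * h y \<partial>lborel)"
  proof (rule nn_integral_mono)
    fix y
    have "ray_int R w y \<le> 2 * (ennreal B + 1)"
      unfolding w_def B(1)[symmetric] by (rule ray_int_powr_le[OF _ v v2]) measurable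
    then show "h y * ray_int R w y \<le> 2 * (ennreal B + 1) * h y"
      by (simp add: mult.commute mult_left_mono)
  qed
  also have "(\<integral>\<^sup>+y. 2 * (ennreal B + 1) * h y \<partial>lborel) = 2 * (ennreal B + 1) * (\<integral>\<^sup>+y. h y \<partial>lborel)"
    by (rule nn_integral_cmult) measurable
  also have "(\<integral>\<^sup>+y. h y \<partial>lborel) = emeasure lborel \<Omega> + (\<integral>\<^sup>+x. ennreal (g x powr q x) * indicator \<Omega> x \<partial>lborel)"
    unfolding h_def distrib_right by (subst nn_integral_add) auto
  finally have I_ray: "(\<integral>\<^sup>+x. w x * ray_int R h x \<partial>lborel)
    \<le> 2 * (ennreal B + 1) * (emeasure lborel \<Omega> + (\<integral>\<^sup>+x. ennreal (g x powr q x) * indicator \<Omega> x \<partial>lborel))" .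
  have I_w: "(\<integral>\<^sup>+x. w x * indicator \<Omega> x \<partial>lborel) \<le> emeasure lborel \<Omega> + 1"
  proof -
    have "w x * indicator \<Omega> x \<le> indicator \<Omega> x + ennreal ((v x)\<^sup>2)" for x
    proof -
      have "?\<delta> \<le> 2" using d by linarith
      then have "v x powr ?\<delta> \<le> 1 + v x powr 2"
        by (rule powr_le_one_plus_powr[OF v less_imp_le[OF d(1)]])
      then have "v x powr ?\<delta> \<le> 1 + (v x)\<^sup>2" using v[of x] by simp
      then have "w x \<le> ennreal (1 + (v x)\<^sup>2)" unfolding w_def by (rule ennreal_leI)
      also have "\<dots> = 1 + ennreal ((v x)\<^sup>2)" by (simp add: ennreal_plus)
      finally show ?thesis by (simp add: indicator_def)
    qed
    then have "(\<integral>\<^sup>+x. w x * indicator \<Omega> x \<partial>lborel) \<le> (\<integral>\<^sup>+x. indicator \<Omega> x + ennreal ((v x)\<^sup>2) \<partial>lborel)"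
      by (intro nn_integral_mono)
    also have "\<dots> = emeasure lborel \<Omega> + (\<integral>\<^sup>+x. ennreal ((v x)\<^sup>2) \<partial>lborel)"
      by (subst nn_integral_add) auto
    also have "\<dots> \<le> emeasure lborel \<Omega> + 1" using v2 by (rule add_left_mono)
    finally show ?thesis .
  qed
  have "(\<integral>\<^sup>+x. ennreal (v x powr q x) * indicator \<Omega> x \<partial>lborel)
    \<le> (\<integral>\<^sup>+x. indicator \<Omega> x + ennreal L * (w x * indicator \<Omega> x) + ennreal L * (w x * ray_int R h x) \<partial>lborel)"
    using bnd by (intro nn_integral_mono_AE) (auto elim!: eventually_mono intro: pointwise)
  also have "\<dots> = emeasure lborel \<Omega> + ennreal L * (\<integral>\<^sup>+x. w x * indicator \<Omega> x \<partial>lborel)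
      + ennreal L * (\<integral>\<^sup>+x. w x * ray_int R h x \<partial>lborel)"
    by (simp add: nn_integral_add nn_integral_cmult)
  also have "\<dots> \<le> emeasure lborel \<Omega> + ennreal L * (emeasure lborel \<Omega> + 1)
      + ennreal L * (2 * (ennreal B + 1) * (emeasure lborel \<Omega> + (\<integral>\<^sup>+x. ennreal (g x powr q x) * indicator \<Omega> x \<partial>lborel)))"
    by (intro add_mono mult_left_mono I_ray I_w order_refl) auto
  finally show ?thesis .
qed

section \<open>A pointwise bound for smooth vector fields\<close>

definition sym_jacobian :: "(real^'n::finite \<Rightarrow> real^'n) \<Rightarrow> real^'n \<Rightarrow> real^'n^'n" where
  "sym_jacobian \<phi> x = (\<chi> i j. (frechet_derivative \<phi> (at x) (dirs j) $ i + frechet_derivative \<phi> (at x) (dirs i) $ j) / 2)"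

lemma continuous_sym_jacobian:
  assumes "Ck 1 \<phi>"
  shows "continuous_on UNIV (sym_jacobian \<phi>)"
proof -
  have "continuous_on UNIV (\<lambda>x. frechet_derivative \<phi> (at x) (dirs j))" for j
    using assms by (auto simp: dirs_def axis_in_Basis_iff)
  then have *: "continuous_on UNIV (\<lambda>x. frechet_derivative \<phi> (at x) (dirs j) $ i)" for i j
    by (rule bounded_linear.continuous_on[OF bounded_linear_vec_nth])
  then show ?thesis
    unfolding sym_jacobian_def[abs_def] by (intro continuous_on_vec_lambda continuous_on_divide continuous_on_add *) auto
qed

text \<open>A quadratic form sees only the symmetric part of its matrix. This is why the derivative of
  \<open>z \<bullet> \<phi>\<close> in the direction \<open>z\<close> is controlled by the symmetric gradient.\<close>
lemma inner_frechet_eq_sym_jacobian: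
  fixes \<phi> :: "real^'n::finite \<Rightarrow> real^'n"
  assumes "linear (frechet_derivative \<phi> (at x))"
  shows "z \<bullet> frechet_derivative \<phi> (at x) z = (\<Sum>i\<in>UNIV. z $ i * (sym_jacobian \<phi> x $ i \<bullet> z))"
proof -
  let ?D = "frechet_derivative \<phi> (at x)"
  have z: "z = (\<Sum>j\<in>UNIV. z $ j *\<^sub>R dirs j)"
    unfolding dirs_def using basis_expansion[of z] by (simp add: scalar_mult_eq_scaleR)
  have "?D z = (\<Sum>j\<in>UNIV. z $ j *\<^sub>R ?D (dirs j))"
    by (subst z) (simp add: linear_sum[OF assms] linear_scale[OF assms])
  then have "z \<bullet> ?D z = (\<Sum>i\<in>UNIV. \<Sum>j\<in>UNIV. z $ i * z $ j * ?D (dirs j) $ i)"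
    by (simp add: inner_vec_def sum_distrib_left mult.assoc)
  moreover have "(\<Sum>i\<in>UNIV. \<Sum>j\<in>UNIV. z $ i * z $ j * ?D (dirs j) $ i)
      = (\<Sum>i\<in>UNIV. \<Sum>j\<in>UNIV. z $ i * z $ j * ?D (dirs i) $ j)"
    by (subst sum.swap) (simp add: mult.commute)
  moreover have "(\<Sum>i\<in>UNIV. z $ i * (sym_jacobian \<phi> x $ i \<bullet> z))
      = ((\<Sum>i\<in>UNIV. \<Sum>j\<in>UNIV. z $ i * z $ j * ?D (dirs j) $ i)
        + (\<Sum>i\<in>UNIV. \<Sum>j\<in>UNIV. z $ i * z $ j * ?D (dirs i) $ j)) / 2"
    by (simp add: inner_vec_def sym_jacobian_def sum_distrib_left sum_divide_distrib
        flip: sum.distrib) (simp add: field_simps)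
  ultimately show ?thesis by simp
qed

lemma quadratic_form_bound:
  fixes S :: "real^'n^'n::finite"
  shows "\<bar>\<Sum>i\<in>UNIV. z $ i * (S $ i \<bullet> z)\<bar> \<le> (norm z)\<^sup>2 * norm S"
proof -
  have "\<bar>\<Sum>i\<in>UNIV. z $ i * (S $ i \<bullet> z)\<bar> \<le> (\<Sum>i\<in>UNIV. \<bar>z $ i\<bar> * \<bar>norm (S $ i) * norm z\<bar>)"
    by (rule order_trans[OF sum_abs])
      (auto simp: abs_mult intro!: sum_mono mult_left_mono Cauchy_Schwarz_ineq2)
  also have "\<dots> \<le> L2_set (\<lambda>i. z $ i) UNIV * L2_set (\<lambda>i. norm (S $ i) * norm z) UNIV"
    by (rule L2_set_mult_ineq)
  also have "L2_set (\<lambda>i. z $ i) UNIV = norm z" by (simp add: norm_vec_def L2_set_def)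
  also have "L2_set (\<lambda>i. norm (S $ i) * norm z) UNIV = norm S * norm z"
    by (simp add: L2_set_left_distrib norm_vec_def)
  finally show ?thesis by (simp add: power2_eq_square mult_ac)
qed

lemma has_real_derivative_along_line:
  fixes v :: "'a::euclidean_space \<Rightarrow> real"
  assumes D: "(v has_derivative D) (at (x + \<tau> *\<^sub>R b))"
  shows "((\<lambda>\<tau>. v (x + \<tau> *\<^sub>R b)) has_real_derivative D b) (at \<tau>)"
proof -
  have "((\<lambda>\<tau>. x + \<tau> *\<^sub>R b) has_derivative (\<lambda>h. h *\<^sub>R b)) (at \<tau>)"
    by (auto intro!: derivative_eq_intros)
  from has_derivative_compose[OF this D] show ?thesis
    unfolding has_field_derivative_def
    by (simp add: linear_scale[OF has_derivative_linear[OF D]] mult.commute[of _ "D b"])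
qed

text \<open>The fundamental theorem of calculus for \<open>\<tau> \<mapsto> z \<bullet> \<phi> (x + \<tau> z)\<close>.\<close>
lemma ray_estimate:
  fixes \<phi> :: "real^'n::finite \<Rightarrow> real^'n"
  assumes \<phi>: "Ck 1 \<phi>"
  shows "ennreal \<bar>z \<bullet> \<phi> x\<bar> \<le> ennreal (norm z * norm (\<phi> (x + z)))
     + (\<integral>\<^sup>+\<tau>. ennreal ((norm z)\<^sup>2 * norm (sym_jacobian \<phi> (x + \<tau> *\<^sub>R z))) * indicator {0<..1} \<tau> \<partial>lborel)"
proof -
  let ?D = "\<lambda>y. frechet_derivative \<phi> (at y)"
  define f where "f \<tau> = (\<Sum>i\<in>UNIV. z $ i * (sym_jacobian \<phi> (x + \<tau> *\<^sub>R z) $ i \<bullet> z))" for \<tau>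
  have D: "(\<phi> has_derivative ?D y) (at y)" for y
    using Ck_differentiable[of 0] \<phi> by simp
  have lin: "linear (?D y)" for y by (rule has_derivative_linear[OF D])
  have f_eq: "f \<tau> = z \<bullet> ?D (x + \<tau> *\<^sub>R z) z" for \<tau>
    unfolding f_def by (rule inner_frechet_eq_sym_jacobian[OF lin, symmetric])
  have der: "((\<lambda>\<tau>. z \<bullet> \<phi> (x + \<tau> *\<^sub>R z)) has_vector_derivative f \<tau>) (at \<tau> within {0..1})" for \<tau>
  proof -
    have "((\<lambda>\<tau>. z \<bullet> \<phi> (x + \<tau> *\<^sub>R z)) has_real_derivative f \<tau>) (at \<tau>)"
      unfolding f_eq by (rule has_real_derivative_along_line[OF has_derivative_inner_right[OF D]])
    then show ?thesis
      unfolding has_real_derivative_iff_has_vector_derivative by (rule has_vector_derivative_at_within)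
  qed
  have cS: "continuous_on UNIV (sym_jacobian \<phi>)" by (rule continuous_sym_jacobian[OF \<phi>])
  have "continuous_on {0..1} (\<lambda>\<tau>. sym_jacobian \<phi> (x + \<tau> *\<^sub>R z))"
    by (intro continuous_on_compose2[OF cS] continuous_intros) auto
  then have cont: "continuous_on {0..1} f"
    unfolding f_def
    by (intro continuous_intros bounded_linear.continuous_on[OF bounded_linear_vec_nth])
  have hb: "has_bochner_integral lborel (\<lambda>\<tau>. indicator {0..1} \<tau> *\<^sub>R f \<tau>) (z \<bullet> \<phi> (x + 1 *\<^sub>R z) - z \<bullet> \<phi> (x + 0 *\<^sub>R z))"
    by (rule has_bochner_integral_FTC_Icc[OF zero_le_one der cont])
  have "ennreal (norm (LINT \<tau>|lborel. indicator {0..1} \<tau> *\<^sub>R f \<tau>))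
    \<le> (\<integral>\<^sup>+\<tau>. ennreal (norm (indicator {0..1} \<tau> *\<^sub>R f \<tau>)) \<partial>lborel)"
    using hb by (intro integral_norm_bound_ennreal) (auto simp: has_bochner_integral_iff)
  also have "\<dots> \<le> (\<integral>\<^sup>+\<tau>. ennreal ((norm z)\<^sup>2 * norm (sym_jacobian \<phi> (x + \<tau> *\<^sub>R z))) * indicator {0<..1} \<tau> \<partial>lborel)"
  proof (rule nn_integral_mono_AE)
    show "AE \<tau> in lborel. ennreal (norm (indicator {0..1} \<tau> *\<^sub>R f \<tau>))
      \<le> ennreal ((norm z)\<^sup>2 * norm (sym_jacobian \<phi> (x + \<tau> *\<^sub>R z))) * indicator {0<..1} \<tau>"
      using AE_lborel_singleton[of "0::real"]
    proof eventually_elim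
      case (elim \<tau>)
      have "\<bar>f \<tau>\<bar> \<le> (norm z)\<^sup>2 * norm (sym_jacobian \<phi> (x + \<tau> *\<^sub>R z))"
        unfolding f_def by (rule quadratic_form_bound)
      then show ?case using elim by (auto simp: indicator_def intro: ennreal_leI)
    qed
  qed
  finally have int: "ennreal \<bar>z \<bullet> \<phi> (x + z) - z \<bullet> \<phi> x\<bar>
    \<le> (\<integral>\<^sup>+\<tau>. ennreal ((norm z)\<^sup>2 * norm (sym_jacobian \<phi> (x + \<tau> *\<^sub>R z))) * indicator {0<..1} \<tau> \<partial>lborel)"
    using hb by (simp add: has_bochner_integral_iff)
  have "\<bar>z \<bullet> \<phi> x\<bar> \<le> norm z * norm (\<phi> (x + z)) + \<bar>z \<bullet> \<phi> (x + z) - z \<bullet> \<phi> x\<bar>"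
    using Cauchy_Schwarz_ineq2[of z "\<phi> (x + z)"] by linarith
  then have "ennreal \<bar>z \<bullet> \<phi> x\<bar> \<le> ennreal (norm z * norm (\<phi> (x + z)) + \<bar>z \<bullet> \<phi> (x + z) - z \<bullet> \<phi> x\<bar>)"
    by (rule ennreal_leI)
  also have "\<dots> = ennreal (norm z * norm (\<phi> (x + z))) + ennreal \<bar>z \<bullet> \<phi> (x + z) - z \<bullet> \<phi> x\<bar>"
    by (rule ennreal_plus) auto
  finally show ?thesis using int by (meson add_left_mono order_trans)
qed

text \<open>A fixed vector is recovered from its components in the directions of a ball: around the point of length
  \<open>R / 2\<close> in the direction of \<open>a\<close>, a whole ball of directions sees a definite fraction of \<open>a\<close>.\<close>
lemma nn_integral_abs_inner_ball:
  fixes a :: "'a::euclidean_space"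
  assumes R: "0 < R"
  shows "ennreal (R / 4 * measure lborel (ball (0::'a) (R / 4)) * norm a)
     \<le> (\<integral>\<^sup>+z. ennreal \<bar>z \<bullet> a\<bar> * indicator (ball 0 R) z \<partial>lborel)"
proof (cases "a = 0")
  case False
  define w where "w = (R / (2 * norm a)) *\<^sub>R a"
  have nw: "norm w = R / 2" "w \<bullet> a = R / 2 * norm a"
    using False R by (auto simp: w_def dot_square_norm power2_eq_square)
  have "ennreal (R / 4 * norm a) * indicator (ball w (R / 4)) z \<le> ennreal \<bar>z \<bullet> a\<bar> * indicator (ball 0 R) z" for z
  proof (cases "z \<in> ball w (R / 4)")
    case True
    then have d: "norm (z - w) < R / 4" by (simp add: dist_norm norm_minus_commute)
    have "norm z < R" using norm_triangle_ineq[of w "z - w"] d nw(1) R by simp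
    moreover have "\<bar>(z - w) \<bullet> a\<bar> \<le> R / 4 * norm a"
      using Cauchy_Schwarz_ineq2[of "z - w" a] d
      by (smt (verit, best) mult_right_mono norm_ge_zero)
    then have "R / 4 * norm a \<le> \<bar>z \<bullet> a\<bar>" using nw(2) unfolding inner_diff_left by linarith
    ultimately show ?thesis using True by (simp add: ennreal_leI)
  qed simp
  then have "(\<integral>\<^sup>+z. ennreal (R / 4 * norm a) * indicator (ball w (R / 4)) z \<partial>lborel)
    \<le> (\<integral>\<^sup>+z. ennreal \<bar>z \<bullet> a\<bar> * indicator (ball 0 R) z \<partial>lborel)"
    by (rule nn_integral_mono)
  moreover have "emeasure lborel (ball w (R / 4)) = ennreal (measure lborel (ball (0::'a) (R / 4)))"
  proof -
    have "measure lborel (ball w (R / 4)) = measure lborel (ball (0::'a) (R / 4))"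
      using R content_ball_conv_unit_ball[of "R / 4" w] content_ball_conv_unit_ball[of "R / 4" "0::'a"] by simp
    moreover have "emeasure lborel (ball w (R / 4)) < \<infinity>" by (rule emeasure_bounded_finite) simp
    ultimately show ?thesis by (simp add: emeasure_eq_ennreal_measure less_top)
  qed
  ultimately show ?thesis
    using R by (simp add: nn_integral_cmult_indicator ennreal_mult[symmetric] mult_ac)
qed simp

text \<open>The ray estimate, averaged over all directions in a ball.\<close>
lemma test_function_ray_bound:
  fixes \<phi> :: "real^'n::finite \<Rightarrow> real^'n"
  assumes \<phi>: "Ck 1 \<phi>" and R: "0 < R" "R \<le> 1"
  shows "ennreal (R / 4 * measure lborel (ball (0::real^'n) (R / 4)) * norm (\<phi> x))
     \<le> near_int R (\<lambda>y. ennreal (norm (\<phi> y))) x + ray_int R (\<lambda>y. ennreal (norm (sym_jacobian \<phi> y))) x"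
proof -
  have "continuous_on UNIV \<phi>" using Ck_mono_Suc[of 0 \<phi>] \<phi> by simp
  then have [measurable]: "\<phi> \<in> borel_measurable borel" by (rule borel_measurable_continuous_onI)
  have [measurable]: "sym_jacobian \<phi> \<in> borel_measurable borel"
    by (rule borel_measurable_continuous_onI[OF continuous_sym_jacobian[OF \<phi>]])
  let ?S = "\<lambda>y. ennreal (norm (sym_jacobian \<phi> y))"
  have "ennreal (R / 4 * measure lborel (ball (0::real^'n) (R / 4)) * norm (\<phi> x))
    \<le> (\<integral>\<^sup>+z. ennreal \<bar>z \<bullet> \<phi> x\<bar> * indicator (ball 0 R) z \<partial>lborel)"
    by (rule nn_integral_abs_inner_ball[OF R(1)])
  also have "\<dots> \<le> (\<integral>\<^sup>+z. (ennreal (norm (\<phi> (x + z)))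
      + (\<integral>\<^sup>+\<tau>. ?S (x + \<tau> *\<^sub>R z) * indicator {0<..1} \<tau> \<partial>lborel)) * indicator (ball 0 R) z \<partial>lborel)"
  proof (rule nn_integral_mono)
    fix z :: "real^'n"
    show "ennreal \<bar>z \<bullet> \<phi> x\<bar> * indicator (ball 0 R) z \<le> (ennreal (norm (\<phi> (x + z)))
      + (\<integral>\<^sup>+\<tau>. ?S (x + \<tau> *\<^sub>R z) * indicator {0<..1} \<tau> \<partial>lborel)) * indicator (ball 0 R) z"
    proof (cases "z \<in> ball 0 R")
      case True
      then have z: "norm z \<le> 1" "(norm z)\<^sup>2 \<le> 1" using R by (auto simp: power_le_one)
      have "ennreal \<bar>z \<bullet> \<phi> x\<bar> \<le> ennreal (norm z * norm (\<phi> (x + z)))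
        + (\<integral>\<^sup>+\<tau>. ennreal ((norm z)\<^sup>2 * norm (sym_jacobian \<phi> (x + \<tau> *\<^sub>R z))) * indicator {0<..1} \<tau> \<partial>lborel)"
        by (rule ray_estimate[OF \<phi>])
      also have "\<dots> \<le> ennreal (norm (\<phi> (x + z))) + (\<integral>\<^sup>+\<tau>. ?S (x + \<tau> *\<^sub>R z) * indicator {0<..1} \<tau> \<partial>lborel)"
        using z by (intro add_mono nn_integral_mono mult_right_mono ennreal_leI mult_left_le_one_le) auto
      finally show ?thesis using True by simp
    qed simp
  qed
  also have "\<dots> = near_int R (\<lambda>y. ennreal (norm (\<phi> y))) x
    + (\<integral>\<^sup>+z. (\<integral>\<^sup>+\<tau>. ?S (x + \<tau> *\<^sub>R z) * indicator {0<..1} \<tau> \<partial>lborel) * indicator (ball 0 R) z \<partial>lborel)"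
    unfolding near_int_def distrib_right by (rule nn_integral_add; measurable)
  also have "(\<integral>\<^sup>+z. (\<integral>\<^sup>+\<tau>. ?S (x + \<tau> *\<^sub>R z) * indicator {0<..1} \<tau> \<partial>lborel) * indicator (ball 0 R) z \<partial>lborel)
    = (\<integral>\<^sup>+z. (\<integral>\<^sup>+\<tau>. ?S (x + \<tau> *\<^sub>R z) * indicator {0<..1} \<tau> * indicator (ball 0 R) z \<partial>lborel) \<partial>lborel)"
    by (subst nn_integral_multc) measurable
  also have "\<dots> = (\<integral>\<^sup>+\<tau>. (\<integral>\<^sup>+z. ?S (x + \<tau> *\<^sub>R z) * indicator {0<..1} \<tau> * indicator (ball 0 R) z \<partial>lborel) \<partial>lborel)"
    by (rule lborel_pair.Fubini') measurable
  also have "\<dots> = (\<integral>\<^sup>+\<tau>. (\<integral>\<^sup>+z. ?S (x + \<tau> *\<^sub>R z) * indicator (ball 0 R) z * indicator {0<..1} \<tau> \<partial>lborel) \<partial>lborel)"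
    by (intro nn_integral_cong) (simp only: mult_ac)
  also have "\<dots> = ray_int R ?S x"
    unfolding ray_int_def by (subst nn_integral_multc) measurable
  finally show ?thesis .
qed

section \<open>Classical derivatives as weak symmetric gradients\<close>

lemma frechet_derivative_zero_outside:
  fixes \<psi> :: "'a::euclidean_space \<Rightarrow> 'b::euclidean_space"
  assumes K: "closed K" "\<And>x. x \<notin> K \<Longrightarrow> \<psi> x = 0" and x: "x \<notin> K"
  shows "frechet_derivative \<psi> (at x) = (\<lambda>_. 0)"
proof -
  have "(\<psi> has_derivative (\<lambda>_. 0)) (at x)"
    by (rule has_derivative_transform_within_open[OF has_derivative_const, of "- K" _ 0])
      (use assms in auto)
  then show ?thesis by (rule frechet_derivative_at[symmetric])
qed

lemma continuous_imp_locally_integrable: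
  fixes f :: "'a::euclidean_space \<Rightarrow> 'b::euclidean_space"
  assumes "continuous_on UNIV f"
  shows "locally_integrable U f"
  unfolding locally_integrable_def
proof (intro allI impI)
  fix K :: "'a set" assume K: "compact K"
  have "integrable lborel (\<lambda>x. indicator K x *\<^sub>R f x)"
    using K assms by (intro borel_integrable_compact) (auto intro: continuous_on_subset)
  then have "integrable lebesgue (\<lambda>x. indicator K x *\<^sub>R f x)"
    by (subst integrable_completion) auto
  then show "integrable (lebesgue_on K) f"
    using K by (subst integrable_restrict_space) (auto simp: borel_compact)
qed

lemma integral_lebesgue_on_eq_lborel:
  fixes f :: "'a::euclidean_space \<Rightarrow> real"
  assumes "U \<in> sets lebesgue" "f \<in> borel_measurable borel" "\<And>x. x \<notin> U \<Longrightarrow> f x = 0"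
  shows "(LINT x|lebesgue_on U. f x) = (LINT x|lborel. f x)"
proof -
  have "(LINT x|lebesgue_on U. f x) = (LINT x|lebesgue. indicator U x *\<^sub>R f x)"
    using assms(1) by (subst integral_restrict_space) auto
  also have "\<dots> = (LINT x|lebesgue. f x)"
    using assms(3) by (intro Bochner_Integration.integral_cong) (auto simp: indicator_def)
  finally show ?thesis using assms(2) by (simp add: integral_completion)
qed

lemma integrable_lborel_compact_support:
  fixes f :: "'a::euclidean_space \<Rightarrow> real"
  assumes "continuous_on UNIV f" "compact K" "\<And>x. x \<notin> K \<Longrightarrow> f x = 0"
  shows "integrable lborel f"
proof -
  have "integrable lborel (\<lambda>x. indicator K x *\<^sub>R f x)"
    using assms by (intro borel_integrable_compact) (auto intro: continuous_on_subset)
  moreover have "(\<lambda>x. indicator K x *\<^sub>R f x) = f"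
    by (rule ext) (use assms(3) in \<open>auto simp: indicator_def\<close>)
  ultimately show ?thesis by simp
qed

lemma integral_lborel_translate:
  fixes f :: "'a::euclidean_space \<Rightarrow> real"
  assumes [measurable]: "f \<in> borel_measurable borel"
  shows "(LINT x|lborel. f (x + a)) = (LINT x|lborel. f x)"
proof -
  have "(LINT x|lborel. f x) = (LINT x|distr lborel borel ((+) a). f x)"
    by (simp only: lborel_distr_plus)
  also have "\<dots> = (LINT x|lborel. f (x + a))"
    by (subst integral_distr) (auto simp: add.commute)
  finally show ?thesis by simp
qed

text \<open>Translation invariance makes the integrals of the difference quotients vanish, and the quotients converge
  dominatedly.\<close>
lemma integral_partial_derivative_zero:
  fixes v :: "'a::euclidean_space \<Rightarrow> real"
  assumes v: "Ck 1 v" and K: "compact K" "\<And>x. x \<notin> K \<Longrightarrow> v x = 0" and b: "b \<in> Basis"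
  shows "(LINT x|lborel. frechet_derivative v (at x) b) = 0"
proof -
  let ?D = "\<lambda>y. frechet_derivative v (at y) b"
  have D: "(v has_derivative frechet_derivative v (at y)) (at y)" for y
    using Ck_differentiable[of 0] v by simp
  have cD: "continuous_on UNIV ?D" using v b by simp
  have cv: "continuous_on UNIV v" using Ck_mono_Suc[of 0 v] v by simp
  have [measurable]: "v \<in> borel_measurable borel" "?D \<in> borel_measurable borel"
    using cv cD by (auto intro: borel_measurable_continuous_onI)
  have Dz: "?D y = 0" if "y \<notin> K" for y
    using frechet_derivative_zero_outside[OF compact_imp_closed[OF K(1)] K(2) that] by simp
  have "bounded (?D ` K)"
    using K by (intro compact_imp_bounded compact_continuous_image continuous_on_subset[OF cD]) auto
  then obtain M0 where M0: "\<And>y. y \<in> K \<Longrightarrow> \<bar>?D y\<bar> \<le> M0" by (auto simp: bounded_iff)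
  define M where "M = max 0 M0"
  have M: "0 \<le> M" "\<bar>?D y\<bar> \<le> M" for y
    using M0[of y] Dz[of y] by (cases "y \<in> K"; force simp: M_def)+
  define K1 where "K1 = {x + y | x y. x \<in> K \<and> y \<in> cball 0 1}"
  have K1: "compact K1" unfolding K1_def using compact_sums[OF K(1) compact_cball[of 0 1]] by simp
  define h where "h k = 1 / real (Suc k)" for k
  have h: "0 < h k" "h k \<le> 1" for k by (auto simp: h_def)
  have h0: "h \<longlonglongrightarrow> 0" unfolding h_def[abs_def] by (rule LIMSEQ_Suc[OF lim_1_over_n])
  define Q where "Q k x = (v (x + h k *\<^sub>R b) - v x) / h k" for k x
  have vi: "integrable lborel v" by (rule integrable_lborel_compact_support[OF cv K])
  have Qz: "(LINT x|lborel. Q k x) = 0" for k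
  proof -
    have "integrable lborel (\<lambda>x. v (x + h k *\<^sub>R b))"
    proof (rule integrable_lborel_compact_support)
      show "continuous_on UNIV (\<lambda>x. v (x + h k *\<^sub>R b))"
        by (intro continuous_on_compose2[OF cv] continuous_intros) auto
      show "compact ((\<lambda>x. x - h k *\<^sub>R b) ` K)"
        by (intro compact_continuous_image K continuous_intros)
      show "v (x + h k *\<^sub>R b) = 0" if "x \<notin> (\<lambda>x. x - h k *\<^sub>R b) ` K" for x
      proof (rule K(2), rule notI)
        assume "x + h k *\<^sub>R b \<in> K"
        then have "(x + h k *\<^sub>R b) - h k *\<^sub>R b \<in> (\<lambda>x. x - h k *\<^sub>R b) ` K" by (rule imageI)
        then show False using that by simp
      qed
    qed
    then show ?thesis
      unfolding Q_def using vi by (simp add: integral_lborel_translate)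
  qed
  have "(\<lambda>k. LINT x|lborel. Q k x) \<longlonglongrightarrow> (LINT x|lborel. ?D x)"
  proof (rule integral_dominated_convergence[where w = "\<lambda>x. indicator K1 x *\<^sub>R M"])
    show "integrable lborel (\<lambda>x. indicator K1 x *\<^sub>R M)"
      by (rule borel_integrable_compact[OF K1 continuous_on_const])
    show "AE x in lborel. (\<lambda>k. Q k x) \<longlonglongrightarrow> ?D x"
    proof (rule AE_I2)
      fix x
      have "((\<lambda>\<tau>. v (x + \<tau> *\<^sub>R b)) has_real_derivative ?D x) (at 0)"
        by (rule has_real_derivative_along_line) (simp add: D)
      then have "(\<lambda>\<tau>. (v (x + \<tau> *\<^sub>R b) - v x) / \<tau>) \<midarrow>0\<rightarrow> ?D x" by (simp add: DERIV_def)
      moreover have "filterlim h (at 0) sequentially"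
        unfolding filterlim_at using h0 h(1) by (auto intro!: always_eventually simp: less_imp_neq[symmetric])
      ultimately show "(\<lambda>k. Q k x) \<longlonglongrightarrow> ?D x"
        unfolding Q_def by (rule filterlim_compose)
    qed
    show "AE x in lborel. norm (Q k x) \<le> indicator K1 x *\<^sub>R M" for k
    proof (rule AE_I2)
      fix x
      show "norm (Q k x) \<le> indicator K1 x *\<^sub>R M"
      proof (cases "x \<in> K1")
        case True
        have "\<exists>\<tau>. 0 < \<tau> \<and> \<tau> < h k \<and> v (x + h k *\<^sub>R b) - v (x + 0 *\<^sub>R b) = (h k - 0) * ?D (x + \<tau> *\<^sub>R b)"
        proof (rule MVT2[OF h(1)])
          fix \<tau>
          show "((\<lambda>\<tau>. v (x + \<tau> *\<^sub>R b)) has_real_derivative ?D (x + \<tau> *\<^sub>R b)) (at \<tau>)"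
            by (rule has_real_derivative_along_line[OF D])
        qed
        then obtain \<tau> where "v (x + h k *\<^sub>R b) - v x = h k * ?D (x + \<tau> *\<^sub>R b)" by auto
        then have "Q k x = ?D (x + \<tau> *\<^sub>R b)" using h[of k] by (simp add: Q_def)
        then show ?thesis using M(2) True by simp
      next
        case False
        have "x \<notin> K"
        proof
          assume "x \<in> K"
          then have "x + 0 \<in> K1" unfolding K1_def by (intro CollectI exI[of _ x] exI[of _ 0]) simp
          then show False using False by simp
        qed
        moreover have "x + h k *\<^sub>R b \<notin> K"
        proof
          assume "x + h k *\<^sub>R b \<in> K"
          then have "(x + h k *\<^sub>R b) + (- (h k *\<^sub>R b)) \<in> K1"
            unfolding K1_def using h[of k] b
            by (intro CollectI exI[of _ "x + h k *\<^sub>R b"] exI[of _ "- (h k *\<^sub>R b)"]) (simp add: less_imp_le)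
          then show False using False by simp
        qed
        ultimately show ?thesis using False K(2) by (simp add: Q_def)
      qed
    qed
    show "Q k \<in> borel_measurable lborel" for k unfolding Q_def[abs_def] by measurable
  qed measurable
  then show ?thesis by (simp add: Qz LIMSEQ_const_iff)
qed

lemma test_functions_Ck: "\<phi> \<in> test_functions U \<Longrightarrow> Ck k \<phi>"
  by (simp add: test_functions_def)

lemma test_function_supportE:
  assumes "\<phi> \<in> test_functions U"
  obtains K where "compact K" "K \<subseteq> U" "\<And>x. x \<notin> K \<Longrightarrow> \<phi> x = 0"
proof
  show "compact (closure {x. \<phi> x \<noteq> 0})" "closure {x. \<phi> x \<noteq> 0} \<subseteq> U"
    using assms unfolding test_functions_def by blast+
qed (rule test_functions_support[OF assms])

text \<open>Integration by parts: the integral of a partial derivative of \<open>\<phi> $ k * \<psi>\<close> vanishes.\<close>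
lemma has_sym_grad_test_function:
  fixes \<phi> :: "real^'n::finite \<Rightarrow> real^'n"
  assumes U: "open U" and \<phi>: "\<phi> \<in> test_functions U"
  shows "has_sym_grad dirs U \<phi> (sym_jacobian \<phi>)"
  unfolding has_sym_grad_def
proof (intro conjI ballI allI)
  have C1: "Ck 1 \<phi>" using \<phi> by (rule test_functions_Ck)
  have cS: "continuous_on UNIV (sym_jacobian \<phi>)" by (rule continuous_sym_jacobian[OF C1])
  have c\<phi>: "continuous_on UNIV \<phi>" using test_functions_Ck[OF \<phi>, of 0] by simp
  show "locally_integrable U \<phi>" "locally_integrable U (sym_jacobian \<phi>)"
    using c\<phi> cS by (auto intro: continuous_imp_locally_integrable)
  show "transpose (sym_jacobian \<phi> x) = sym_jacobian \<phi> x" for x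
    by (simp add: transpose_def sym_jacobian_def vec_eq_iff add.commute)
  fix \<psi> :: "real^'n \<Rightarrow> real" and i j assume \<psi>: "\<psi> \<in> test_functions U"
  obtain K where K: "compact K" "K \<subseteq> U" and z\<psi>: "\<And>x. x \<notin> K \<Longrightarrow> \<psi> x = 0"
    using test_function_supportE[OF \<psi>] by blast
  have c\<psi>: "continuous_on UNIV \<psi>" using test_functions_Ck[OF \<psi>, of 0] by simp
  have D\<psi>: "(\<psi> has_derivative frechet_derivative \<psi> (at x)) (at x)" for x
    using Ck_differentiable[of 0] test_functions_Ck[OF \<psi>, of 1] by simp
  have D\<phi>: "(\<phi> has_derivative frechet_derivative \<phi> (at x)) (at x)" for x
    using Ck_differentiable[of 0] C1 by simp
  have zD\<psi>: "frechet_derivative \<psi> (at x) b = 0" if "x \<notin> K" for x b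
    using frechet_derivative_zero_outside[OF compact_imp_closed[OF K(1)] z\<psi> that] by simp
  have cD\<psi>: "continuous_on UNIV (\<lambda>x. frechet_derivative \<psi> (at x) (dirs l))" for l
    using test_functions_Ck[OF \<psi>, of 1] by (simp add: dirs_def axis_in_Basis_iff)
  have cD\<phi>: "continuous_on UNIV (\<lambda>x. frechet_derivative \<phi> (at x) (dirs l) $ k)" for l k
  proof -
    have "continuous_on UNIV (\<lambda>x. frechet_derivative \<phi> (at x) (dirs l))"
      using C1 by (simp add: dirs_def axis_in_Basis_iff)
    then show ?thesis by (rule bounded_linear.continuous_on[OF bounded_linear_vec_nth])
  qed
  have c\<phi>k: "continuous_on UNIV (\<lambda>x. \<phi> x $ k)" for k
    by (rule bounded_linear.continuous_on[OF bounded_linear_vec_nth c\<phi>])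
  have UL: "U \<in> sets lebesgue" using U by auto
  have int_on: "(LINT x|lebesgue_on U. f x) = (LINT x|lborel. f x)" "integrable lborel f"
    if "continuous_on UNIV f" "\<And>x. x \<notin> K \<Longrightarrow> f x = 0" for f :: "real^'n \<Rightarrow> real"
  proof -
    show "(LINT x|lebesgue_on U. f x) = (LINT x|lborel. f x)"
      using that K(2) by (intro integral_lebesgue_on_eq_lborel[OF UL]) (auto intro: borel_measurable_continuous_onI)
    show "integrable lborel f" by (rule integrable_lborel_compact_support[OF that(1) K(1) that(2)])
  qed
  have parts: "(LINT x|lborel. frechet_derivative \<phi> (at x) (dirs l) $ k * \<psi> x)
      = dist_deriv U (dirs l) (\<lambda>x. \<phi> x $ k) \<psi>" for k l
  proof -
    have Ckl: "Ck 1 (\<lambda>x. \<phi> x $ k * \<psi> x)"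
      by (intro Ck_mult Ck_bounded_linear_comp[OF bounded_linear_vec_nth] C1 test_functions_Ck[OF \<psi>])
    have "((\<lambda>x. \<phi> x $ k * \<psi> x) has_derivative
        (\<lambda>h. \<phi> x $ k * frechet_derivative \<psi> (at x) h + frechet_derivative \<phi> (at x) h $ k * \<psi> x)) (at x)" for x
      by (rule has_derivative_mult[OF bounded_linear.has_derivative[OF bounded_linear_vec_nth D\<phi>] D\<psi>])
    then have F: "frechet_derivative (\<lambda>x. \<phi> x $ k * \<psi> x) (at x)
       = (\<lambda>h. \<phi> x $ k * frechet_derivative \<psi> (at x) h + frechet_derivative \<phi> (at x) h $ k * \<psi> x)" for x
      by (rule frechet_derivative_at[symmetric])
    have "(LINT x|lborel. frechet_derivative (\<lambda>x. \<phi> x $ k * \<psi> x) (at x) (dirs l)) = 0"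
      by (rule integral_partial_derivative_zero[OF Ckl K(1)]) (auto simp: z\<psi> dirs_def axis_in_Basis_iff)
    then have "0 = (LINT x|lborel. \<phi> x $ k * frechet_derivative \<psi> (at x) (dirs l)
        + frechet_derivative \<phi> (at x) (dirs l) $ k * \<psi> x)"
      by (simp only: F)
    also have "\<dots> = (LINT x|lborel. \<phi> x $ k * frechet_derivative \<psi> (at x) (dirs l))
        + (LINT x|lborel. frechet_derivative \<phi> (at x) (dirs l) $ k * \<psi> x)"
      by (intro Bochner_Integration.integral_add int_on(2) continuous_on_mult c\<phi>k cD\<psi> cD\<phi> c\<psi>)
        (auto simp: z\<psi> zD\<psi>)
    also have "(LINT x|lborel. \<phi> x $ k * frechet_derivative \<psi> (at x) (dirs l)) = - dist_deriv U (dirs l) (\<lambda>x. \<phi> x $ k) \<psi>"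
      unfolding dist_deriv_def
      by (subst int_on(1)) (auto simp: zD\<psi> intro!: continuous_on_mult c\<phi>k cD\<psi>)
    finally show ?thesis by simp
  qed
  have "(LINT x|lebesgue_on U. sym_jacobian \<phi> x $ i $ j * \<psi> x) = (LINT x|lborel. sym_jacobian \<phi> x $ i $ j * \<psi> x)"
    by (rule int_on(1))
      (auto simp: z\<psi> intro!: continuous_on_mult c\<psi> bounded_linear.continuous_on[OF bounded_linear_matrix_entry cS])
  also have "\<dots> = (LINT x|lborel. (frechet_derivative \<phi> (at x) (dirs j) $ i * \<psi> x + frechet_derivative \<phi> (at x) (dirs i) $ j * \<psi> x) / 2)"
    by (intro Bochner_Integration.integral_cong) (auto simp: sym_jacobian_def field_simps)
  also have "\<dots> = (LINT x|lborel. (frechet_derivative \<phi> (at x) (dirs j) $ i * \<psi> x + frechet_derivative \<phi> (at x) (dirs i) $ j * \<psi> x)) / 2"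
    by (rule Bochner_Integration.integral_divide_zero)
  also have "(LINT x|lborel. (frechet_derivative \<phi> (at x) (dirs j) $ i * \<psi> x + frechet_derivative \<phi> (at x) (dirs i) $ j * \<psi> x))
    = (LINT x|lborel. frechet_derivative \<phi> (at x) (dirs j) $ i * \<psi> x) + (LINT x|lborel. frechet_derivative \<phi> (at x) (dirs i) $ j * \<psi> x)"
    by (intro Bochner_Integration.integral_add int_on(2) continuous_on_mult cD\<phi> c\<psi>) (auto simp: z\<psi>)
  finally show "(LINT x|lebesgue_on U. sym_jacobian \<phi> x $ i $ j * \<psi> x) = dist_sym_grad dirs U \<phi> i j \<psi>"
    by (simp add: parts dist_sym_grad_def)
qed

lemma has_sym_grad_diff:
  fixes e :: "'n::finite \<Rightarrow> 'a::euclidean_space" and u w :: "'a \<Rightarrow> real^'n"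
  assumes U: "open U" and e: "\<And>j. e j \<in> Basis"
    and u: "has_sym_grad e U u E" and w: "has_sym_grad e U w F"
  shows "has_sym_grad e U (\<lambda>x. u x - w x) (\<lambda>x. E x - F x)"
  unfolding has_sym_grad_def
proof (intro conjI ballI allI)
  have lu: "locally_integrable U u" "locally_integrable U E" and lw: "locally_integrable U w" "locally_integrable U F"
    using u w by (auto simp: has_sym_grad_def)
  then show "locally_integrable U (\<lambda>x. u x - w x)" "locally_integrable U (\<lambda>x. E x - F x)"
    by (auto intro: locally_integrable_diff)
  show "transpose (E x - F x) = E x - F x" if "x \<in> U" for x
  proof -
    have "transpose (E x) = E x" "transpose (F x) = F x" using u w that by (auto simp: has_sym_grad_def)
    then show ?thesis by (simp add: transpose_def vec_eq_iff)
  qed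
  fix \<psi> :: "'a \<Rightarrow> real" and i j assume \<psi>: "\<psi> \<in> test_functions U"
  obtain K where K: "compact K" "K \<subseteq> U" and z\<psi>: "\<And>x. x \<notin> K \<Longrightarrow> \<psi> x = 0"
    using test_function_supportE[OF \<psi>] by blast
  have "continuous_on UNIV (\<lambda>x. frechet_derivative \<psi> (at x) (e l))" for l
    using test_functions_Ck[OF \<psi>, of 1] e by simp
  moreover have "frechet_derivative \<psi> (at x) b = 0" if "x \<notin> K" for x b
    using frechet_derivative_zero_outside[OF compact_imp_closed[OF K(1)] z\<psi> that] by simp
  ultimately have int: "integrable (lebesgue_on U) (\<lambda>x. g x $ k * frechet_derivative \<psi> (at x) (e l))"
    if "locally_integrable U g" for g :: "'a \<Rightarrow> real^'n" and k l
    using locally_integrable_linear[OF that bounded_linear_vec_nth[of k]] K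
    by (intro integrable_mult_compact_support[OF U]) auto
  have dd: "dist_deriv U (e l) (\<lambda>x. (u x - w x) $ k) \<psi> = dist_deriv U (e l) (\<lambda>x. u x $ k) \<psi> - dist_deriv U (e l) (\<lambda>x. w x $ k) \<psi>" for k l
    unfolding dist_deriv_def using int[OF lu(1)] int[OF lw(1)]
    by (simp add: left_diff_distrib)
  have "(LINT x|lebesgue_on U. (E x - F x) $ i $ j * \<psi> x)
     = (LINT x|lebesgue_on U. E x $ i $ j * \<psi> x) - (LINT x|lebesgue_on U. F x $ i $ j * \<psi> x)"
    using integrable_mult_test_function[OF U locally_integrable_linear[OF lu(2) bounded_linear_matrix_entry] \<psi>]
      integrable_mult_test_function[OF U locally_integrable_linear[OF lw(2) bounded_linear_matrix_entry] \<psi>]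
    by (simp add: left_diff_distrib)
  also have "\<dots> = dist_sym_grad e U u i j \<psi> - dist_sym_grad e U w i j \<psi>"
    using u w \<psi> by (simp add: has_sym_grad_def)
  also have "\<dots> = dist_sym_grad e U (\<lambda>x. u x - w x) i j \<psi>"
    unfolding dist_sym_grad_def dd by (simp add: field_simps)
  finally show "(LINT x|lebesgue_on U. (E x - F x) $ i $ j * \<psi> x) = dist_sym_grad e U (\<lambda>x. u x - w x) i j \<psi>" .
qed

lemma has_sym_grad_sym_grad: "has_sym_grad e U u E \<Longrightarrow> has_sym_grad e U u (sym_grad e U u)"
  unfolding sym_grad_def by (rule someI[of "has_sym_grad e U u"])

lemma sym_grad_AE_eq:
  "open U \<Longrightarrow> has_sym_grad e U u E \<Longrightarrow> AE x in lebesgue_on U. sym_grad e U u x = E x"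
  by (rule has_sym_grad_unique[OF _ has_sym_grad_sym_grad])

section \<open>Modulars, Luxemburg norms and the pointwise bound on a slice\<close>

lemma nn_integral_lborel_eq_lebesgue_on:
  fixes k k' :: "'a::euclidean_space \<Rightarrow> ennreal"
  assumes U: "U \<in> sets lebesgue" and k: "\<And>x. x \<notin> U \<Longrightarrow> k x = 0"
    and eq: "AE x in lebesgue_on U. k x = k' x"
  shows "(\<integral>\<^sup>+x. k x \<partial>lborel) = (\<integral>\<^sup>+x. k' x \<partial>lebesgue_on U)"
proof -
  have "(\<integral>\<^sup>+x. k' x \<partial>lebesgue_on U) = (\<integral>\<^sup>+x. k x \<partial>lebesgue_on U)"
    using eq by (intro nn_integral_cong_AE) (auto elim: eventually_mono)
  also have "\<dots> = (\<integral>\<^sup>+x. k x * indicator U x \<partial>lebesgue)"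
    using U by (subst nn_integral_restrict_space) auto
  also have "\<dots> = (\<integral>\<^sup>+x. k x \<partial>lebesgue)"
    using k by (intro nn_integral_cong) (auto simp: indicator_def)
  finally show ?thesis by (simp add: nn_integral_completion)
qed

lemma norm_scaled_measurable:
  fixes f :: "'a \<Rightarrow> 'b::euclidean_space"
  assumes [measurable]: "f \<in> borel_measurable M" "q \<in> borel_measurable M"
  shows "(\<lambda>x. ennreal (norm (f x /\<^sub>R l) powr q x)) \<in> borel_measurable M"
  by measurable

lemma bounded_open_emeasure:
  fixes S :: "'a::euclidean_space set"
  assumes "open S" "bounded S"
  shows "emeasure lborel S = ennreal (measure lborel S)" "emeasure (lebesgue_on S) S < \<infinity>"
proof -
  have S: "S \<in> sets lebesgue" using assms by auto
  have fin: "emeasure lborel S < \<infinity>" by (rule emeasure_bounded_finite[OF assms(2)])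
  then show "emeasure lborel S = ennreal (measure lborel S)"
    by (intro emeasure_eq_ennreal_measure) auto
  have "emeasure (lebesgue_on S) S = emeasure lborel S"
    using S assms(1) by (simp add: emeasure_restrict_space)
  then show "emeasure (lebesgue_on S) S < \<infinity>" using fin by simp
qed

lemma modular_scaleR_le:
  fixes f :: "'a::euclidean_space \<Rightarrow> 'b::euclidean_space"
  assumes f: "f \<in> borel_measurable (lebesgue_on G)" and qm: "q \<in> borel_measurable (lebesgue_on G)"
    and q: "\<And>x. x \<in> G \<Longrightarrow> 1 \<le> q x" and l: "1 \<le> l"
  shows "modular G q (\<lambda>x. f x /\<^sub>R l) \<le> modular G q f / ennreal l"
proof -
  have "modular G q (\<lambda>x. f x /\<^sub>R l) \<le> (\<integral>\<^sup>+x. ennreal (norm (f x) powr q x) / ennreal l \<partial>lebesgue_on G)"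
    unfolding modular_def
  proof (rule nn_integral_mono)
    fix x assume "x \<in> space (lebesgue_on G)"
    then have qx: "1 \<le> q x" using q by simp
    have "norm (f x /\<^sub>R l) powr q x = norm (f x) powr q x / l powr q x"
      using l powr_divide[of "norm (f x)" l "q x"] by (simp add: divide_inverse mult.commute)
    also have "\<dots> \<le> norm (f x) powr q x / l"
      using l powr_mono[OF qx l] by (intro divide_left_mono) auto
    finally show "ennreal (norm (f x /\<^sub>R l) powr q x) \<le> ennreal (norm (f x) powr q x) / ennreal l"
      using l by (simp add: divide_ennreal ennreal_leI)
  qed
  also have "\<dots> = modular G q f / ennreal l"
    unfolding modular_def using norm_scaled_measurable[OF f qm, of 1] by (intro nn_integral_divide) simp
  finally show ?thesis .
qed

lemma modular_antimono_scale:
  assumes "0 < l" "l \<le> l'" and q: "\<And>x. x \<in> G \<Longrightarrow> 1 \<le> q x"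
  shows "modular G q (\<lambda>x. f x /\<^sub>R l') \<le> modular G q (\<lambda>x. f x /\<^sub>R l)"
  unfolding modular_def
proof (rule nn_integral_mono)
  fix x assume "x \<in> space (lebesgue_on G)"
  then have "1 \<le> q x" using q by simp
  moreover have "norm (f x /\<^sub>R l') \<le> norm (f x /\<^sub>R l)"
    using assms(1,2) by (auto intro!: mult_right_mono simp: le_imp_inverse_le)
  ultimately show "ennreal (norm (f x /\<^sub>R l') powr q x) \<le> ennreal (norm (f x /\<^sub>R l) powr q x)"
    by (intro ennreal_leI powr_mono2) auto
qed

lemma modular_scaled_le_one:
  fixes f :: "'a::euclidean_space \<Rightarrow> 'b::euclidean_space"
  assumes f: "f \<in> borel_measurable (lebesgue_on G)" and qm: "q \<in> borel_measurable (lebesgue_on G)"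
    and q: "\<And>x. x \<in> G \<Longrightarrow> 1 \<le> q x" and m: "modular G q f \<le> ennreal l" "1 \<le> l"
  shows "modular G q (\<lambda>x. f x /\<^sub>R l) \<le> 1"
proof -
  have "modular G q (\<lambda>x. f x /\<^sub>R l) \<le> modular G q f / ennreal l"
    by (rule modular_scaleR_le[OF f qm q m(2)])
  also have "\<dots> \<le> ennreal l / ennreal l" using m(1) by (intro divide_right_mono_ennreal)
  also have "\<dots> = 1" using m(2) by (simp add: divide_ennreal)
  finally show ?thesis .
qed

text \<open>The infimum of an empty set of reals is unspecified, so this is needed before anything can be read off
  from the value of \<open>Lp_norm\<close>.\<close>
lemma Lp_norm_set_nonempty:
  fixes f :: "'a::euclidean_space \<Rightarrow> 'b::euclidean_space"
  assumes f: "f \<in> Lp_space G q" and qm: "q \<in> borel_measurable (lebesgue_on G)"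
    and q: "\<And>x. x \<in> G \<Longrightarrow> 1 \<le> q x"
  shows "{l. l > 0 \<and> modular G q (\<lambda>x. f x /\<^sub>R l) \<le> 1} \<noteq> {}"
proof -
  define l where "l = max 1 (enn2real (modular G q f))"
  have "modular G q f = ennreal (enn2real (modular G q f))" using f by (simp add: Lp_space_def)
  also have "\<dots> \<le> ennreal l" by (intro ennreal_leI) (simp add: l_def)
  finally have "modular G q (\<lambda>x. f x /\<^sub>R l) \<le> 1"
    using f by (intro modular_scaled_le_one[OF _ qm q]) (auto simp: Lp_space_def l_def)
  moreover have "0 < l" by (simp add: l_def)
  ultimately show ?thesis by blast
qed

lemma Lp_norm_nonneg:
  assumes "f \<in> Lp_space G q" "q \<in> borel_measurable (lebesgue_on G)" "\<And>x. x \<in> G \<Longrightarrow> 1 \<le> q x"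
  shows "0 \<le> Lp_norm G q f"
  unfolding Lp_norm_def by (rule cInf_greatest[OF Lp_norm_set_nonempty[OF assms]]) auto

lemma Lp_norm_lessE:
  assumes "f \<in> Lp_space G q" "q \<in> borel_measurable (lebesgue_on G)" "\<And>x. x \<in> G \<Longrightarrow> 1 \<le> q x"
    and "Lp_norm G q f < \<delta>"
  obtains l where "0 < l" "l < \<delta>" "modular G q (\<lambda>x. f x /\<^sub>R l) \<le> 1"
  using cInf_lessD[OF Lp_norm_set_nonempty[OF assms(1-3)] assms(4)[unfolded Lp_norm_def]] by auto

lemma Lp_norm_le:
  assumes "0 < l" "modular G q (\<lambda>x. f x /\<^sub>R l) \<le> 1"
  shows "Lp_norm G q f \<le> l"
  unfolding Lp_norm_def by (rule cInf_lower) (use assms in \<open>auto intro!: bdd_belowI[of _ 0]\<close>)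

lemma modular_cong_AE:
  assumes "AE x in lebesgue_on G. f x = g x"
  shows "modular G q f = modular G q g"
  unfolding modular_def using assms by (intro nn_integral_cong_AE) (auto elim: eventually_mono)

lemma Lp_norm_cong_AE:
  assumes "AE x in lebesgue_on G. f x = g x"
  shows "Lp_norm G q f = Lp_norm G q g"
proof -
  have "modular G q (\<lambda>x. f x /\<^sub>R l) = modular G q (\<lambda>x. g x /\<^sub>R l)" for l
    using assms by (intro modular_cong_AE) (auto elim: eventually_mono)
  then show ?thesis by (simp add: Lp_norm_def)
qed

text \<open>Smallness in the Luxemburg norm of any exponent \<open>q \<ge> 1\<close> gives smallness in \<open>L\<^sup>1\<close>, since
  \<open>a \<le> 1 + a\<^sup>q\<close>; the limit along test functions is thereby carried out in \<open>L\<^sup>1\<close>.\<close>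
lemma nn_integral_norm_le_of_modular:
  fixes f :: "'a::euclidean_space \<Rightarrow> 'b::euclidean_space"
  assumes f: "f \<in> borel_measurable (lebesgue_on G)" and qm: "q \<in> borel_measurable (lebesgue_on G)"
    and q: "\<And>x. x \<in> G \<Longrightarrow> 1 \<le> q x" and l: "0 < l" "modular G q (\<lambda>x. f x /\<^sub>R l) \<le> 1"
  shows "(\<integral>\<^sup>+x. ennreal (norm (f x)) \<partial>lebesgue_on G) \<le> ennreal l * (emeasure (lebesgue_on G) G + 1)"
proof -
  have "(\<integral>\<^sup>+x. ennreal (norm (f x)) \<partial>lebesgue_on G)
    \<le> (\<integral>\<^sup>+x. ennreal l * (1 + ennreal (norm (f x /\<^sub>R l) powr q x)) \<partial>lebesgue_on G)"
  proof (rule nn_integral_mono)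
    fix x assume "x \<in> space (lebesgue_on G)"
    then have "1 \<le> q x" using q by simp
    then have "norm (f x /\<^sub>R l) powr 1 \<le> 1 + norm (f x /\<^sub>R l) powr q x"
      by (intro powr_le_one_plus_powr) auto
    then have "norm (f x) \<le> l * (1 + norm (f x /\<^sub>R l) powr q x)"
      using l(1) by (simp add: field_simps)
    then have "ennreal (norm (f x)) \<le> ennreal (l * (1 + norm (f x /\<^sub>R l) powr q x))" by (rule ennreal_leI)
    then show "ennreal (norm (f x)) \<le> ennreal l * (1 + ennreal (norm (f x /\<^sub>R l) powr q x))"
      using l(1) by (simp only: ennreal_mult ennreal_plus powr_ge_zero zero_le_one ennreal_1 add_nonneg_nonneg less_imp_le)
  qed
  also have "\<dots> = ennreal l * (emeasure (lebesgue_on G) G + modular G q (\<lambda>x. f x /\<^sub>R l))"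
    unfolding modular_def using norm_scaled_measurable[OF f qm, of l]
    by (subst nn_integral_cmult) (auto simp: nn_integral_add)
  also have "\<dots> \<le> ennreal l * (emeasure (lebesgue_on G) G + 1)"
    using l(2) by (intro mult_left_mono add_left_mono) auto
  finally show ?thesis .
qed

lemma nn_integral_L2_scaled:
  assumes f: "f \<in> L2_space G" and l: "0 < l" "L2_norm G f \<le> l"
  shows "(\<integral>\<^sup>+x. ennreal ((norm (f x /\<^sub>R l))\<^sup>2) \<partial>lebesgue_on G) \<le> 1"
proof -
  have int: "integrable (lebesgue_on G) (\<lambda>x. (norm (f x))\<^sup>2)" using f by (simp add: L2_space_def)
  have "(norm (f x /\<^sub>R l))\<^sup>2 = (norm (f x))\<^sup>2 / l\<^sup>2" for x
    by (simp add: power_mult_distrib divide_inverse power_inverse mult.commute)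
  then have "(\<integral>\<^sup>+x. ennreal ((norm (f x /\<^sub>R l))\<^sup>2) \<partial>lebesgue_on G) = (\<integral>\<^sup>+x. ennreal ((norm (f x))\<^sup>2 / l\<^sup>2) \<partial>lebesgue_on G)"
    by simp
  also have "\<dots> = ennreal (LINT x|lebesgue_on G. (norm (f x))\<^sup>2 / l\<^sup>2)"
    using int by (intro nn_integral_eq_integral) auto
  also have "(LINT x|lebesgue_on G. (norm (f x))\<^sup>2 / l\<^sup>2) = (LINT x|lebesgue_on G. (norm (f x))\<^sup>2) / l\<^sup>2"
    by (rule Bochner_Integration.integral_divide_zero)
  also have "(LINT x|lebesgue_on G. (norm (f x))\<^sup>2) \<le> l\<^sup>2"
    using l by (simp add: L2_norm_def real_le_lsqrt sqrt_le_D)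
  then have "ennreal ((LINT x|lebesgue_on G. (norm (f x))\<^sup>2) / l\<^sup>2) \<le> 1"
    using l(1) by (simp add: divide_le_eq)
  finally show ?thesis .
qed

lemma nn_integral_norm_le_of_L2:
  fixes f :: "'a::euclidean_space \<Rightarrow> 'b::euclidean_space"
  assumes f: "f \<in> L2_space G" and l: "0 < l" "L2_norm G f \<le> l"
  shows "(\<integral>\<^sup>+x. ennreal (norm (f x)) \<partial>lebesgue_on G) \<le> ennreal l * (emeasure (lebesgue_on G) G + 1)"
proof (rule nn_integral_norm_le_of_modular[where q = "\<lambda>_. 2"])
  show "modular G (\<lambda>_. 2) (\<lambda>x. f x /\<^sub>R l) \<le> 1"
    using nn_integral_L2_scaled[OF f l] by (simp add: modular_def)
  show "f \<in> borel_measurable (lebesgue_on G)" using f by (simp add: L2_space_def)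
qed (use l in auto)

lemma powr_diff_bound:
  fixes a b :: "'b::real_normed_vector"
  assumes q: "1 \<le> q" "q \<le> P" and b: "norm b \<le> M"
  shows "norm (a - b) powr q \<le> 2 powr P * (norm a powr q + (max 1 M) powr P)"
proof -
  let ?m = "max (norm a) (norm b)"
  have "norm (a - b) \<le> 2 * ?m" using norm_triangle_ineq4[of a b] by linarith
  then have "norm (a - b) powr q \<le> (2 * ?m) powr q" using q by (intro powr_mono2) auto
  also have "\<dots> = 2 powr q * ?m powr q" by (rule powr_mult)
  also have "\<dots> \<le> 2 powr P * ?m powr q" using q by (intro mult_right_mono powr_mono) auto
  also have "?m powr q \<le> norm a powr q + norm b powr q" by (auto simp: max_def)
  also have "norm b powr q \<le> (max 1 M) powr q" using q b by (intro powr_mono2) auto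
  also have "(max 1 M) powr q \<le> (max 1 M) powr P" using q by (intro powr_mono) auto
  finally show ?thesis by simp
qed

lemma Lp_space_diff_bounded:
  fixes E S :: "'a::euclidean_space \<Rightarrow> 'b::euclidean_space"
  assumes E: "E \<in> Lp_space G q" and S: "S \<in> borel_measurable (lebesgue_on G)" "\<And>x. x \<in> G \<Longrightarrow> norm (S x) \<le> M"
    and qm: "q \<in> borel_measurable (lebesgue_on G)"
    and q: "\<And>x. x \<in> G \<Longrightarrow> 1 \<le> q x" "\<And>x. x \<in> G \<Longrightarrow> q x \<le> P"
    and G: "emeasure (lebesgue_on G) G < \<infinity>"
  shows "(\<lambda>x. E x - S x) \<in> Lp_space G q"
proof -
  have Em: "E \<in> borel_measurable (lebesgue_on G)" and fin: "modular G q E < \<infinity>"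
    using E by (auto simp: Lp_space_def)
  have "modular G q (\<lambda>x. E x - S x)
    \<le> (\<integral>\<^sup>+x. ennreal (2 powr P) * (ennreal (norm (E x) powr q x) + ennreal (max 1 M powr P)) \<partial>lebesgue_on G)"
    unfolding modular_def
  proof (rule nn_integral_mono)
    fix x assume "x \<in> space (lebesgue_on G)"
    then have x: "x \<in> G" by simp
    have "norm (E x - S x) powr q x \<le> 2 powr P * (norm (E x) powr q x + max 1 M powr P)"
      by (rule powr_diff_bound[OF q[OF x] S(2)[OF x]])
    then show "ennreal (norm (E x - S x) powr q x)
      \<le> ennreal (2 powr P) * (ennreal (norm (E x) powr q x) + ennreal (max 1 M powr P))"
      by (simp flip: ennreal_plus ennreal_mult add: ennreal_leI)
  qed
  also have "\<dots> = ennreal (2 powr P) * (modular G q E + ennreal (max 1 M powr P) * emeasure (lebesgue_on G) G)"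
    unfolding modular_def using norm_scaled_measurable[OF Em qm, of 1]
    by (subst nn_integral_cmult) (auto simp: nn_integral_add)
  also have "\<dots> < \<infinity>" using fin G by (simp add: ennreal_mult_less_top)
  finally show ?thesis using Em S(1) by (simp add: Lp_space_def)
qed

lemma L2_space_diff_bounded:
  fixes E S :: "'a::euclidean_space \<Rightarrow> 'b::euclidean_space"
  assumes E: "E \<in> L2_space G" and S: "S \<in> borel_measurable (lebesgue_on G)" "\<And>x. x \<in> G \<Longrightarrow> norm (S x) \<le> M"
    and G: "emeasure (lebesgue_on G) G < \<infinity>"
  shows "(\<lambda>x. E x - S x) \<in> L2_space G"
proof -
  have Em: "E \<in> borel_measurable (lebesgue_on G)" and int: "integrable (lebesgue_on G) (\<lambda>x. (norm (E x))\<^sup>2)"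
    using E by (auto simp: L2_space_def)
  interpret finite_measure "lebesgue_on G" by (rule finite_measureI) (use G in auto)
  have "integrable (lebesgue_on G) (\<lambda>x. (norm (E x - S x))\<^sup>2)"
  proof (rule Bochner_Integration.integrable_bound)
    show "integrable (lebesgue_on G) (\<lambda>x. 4 * ((norm (E x))\<^sup>2 + (max 1 M)\<^sup>2))"
      using int by (intro integrable_mult_right Bochner_Integration.integrable_add) auto
    show "AE x in lebesgue_on G. norm ((norm (E x - S x))\<^sup>2) \<le> norm (4 * ((norm (E x))\<^sup>2 + (max 1 M)\<^sup>2))"
    proof (rule AE_I2)
      fix x assume "x \<in> space (lebesgue_on G)"
      then have "norm (S x) \<le> M" using S by simp
      from powr_diff_bound[of 2 2, OF _ _ this, of "E x"]
      show "norm ((norm (E x - S x))\<^sup>2) \<le> norm (4 * ((norm (E x))\<^sup>2 + (max 1 M)\<^sup>2))" by simp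
    qed
    show "(\<lambda>x. (norm (E x - S x))\<^sup>2) \<in> borel_measurable (lebesgue_on G)" using Em S(1) by measurable
  qed
  then show ?thesis using Em S(1) by (simp add: L2_space_def)
qed

lemma bounded_of_compact_support:
  fixes f :: "'a::euclidean_space \<Rightarrow> 'b::euclidean_space"
  assumes "continuous_on UNIV f" "compact K" "\<And>x. x \<notin> K \<Longrightarrow> f x = 0"
  obtains M where "\<And>x. norm (f x) \<le> M"
proof -
  have "bounded (f ` K)"
    using assms by (intro compact_imp_bounded compact_continuous_image continuous_on_subset[OF assms(1)]) auto
  then obtain M where M: "\<And>x. x \<in> K \<Longrightarrow> norm (f x) \<le> M" by (auto simp: bounded_iff)
  have "norm (f x) \<le> max 0 M" for x
    using M[of x] assms(3)[of x] by (cases "x \<in> K") (auto simp: le_max_iff_disj)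
  then show ?thesis by (rule that)
qed

text \<open>Members of \<open>X_slice\<close> are limits of test functions, for which the pointwise bound holds on the whole space
  after extension by zero. Both averaging operators are bounded on \<open>L\<^sup>1\<close>, so
  the integral of the amount by which the bound fails is controlled by the approximation error and must vanish.\<close>
lemma X_slice_ray_bound:
  fixes \<Omega> :: "(real^'n::finite) set" and f f' :: "real^'n \<Rightarrow> real^'n" and E' :: "real^'n \<Rightarrow> real^'n^'n"
  assumes \<Omega>: "open \<Omega>" "bounded \<Omega>"
    and qm: "(\<lambda>x. p (t, x)) \<in> borel_measurable (lebesgue_on \<Omega>)"
    and q: "\<And>x. x \<in> \<Omega> \<Longrightarrow> 1 \<le> p (t, x)" "\<And>x. x \<in> \<Omega> \<Longrightarrow> p (t, x) \<le> P"
    and f: "f \<in> X_slice \<Omega> p t"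
    and [measurable]: "f' \<in> borel_measurable borel" "E' \<in> borel_measurable borel"
    and zero: "\<And>x. x \<notin> \<Omega> \<Longrightarrow> f' x = 0" "\<And>x. x \<notin> \<Omega> \<Longrightarrow> E' x = 0"
    and ff': "AE x in lebesgue_on \<Omega>. f x = f' x"
    and EE': "AE x in lebesgue_on \<Omega>. sym_grad dirs \<Omega> f x = E' x"
    and R: "0 < R" "R \<le> 1" and c: "c = R / 4 * measure lborel (ball (0::real^'n) (R / 4))"
  shows "AE x in lborel. ennreal (c * norm (f' x))
    \<le> near_int R (\<lambda>y. ennreal (norm (f' y))) x + ray_int R (\<lambda>y. ennreal (norm (E' y))) x"
proof -
  let ?q = "\<lambda>x. p (t, x)"
  define F where "F x = ennreal (c * norm (f' x))" for x
  define G where "G x = near_int R (\<lambda>y. ennreal (norm (f' y))) x + ray_int R (\<lambda>y. ennreal (norm (E' y))) x" for x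
  have [measurable]: "F \<in> borel_measurable borel" "G \<in> borel_measurable borel"
    unfolding F_def[abs_def] G_def[abs_def] by measurable
  have \<Omega>L: "\<Omega> \<in> sets lebesgue" using \<Omega> by auto
  note fin = bounded_open_emeasure(2)[OF \<Omega>]
  define V where "V = enn2real (emeasure (lebesgue_on \<Omega>) \<Omega>)"
  have V: "emeasure (lebesgue_on \<Omega>) \<Omega> = ennreal V" "0 \<le> V" using fin by (auto simp: V_def)
  define B where "B = measure lborel (ball (0::real^'n) R)"
  have B: "emeasure lborel (ball (0::real^'n) R) = ennreal B" "0 \<le> B"
    using emeasure_bounded_finite[OF bounded_ball, of "0::real^'n" R]
    unfolding B_def by (auto intro!: emeasure_eq_ennreal_measure)
  have c0: "0 \<le> c" unfolding c using R by (intro mult_nonneg_nonneg measure_nonneg) auto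
  from f obtain Ef where Ef: "Ef \<in> Lp_space \<Omega> ?q" "has_sym_grad dirs \<Omega> f Ef" and fL2: "f \<in> L2_space \<Omega>"
    by (auto simp: X_slice_def L2p_space_def)
  from EE' sym_grad_AE_eq[OF \<Omega>(1) Ef(2)]
  have EfE': "AE x in lebesgue_on \<Omega>. Ef x = E' x" by eventually_elim simp
  \<comment> \<open>The difference of extended nonnegative reals is truncated at \<open>0\<close>, so it measures the failure of \<open>F \<le> G\<close>.\<close>
  have approx: "(\<integral>\<^sup>+x. F x - G x \<partial>lborel) \<le> ennreal (\<delta> * ((c + 2 * B) * (V + 1)))" if \<delta>: "0 < \<delta>" for \<delta>
  proof -
    obtain \<phi> where \<phi>: "\<phi> \<in> test_functions \<Omega>" "L2p_norm dirs \<Omega> ?q (\<lambda>x. f x - \<phi> x) < \<delta>"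
      using f \<delta> by (auto simp: X_slice_def)
    obtain K where K: "compact K" "K \<subseteq> \<Omega>" and z\<phi>: "\<And>x. x \<notin> K \<Longrightarrow> \<phi> x = 0"
      using test_function_supportE[OF \<phi>(1)] by blast
    have C1: "Ck 1 \<phi>" by (rule test_functions_Ck[OF \<phi>(1)])
    have c\<phi>: "continuous_on UNIV \<phi>" using test_functions_Ck[OF \<phi>(1), of 0] by simp
    let ?S = "sym_jacobian \<phi>"
    have cS: "continuous_on UNIV ?S" by (rule continuous_sym_jacobian[OF C1])
    have zS: "?S x = 0" if "x \<notin> K" for x
      using frechet_derivative_zero_outside[OF compact_imp_closed[OF K(1)] z\<phi> that]
      by (simp add: sym_jacobian_def vec_eq_iff)
    have [measurable]: "\<phi> \<in> borel_measurable borel" "?S \<in> borel_measurable borel"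
      using c\<phi> cS by (auto intro: borel_measurable_continuous_onI)
    have meas_on: "\<phi> \<in> borel_measurable (lebesgue_on \<Omega>)" "?S \<in> borel_measurable (lebesgue_on \<Omega>)"
      using c\<phi> cS by (auto intro!: measurable_restrict_space1 continuous_imp_lebesgue_measurable)
    obtain M1 where M1: "\<And>x. norm (\<phi> x) \<le> M1" using bounded_of_compact_support[OF c\<phi> K(1) z\<phi>] by blast
    obtain M2 where M2: "\<And>x. norm (?S x) \<le> M2" using bounded_of_compact_support[OF cS K(1) zS] by blast
    have dL2: "(\<lambda>x. f x - \<phi> x) \<in> L2_space \<Omega>"
      by (rule L2_space_diff_bounded[OF fL2 meas_on(1) M1 fin])
    have dLp: "(\<lambda>x. Ef x - ?S x) \<in> Lp_space \<Omega> ?q"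
      by (rule Lp_space_diff_bounded[OF Ef(1) meas_on(2) M2 qm q fin])
    have hs: "has_sym_grad dirs \<Omega> (\<lambda>x. f x - \<phi> x) (\<lambda>x. Ef x - ?S x)"
      by (rule has_sym_grad_diff[OF \<Omega>(1) _ Ef(2) has_sym_grad_test_function[OF \<Omega>(1) \<phi>(1)]])
        (simp add: dirs_def axis_in_Basis_iff)
    have "Lp_norm \<Omega> ?q (sym_grad dirs \<Omega> (\<lambda>x. f x - \<phi> x)) = Lp_norm \<Omega> ?q (\<lambda>x. Ef x - ?S x)"
      by (rule Lp_norm_cong_AE[OF sym_grad_AE_eq[OF \<Omega>(1) hs]])
    moreover have "0 \<le> Lp_norm \<Omega> ?q (\<lambda>x. Ef x - ?S x)" by (rule Lp_norm_nonneg[OF dLp qm q(1)])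
    moreover have "0 \<le> L2_norm \<Omega> (\<lambda>x. f x - \<phi> x)" by (simp add: L2_norm_def)
    ultimately have small: "L2_norm \<Omega> (\<lambda>x. f x - \<phi> x) < \<delta>" "Lp_norm \<Omega> ?q (\<lambda>x. Ef x - ?S x) < \<delta>"
      using \<phi>(2) by (auto simp: L2p_norm_def)
    obtain l where l: "0 < l" "l < \<delta>" "modular \<Omega> ?q (\<lambda>x. (Ef x - ?S x) /\<^sub>R l) \<le> 1"
      using Lp_norm_lessE[OF dLp qm q(1) small(2)] by blast
    have dEm: "(\<lambda>x. Ef x - ?S x) \<in> borel_measurable (lebesgue_on \<Omega>)" using dLp by (simp add: Lp_space_def)
    define a where "a x = ennreal (norm (f' x - \<phi> x))" for x
    define e where "e x = ennreal (norm (E' x - ?S x))" for x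
    have [measurable]: "a \<in> borel_measurable borel" "e \<in> borel_measurable borel"
      unfolding a_def[abs_def] e_def[abs_def] by measurable
    have "(\<integral>\<^sup>+x. a x \<partial>lborel) = (\<integral>\<^sup>+x. ennreal (norm (f x - \<phi> x)) \<partial>lebesgue_on \<Omega>)"
    proof (rule nn_integral_lborel_eq_lebesgue_on[OF \<Omega>L])
      show "a x = 0" if "x \<notin> \<Omega>" for x using zero(1) z\<phi> K(2) that by (auto simp: a_def subset_eq)
      show "AE x in lebesgue_on \<Omega>. a x = ennreal (norm (f x - \<phi> x))"
        using ff' by eventually_elim (simp add: a_def)
    qed
    also have "\<dots> \<le> ennreal \<delta> * (emeasure (lebesgue_on \<Omega>) \<Omega> + 1)"
      using small(1) by (intro nn_integral_norm_le_of_L2[OF dL2 \<delta>]) simp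
    also have "\<dots> = ennreal (\<delta> * (V + 1))" using V \<delta> by (simp add: ennreal_mult ennreal_plus)
    finally have Ia: "(\<integral>\<^sup>+x. a x \<partial>lborel) \<le> ennreal (\<delta> * (V + 1))" .
    have "(\<integral>\<^sup>+x. e x \<partial>lborel) = (\<integral>\<^sup>+x. ennreal (norm (Ef x - ?S x)) \<partial>lebesgue_on \<Omega>)"
    proof (rule nn_integral_lborel_eq_lebesgue_on[OF \<Omega>L])
      show "e x = 0" if "x \<notin> \<Omega>" for x using zero(2) zS K(2) that by (auto simp: e_def subset_eq)
      show "AE x in lebesgue_on \<Omega>. e x = ennreal (norm (Ef x - ?S x))"
        using EfE' by eventually_elim (simp add: e_def)
    qed
    also have "\<dots> \<le> ennreal l * (emeasure (lebesgue_on \<Omega>) \<Omega> + 1)"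
      by (rule nn_integral_norm_le_of_modular[OF dEm qm q(1) l(1,3)])
    also have "\<dots> \<le> ennreal \<delta> * (emeasure (lebesgue_on \<Omega>) \<Omega> + 1)"
      using l(2) by (intro mult_right_mono ennreal_leI) auto
    also have "\<dots> = ennreal (\<delta> * (V + 1))" using V \<delta> by (simp add: ennreal_mult ennreal_plus)
    finally have Ie: "(\<integral>\<^sup>+x. e x \<partial>lborel) \<le> ennreal (\<delta> * (V + 1))" .
    have "F x - G x \<le> ennreal c * a x + near_int R a x + ray_int R e x" for x
    proof -
      have "norm (f' x) \<le> norm (f' x - \<phi> x) + norm (\<phi> x)" using norm_triangle_sub[of "f' x" "\<phi> x"] by simp
      then have "c * norm (f' x) \<le> c * (norm (f' x - \<phi> x) + norm (\<phi> x))" using c0 by (rule mult_left_mono)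
      then have "F x \<le> ennreal (c * norm (f' x - \<phi> x) + c * norm (\<phi> x))"
        unfolding F_def by (intro ennreal_leI) (simp add: distrib_left)
      also have "\<dots> = ennreal c * a x + ennreal (c * norm (\<phi> x))"
        using c0 by (simp add: a_def ennreal_plus ennreal_mult)
      also have "ennreal (c * norm (\<phi> x)) \<le> near_int R (\<lambda>y. ennreal (norm (\<phi> y))) x + ray_int R (\<lambda>y. ennreal (norm (?S y))) x"
        unfolding c by (rule test_function_ray_bound[OF C1 R])
      also have "near_int R (\<lambda>y. ennreal (norm (\<phi> y))) x \<le> near_int R (\<lambda>y. ennreal (norm (f' y)) + a y) x"
      proof (rule near_int_mono)
        fix y
        have "norm (\<phi> y) \<le> norm (f' y) + norm (f' y - \<phi> y)"
          using norm_triangle_sub[of "\<phi> y" "f' y"] by (simp add: norm_minus_commute)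
        then have "ennreal (norm (\<phi> y)) \<le> ennreal (norm (f' y) + norm (f' y - \<phi> y))" by (rule ennreal_leI)
        then show "ennreal (norm (\<phi> y)) \<le> ennreal (norm (f' y)) + a y" by (simp add: a_def ennreal_plus)
      qed
      also have "\<dots> = near_int R (\<lambda>y. ennreal (norm (f' y))) x + near_int R a x"
        by (rule near_int_add) measurable
      also have "ray_int R (\<lambda>y. ennreal (norm (?S y))) x \<le> ray_int R (\<lambda>y. ennreal (norm (E' y)) + e y) x"
      proof (rule ray_int_mono)
        fix y
        have "norm (?S y) \<le> norm (E' y) + norm (E' y - ?S y)"
          using norm_triangle_sub[of "?S y" "E' y"] by (simp add: norm_minus_commute)
        then have "ennreal (norm (?S y)) \<le> ennreal (norm (E' y) + norm (E' y - ?S y))" by (rule ennreal_leI)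
        then show "ennreal (norm (?S y)) \<le> ennreal (norm (E' y)) + e y" by (simp add: e_def ennreal_plus)
      qed
      also have "\<dots> = ray_int R (\<lambda>y. ennreal (norm (E' y))) x + ray_int R e x"
        by (rule ray_int_add) measurable
      finally have "F x \<le> G x + (ennreal c * a x + near_int R a x + ray_int R e x)"
        by (simp add: G_def add_left_mono add_right_mono add_mono ac_simps)
      moreover have "F x \<noteq> top" by (simp add: F_def)
      ultimately show ?thesis by (simp add: ennreal_minus_le_iff)
    qed
    then have "(\<integral>\<^sup>+x. F x - G x \<partial>lborel) \<le> (\<integral>\<^sup>+x. ennreal c * a x + near_int R a x + ray_int R e x \<partial>lborel)"
      by (intro nn_integral_mono)
    also have "\<dots> = ennreal c * (\<integral>\<^sup>+x. a x \<partial>lborel) + (\<integral>\<^sup>+x. a x \<partial>lborel) * ennreal B + (\<integral>\<^sup>+x. e x \<partial>lborel) * ennreal B"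
      by (simp add: nn_integral_add nn_integral_cmult nn_integral_near_int nn_integral_ray_int B(1))
    also have "\<dots> \<le> ennreal c * ennreal (\<delta> * (V + 1)) + ennreal (\<delta> * (V + 1)) * ennreal B + ennreal (\<delta> * (V + 1)) * ennreal B"
      using Ia Ie by (intro add_mono mult_left_mono mult_right_mono) auto
    also have "\<dots> = ennreal (c * (\<delta> * (V + 1)) + \<delta> * (V + 1) * B + \<delta> * (V + 1) * B)"
      using c0 B(2) V(2) \<delta> by (simp flip: ennreal_plus ennreal_mult)
    also have "c * (\<delta> * (V + 1)) + \<delta> * (V + 1) * B + \<delta> * (V + 1) * B = \<delta> * ((c + 2 * B) * (V + 1))"
      by (simp add: algebra_simps)
    finally show ?thesis .
  qed
  have "(\<integral>\<^sup>+x. F x - G x \<partial>lborel) \<le> 0"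
  proof (rule ennreal_le_epsilon)
    fix \<epsilon> :: real assume \<epsilon>: "0 < \<epsilon>"
    let ?k = "(c + 2 * B) * (V + 1)"
    have k: "0 \<le> ?k" using c0 B(2) V(2) by simp
    have "(\<integral>\<^sup>+x. F x - G x \<partial>lborel) \<le> ennreal (\<epsilon> / (?k + 1) * ?k)"
      using \<epsilon> k by (intro approx) auto
    also have "\<dots> \<le> ennreal \<epsilon>"
      using \<epsilon> k by (intro ennreal_leI) (simp add: divide_le_eq mult_left_mono)
    finally show "(\<integral>\<^sup>+x. F x - G x \<partial>lborel) \<le> 0 + ennreal \<epsilon>" by simp
  qed
  then have "AE x in lborel. F x - G x = 0"
    by (subst (asm) le_zero_eq, subst (asm) nn_integral_0_iff_AE) auto
  then show ?thesis
    by eventually_elim (simp add: F_def G_def ennreal_minus_eq_0)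
qed

section \<open>Slices of a space-time symmetric gradient\<close>

text \<open>Products separate time and space, so that testing with them turns a space-time identity into one for
  almost every time.\<close>
lemma test_functions_tensor:
  fixes \<theta> :: "'a::euclidean_space \<Rightarrow> real" and \<beta> :: "'b::euclidean_space \<Rightarrow> real"
  assumes \<theta>: "\<theta> \<in> test_functions U" and \<beta>: "\<beta> \<in> test_functions W"
  shows "(\<lambda>z. \<theta> (fst z) * \<beta> (snd z)) \<in> test_functions (U \<times> W)"
proof -
  let ?\<psi> = "\<lambda>z :: 'a \<times> 'b. \<theta> (fst z) * \<beta> (snd z)"
  obtain K where K: "compact K" "K \<subseteq> U" "\<And>x. x \<notin> K \<Longrightarrow> \<theta> x = 0" using test_function_supportE[OF \<theta>] by blast
  obtain L where L: "compact L" "L \<subseteq> W" "\<And>x. x \<notin> L \<Longrightarrow> \<beta> x = 0" using test_function_supportE[OF \<beta>] by blast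
  have KL: "compact (K \<times> L)" using K(1) L(1) by (rule compact_Times)
  have "{z. ?\<psi> z \<noteq> 0} \<subseteq> K \<times> L" using K(3) L(3) by force
  then have c: "closure {z. ?\<psi> z \<noteq> 0} \<subseteq> K \<times> L" by (rule closure_minimal[OF _ compact_imp_closed[OF KL]])
  have "compact (closure {z. ?\<psi> z \<noteq> 0})"
    using bounded_subset[OF compact_imp_bounded[OF KL] c] by (simp add: compact_eq_bounded_closed)
  moreover have "closure {z. ?\<psi> z \<noteq> 0} \<subseteq> U \<times> W" using c K(2) L(2) by blast
  moreover have "\<forall>k. Ck k ?\<psi>"
    by (intro allI Ck_mult Ck_comp_projection[OF bounded_linear_fst] Ck_comp_projection[OF bounded_linear_snd]
        test_functions_Ck[OF \<theta>] test_functions_Ck[OF \<beta>]) (auto simp: Basis_prod_def)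
  ultimately show ?thesis unfolding test_functions_def by blast
qed

lemma frechet_derivative_tensor:
  fixes \<theta> :: "'a::euclidean_space \<Rightarrow> real" and \<beta> :: "'b::euclidean_space \<Rightarrow> real"
  assumes "Ck 1 \<theta>" "Ck 1 \<beta>"
  shows "frechet_derivative (\<lambda>z. \<theta> (fst z) * \<beta> (snd z)) (at (t, x)) (0, v)
    = \<theta> t * frechet_derivative \<beta> (at x) v"
proof -
  have D: "(\<theta> has_derivative frechet_derivative \<theta> (at y)) (at y)"
    "(\<beta> has_derivative frechet_derivative \<beta> (at w)) (at w)" for y w
    using assms Ck_differentiable[of 0] by simp_all
  have "((\<lambda>z. \<theta> (fst z)) has_derivative (\<lambda>h. frechet_derivative \<theta> (at (fst (t, x))) (fst h))) (at (t, x))"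
    by (rule has_derivative_compose[OF has_derivative_fst[OF has_derivative_ident] D(1)])
  moreover have "((\<lambda>z. \<beta> (snd z)) has_derivative (\<lambda>h. frechet_derivative \<beta> (at (snd (t, x))) (snd h))) (at (t, x))"
    by (rule has_derivative_compose[OF has_derivative_snd[OF has_derivative_ident] D(2)])
  ultimately have "((\<lambda>z. \<theta> (fst z) * \<beta> (snd z)) has_derivative
     (\<lambda>h. \<theta> (fst (t, x)) * frechet_derivative \<beta> (at (snd (t, x))) (snd h)
        + frechet_derivative \<theta> (at (fst (t, x))) (fst h) * \<beta> (snd (t, x)))) (at (t, x))"
    by (rule has_derivative_mult)
  then have "frechet_derivative (\<lambda>z. \<theta> (fst z) * \<beta> (snd z)) (at (t, x)) =
     (\<lambda>h. \<theta> (fst (t, x)) * frechet_derivative \<beta> (at (snd (t, x))) (snd h)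
        + frechet_derivative \<theta> (at (fst (t, x))) (fst h) * \<beta> (snd (t, x)))"
    by (rule frechet_derivative_at[symmetric])
  then show ?thesis using linear_0[OF has_derivative_linear[OF D(1)]] by simp
qed

lemma ex_borel_representative:
  fixes f :: "'a::euclidean_space \<Rightarrow> 'b::euclidean_space"
  assumes U: "U \<in> sets borel" and f: "f \<in> borel_measurable (lebesgue_on U)"
  obtains f' where "f' \<in> borel_measurable borel" "\<And>x. x \<notin> U \<Longrightarrow> f' x = 0"
    "AE x in lebesgue_on U. f x = f' x"
proof -
  have UL: "U \<in> sets lebesgue" using U by simp
  have "\<exists>g \<in> borel_measurable borel. AE x in lborel. indicator U x *\<^sub>R (f x \<bullet> b) = g x" for b
  proof -
    have "(\<lambda>x. f x \<bullet> b) \<in> borel_measurable (lebesgue_on U)" using f by measurable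
    then have "(\<lambda>x. indicator U x *\<^sub>R (f x \<bullet> b)) \<in> borel_measurable lebesgue"
      using UL by (subst (asm) borel_measurable_restrict_space_iff) auto
    from completion_ex_borel_measurable_real[OF this] show ?thesis by simp
  qed
  then obtain g where g: "\<And>b. g b \<in> borel_measurable borel"
    "\<And>b. AE x in lborel. indicator U x *\<^sub>R (f x \<bullet> b) = g b x" by metis
  define f' where "f' x = indicator U x *\<^sub>R (\<Sum>b\<in>Basis. g b x *\<^sub>R b)" for x
  show ?thesis
  proof
    show "f' \<in> borel_measurable borel" unfolding f'_def[abs_def] using g(1) U by measurable
    show "f' x = 0" if "x \<notin> U" for x using that by (simp add: f'_def)
    have "AE x in lborel. \<forall>b\<in>Basis. indicator U x *\<^sub>R (f x \<bullet> b) = g b x"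
      by (rule AE_finite_allI[OF finite_Basis g(2)])
    then have "AE x in lborel. x \<in> U \<longrightarrow> f x = f' x"
    proof eventually_elim
      case (elim x)
      show ?case
      proof
        assume x: "x \<in> U"
        have "(\<Sum>b\<in>Basis. g b x *\<^sub>R b) = (\<Sum>b\<in>Basis. (f x \<bullet> b) *\<^sub>R b)"
          using elim x by (intro sum.cong) auto
        then show "f x = f' x" using x by (simp add: f'_def euclidean_representation)
      qed
    qed
    then show "AE x in lebesgue_on U. f x = f' x"
      using UL by (subst AE_restrict_space_iff) (auto simp: AE_completion_iff)
  qed
qed

lemma AE_slices:
  fixes I :: "'a::euclidean_space set" and \<Omega> :: "'b::euclidean_space set"
  assumes "I \<in> sets borel" "\<Omega> \<in> sets borel" and P: "AE z in lebesgue_on (I \<times> \<Omega>). P z"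
  shows "AE t in lborel. t \<in> I \<longrightarrow> (AE x in lebesgue_on \<Omega>. P (t, x))"
proof -
  have "I \<times> \<Omega> \<in> sets (borel \<Otimes>\<^sub>M borel)" using assms(1,2) by (intro pair_measureI) auto
  then have "I \<times> \<Omega> \<in> sets borel" unfolding borel_prod .
  then have "I \<times> \<Omega> \<in> sets lebesgue" by simp
  then have "AE z in lebesgue. z \<in> I \<times> \<Omega> \<longrightarrow> P z"
    using P by (subst (asm) AE_restrict_space_iff) auto
  then have "AE z in lborel. z \<in> I \<times> \<Omega> \<longrightarrow> P z"
    by (simp only: AE_completion_iff)
  then have "AE z in lborel \<Otimes>\<^sub>M lborel. z \<in> I \<times> \<Omega> \<longrightarrow> P z"
    by (simp only: lborel_prod)
  then have "AE t in lborel. AE x in lborel. (t, x) \<in> I \<times> \<Omega> \<longrightarrow> P (t, x)"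
    by (rule lborel_pair.AE_pair)
  then show ?thesis
  proof eventually_elim
    case (elim t)
    show ?case
    proof
      assume "t \<in> I"
      then have "AE x in lborel. x \<in> \<Omega> \<longrightarrow> P (t, x)" using elim by simp
      then show "AE x in lebesgue_on \<Omega>. P (t, x)"
        using assms(2) by (subst AE_restrict_space_iff) (auto simp: AE_completion_iff)
    qed
  qed
qed

lemma integral_lebesgue_on_eq_lborel_AE:
  fixes f f' :: "'a::euclidean_space \<Rightarrow> real"
  assumes U: "U \<in> sets lebesgue" and f: "f \<in> borel_measurable (lebesgue_on U)"
    and f': "f' \<in> borel_measurable borel" "\<And>x. x \<notin> U \<Longrightarrow> f' x = 0" and eq: "AE x in lebesgue_on U. f x = f' x"
  shows "(LINT x|lebesgue_on U. f x) = (LINT x|lborel. f' x)"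
proof -
  have "f' \<in> borel_measurable (lebesgue_on U)"
    using f'(1) by (intro measurable_restrict_space1 measurable_completion) simp
  then have "(LINT x|lebesgue_on U. f x) = (LINT x|lebesgue_on U. f' x)"
    using f eq by (intro integral_cong_AE)
  also have "\<dots> = (LINT x|lborel. f' x)" by (rule integral_lebesgue_on_eq_lborel[OF U f'])
  finally show ?thesis .
qed

lemma integrable_mult_bounded_continuous:
  fixes f h :: "'a::euclidean_space \<Rightarrow> real"
  assumes f: "integrable lborel f" and h: "continuous_on UNIV h" "\<And>x. \<bar>h x\<bar> \<le> M"
  shows "integrable lborel (\<lambda>x. f x * h x)"
proof (rule Bochner_Integration.integrable_bound[OF integrable_mult_left[OF f, of M]])
  have [measurable]: "h \<in> borel_measurable borel" by (rule borel_measurable_continuous_onI[OF h(1)])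
  have "f \<in> borel_measurable lborel" using f by (rule borel_measurable_integrable)
  then show "(\<lambda>x. f x * h x) \<in> borel_measurable lborel" by measurable
  show "AE x in lborel. norm (f x * h x) \<le> norm (f x * M)"
  proof (rule AE_I2)
    fix x
    have "\<bar>h x\<bar> \<le> \<bar>M\<bar>" using h(2)[of x] by linarith
    then show "norm (f x * h x) \<le> norm (f x * M)" by (simp add: abs_mult mult_left_mono)
  qed
qed

lemma bounded_linear_borel_measurable:
  fixes L :: "'a::euclidean_space \<Rightarrow> 'b::euclidean_space"
  shows "bounded_linear L \<Longrightarrow> L \<in> borel_measurable borel"
  by (intro borel_measurable_continuous_onI linear_continuous_on)

lemma has_sym_gradD:
  "has_sym_grad e U u E \<Longrightarrow> \<phi> \<in> test_functions U \<Longrightarrow>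
    (LINT x|lebesgue_on U. E x $ i $ j * \<phi> x) = dist_sym_grad e U u i j \<phi>"
  by (simp add: has_sym_grad_def)

lemma integrable_lborel_imp_locally_integrable:
  fixes f :: "'a::euclidean_space \<Rightarrow> 'b::euclidean_space"
  assumes "integrable lborel f"
  shows "locally_integrable U f"
proof -
  have "integrable lebesgue f"
    using assms borel_measurable_integrable[OF assms] by (subst integrable_completion) auto
  then show ?thesis
    unfolding locally_integrable_def
    by (auto simp: borel_compact intro!: integrable_restrict_space[THEN iffD2] integrable_mult_indicator)
qed

text \<open>Testing with \<open>\<theta> t * \<beta> x\<close> shows that the function of \<open>t\<close> in question is orthogonal to every bump
  \<open>\<theta>\<close>. Borel representatives that vanish outside the domain are used to apply the Fubini theorem.\<close>
lemma AE_slice_weak_equation: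
  fixes \<Omega> :: "(real^'n::finite) set" and u u' :: "real \<times> (real^'n) \<Rightarrow> real^'n" and E E' :: "real \<times> (real^'n) \<Rightarrow> real^'n^'n"
  assumes I: "open I" and \<Omega>: "open \<Omega>"
    and E: "has_sym_grad space_dirs (I \<times> \<Omega>) u E"
    and meas: "u \<in> borel_measurable (lebesgue_on (I \<times> \<Omega>))" "E \<in> borel_measurable (lebesgue_on (I \<times> \<Omega>))"
    and int: "integrable lborel u'" "integrable lborel E'"
    and zero: "\<And>z. z \<notin> I \<times> \<Omega> \<Longrightarrow> u' z = 0" "\<And>z. z \<notin> I \<times> \<Omega> \<Longrightarrow> E' z = 0"
    and uu': "AE z in lebesgue_on (I \<times> \<Omega>). u z = u' z" and EE': "AE z in lebesgue_on (I \<times> \<Omega>). E z = E' z"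
    and \<beta>: "\<beta> \<in> test_functions \<Omega>"
  shows "AE t in lebesgue_on I. (LINT x|lborel. E' (t, x) $ i $ j * \<beta> x
      + (u' (t, x) $ i * frechet_derivative \<beta> (at x) (dirs j) + u' (t, x) $ j * frechet_derivative \<beta> (at x) (dirs i)) / 2) = 0"
proof -
  let ?D = "\<lambda>l x. frechet_derivative \<beta> (at x) (dirs l)"
  define k where "k z = E' z $ i $ j * \<beta> (snd z) + (u' z $ i * ?D j (snd z) + u' z $ j * ?D i (snd z)) / 2" for z
  have IO: "open (I \<times> \<Omega>)" using I \<Omega> by (rule open_Times)
  have IOL: "I \<times> \<Omega> \<in> sets lebesgue" using IO by auto
  obtain K where K: "compact K" "\<And>x. x \<notin> K \<Longrightarrow> \<beta> x = 0" using test_function_supportE[OF \<beta>] by blast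
  have c\<beta>: "continuous_on UNIV \<beta>" using test_functions_Ck[OF \<beta>, of 0] by simp
  have cD: "continuous_on UNIV (?D l)" for l
    using test_functions_Ck[OF \<beta>, of 1] by (simp add: dirs_def axis_in_Basis_iff)
  have zD: "?D l x = 0" if "x \<notin> K" for l x
    using frechet_derivative_zero_outside[OF compact_imp_closed[OF K(1)] K(2) that] by simp
  have int_E: "integrable lborel (\<lambda>z. E' z $ i $ j)" and int_u: "integrable lborel (\<lambda>z. u' z $ l)" for l
    by (rule integrable_bounded_linear[OF bounded_linear_matrix_entry int(2)],
        rule integrable_bounded_linear[OF bounded_linear_vec_nth int(1)])
  obtain M0 where M0: "\<And>x. norm (\<beta> x) \<le> M0" using bounded_of_compact_support[OF c\<beta> K] by blast
  have "\<exists>M. \<forall>x. norm (?D l x) \<le> M" for l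
    using bounded_of_compact_support[OF cD[of l] K(1) zD] by blast
  then obtain M where M: "\<And>l x. norm (?D l x) \<le> M l" by metis
  have snd_cont: "continuous_on UNIV (\<lambda>z :: real \<times> (real^'n). g (snd z))" if "continuous_on UNIV g" for g :: "real^'n \<Rightarrow> real"
    by (intro continuous_on_compose2[OF that] continuous_intros) auto
  have term_int: "integrable lborel (\<lambda>z. E' z $ i $ j * \<beta> (snd z))" "integrable lborel (\<lambda>z. u' z $ m * ?D l (snd z))" for l m
    using M0 M by (auto intro!: integrable_mult_bounded_continuous int_E int_u snd_cont c\<beta> cD)
  have k_int: "integrable lborel k"
    unfolding k_def[abs_def]
    by (intro Bochner_Integration.integrable_add integrable_divide term_int)
  define H where "H t = (LINT x|lborel. k (t, x))" for t
  have k_int': "integrable (lborel \<Otimes>\<^sub>M lborel) k" using k_int by (simp add: lborel_prod)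
  have H_int: "integrable lborel H"
    unfolding H_def[abs_def] using lborel_pair.integrable_fst'[OF k_int'] .
  have "AE t in lebesgue_on I. H t = 0"
  proof (rule AE_zero_of_bumps[OF I])
    show "locally_integrable I H" by (rule integrable_lborel_imp_locally_integrable[OF H_int])
    fix a b :: real and m
    assume "cbox a b \<subseteq> I"
    then have \<theta>: "bump a b m \<in> test_functions I" by (rule bump_test_function)
    let ?\<theta> = "bump a b m"
    have c\<theta>: "continuous_on UNIV ?\<theta>" using test_functions_Ck[OF \<theta>, of 0] by simp
    let ?\<psi> = "\<lambda>z. ?\<theta> (fst z) * \<beta> (snd z)"
    have \<psi>: "?\<psi> \<in> test_functions (I \<times> \<Omega>)" by (rule test_functions_tensor[OF \<theta> \<beta>])
    have D\<psi>: "frechet_derivative ?\<psi> (at z) (space_dirs l) = ?\<theta> (fst z) * ?D l (snd z)" for z l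
      using frechet_derivative_tensor[OF test_functions_Ck[OF \<theta>] test_functions_Ck[OF \<beta>], of "fst z" "snd z" "dirs l"]
      by (simp add: space_dirs_def dirs_def)
    have fst_cont: "continuous_on UNIV (\<lambda>z :: real \<times> (real^'n). ?\<theta> (fst z))"
      by (intro continuous_on_compose2[OF c\<theta>] continuous_intros) auto
    have \<theta>_mult: "integrable lborel (\<lambda>z. f z * ?\<theta> (fst z))" if "integrable lborel f" for f :: "real \<times> (real^'n) \<Rightarrow> real"
      using that by (rule integrable_mult_bounded_continuous[OF _ fst_cont, of _ 1]) (simp add: bump_bounds)
    have conv: "(LINT z|lebesgue_on (I \<times> \<Omega>). f z * (?\<theta> (fst z) * g (snd z))) = (LINT z|lborel. f' z * g (snd z) * ?\<theta> (fst z))"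
      if f: "f \<in> borel_measurable (lebesgue_on (I \<times> \<Omega>))" "integrable lborel f'" "\<And>z. z \<notin> I \<times> \<Omega> \<Longrightarrow> f' z = 0"
        "AE z in lebesgue_on (I \<times> \<Omega>). f z = f' z" and g: "continuous_on UNIV g"
      for f f' :: "real \<times> (real^'n) \<Rightarrow> real" and g :: "real^'n \<Rightarrow> real"
    proof (rule integral_lebesgue_on_eq_lborel_AE[OF IOL])
      have cc: "continuous_on UNIV (\<lambda>z :: real \<times> (real^'n). ?\<theta> (fst z) * g (snd z))"
        by (intro continuous_on_mult fst_cont snd_cont[OF g])
      then have "(\<lambda>z. ?\<theta> (fst z) * g (snd z)) \<in> borel_measurable (lebesgue_on (I \<times> \<Omega>))"
        by (intro measurable_restrict_space1 continuous_imp_lebesgue_measurable)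
      with f(1) show "(\<lambda>z. f z * (?\<theta> (fst z) * g (snd z))) \<in> borel_measurable (lebesgue_on (I \<times> \<Omega>))"
        by (rule borel_measurable_times)
      have "(\<lambda>z. f' z * (?\<theta> (fst z) * g (snd z))) \<in> borel_measurable borel"
        using borel_measurable_integrable[OF f(2)] borel_measurable_continuous_onI[OF cc] by simp
      then show "(\<lambda>z. f' z * g (snd z) * ?\<theta> (fst z)) \<in> borel_measurable borel" by (simp only: mult_ac)
      show "f' z * g (snd z) * ?\<theta> (fst z) = 0" if "z \<notin> I \<times> \<Omega>" for z using f(3)[OF that] by simp
      show "AE z in lebesgue_on (I \<times> \<Omega>). f z * (?\<theta> (fst z) * g (snd z)) = f' z * g (snd z) * ?\<theta> (fst z)"
        using f(4) by eventually_elim simp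
    qed
    have ui: "(\<lambda>z. u z $ l) \<in> borel_measurable (lebesgue_on (I \<times> \<Omega>))" for l
      by (rule measurable_compose[OF meas(1) bounded_linear_borel_measurable[OF bounded_linear_vec_nth]])
    have Eij: "(\<lambda>z. E z $ i $ j) \<in> borel_measurable (lebesgue_on (I \<times> \<Omega>))"
      by (rule measurable_compose[OF meas(2) bounded_linear_borel_measurable[OF bounded_linear_matrix_entry]])
    have dd: "dist_deriv (I \<times> \<Omega>) (space_dirs l) (\<lambda>z. u z $ m) ?\<psi> = - (LINT z|lborel. u' z $ m * ?D l (snd z) * ?\<theta> (fst z))" for l m
      unfolding dist_deriv_def D\<psi>
      by (subst conv[OF ui int_u _ _ cD]) (use zero(1) uu' in \<open>auto elim: eventually_mono\<close>)
    have arith: "L = (- X + - Y) / 2 \<Longrightarrow> L = A \<Longrightarrow> 0 = A + (X + Y) / 2" for L A X Y :: real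
      by (simp add: field_simps)
    have "(LINT z|lebesgue_on (I \<times> \<Omega>). E z $ i $ j * ?\<psi> z) = dist_sym_grad space_dirs (I \<times> \<Omega>) u i j ?\<psi>"
      by (rule has_sym_gradD[OF E \<psi>])
    moreover have "(LINT z|lebesgue_on (I \<times> \<Omega>). E z $ i $ j * ?\<psi> z) = (LINT z|lborel. E' z $ i $ j * \<beta> (snd z) * ?\<theta> (fst z))"
      by (rule conv[OF Eij int_E _ _ c\<beta>]) (use zero(2) EE' in \<open>auto elim: eventually_mono\<close>)
    ultimately have "0 = (LINT z|lborel. E' z $ i $ j * \<beta> (snd z) * ?\<theta> (fst z))
       + ((LINT z|lborel. u' z $ i * ?D j (snd z) * ?\<theta> (fst z)) + (LINT z|lborel. u' z $ j * ?D i (snd z) * ?\<theta> (fst z))) / 2"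
      unfolding dist_sym_grad_def dd by (rule arith)
    also have "\<dots> = (LINT z|lborel. E' z $ i $ j * \<beta> (snd z) * ?\<theta> (fst z)
       + (u' z $ i * ?D j (snd z) * ?\<theta> (fst z) + u' z $ j * ?D i (snd z) * ?\<theta> (fst z)) / 2)"
      by (simp add: Bochner_Integration.integral_add \<theta>_mult term_int)
    also have "\<dots> = (LINT z|lborel. k z * ?\<theta> (fst z))"
      by (intro Bochner_Integration.integral_cong refl) (simp add: k_def algebra_simps add_divide_distrib)
    also have "\<dots> = (LINT z|(lborel \<Otimes>\<^sub>M lborel). k z * ?\<theta> (fst z))" by (simp add: lborel_prod)
    also have "\<dots> = (LINT t|lborel. LINT x|lborel. k (t, x) * ?\<theta> (fst (t, x)))"
      by (rule lborel_pair.integral_fst'[symmetric]) (use \<theta>_mult[OF k_int] in \<open>simp add: lborel_prod\<close>)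
    also have "\<dots> = (LINT t|lborel. H t * ?\<theta> t)" by (simp add: H_def)
    also have "\<dots> = (LINT t|lebesgue_on I. H t * ?\<theta> t)"
    proof (rule integral_lebesgue_on_eq_lborel[symmetric])
      show "I \<in> sets lebesgue" using I by auto
      show "(\<lambda>t. H t * ?\<theta> t) \<in> borel_measurable borel"
        using borel_measurable_integrable[OF H_int] borel_measurable_continuous_onI[OF c\<theta>] by simp
      show "H t * ?\<theta> t = 0" if "t \<notin> I" for t
      proof -
        have "t \<notin> box a b" using that \<open>cbox a b \<subseteq> I\<close> box_subset_cbox by blast
        then show ?thesis by (simp add: bump_outside)
      qed
    qed
    finally show "(LINT t|lebesgue_on I. H t * ?\<theta> t) = 0" by simp
  qed
  then show ?thesis by (simp add: H_def k_def)
qed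


text \<open>For a fixed test function the weak equation holds outside a null set of times; the countable family of
  rational bumps makes the exceptional set uniform, and suffices to identify the weak symmetric gradient of the slice.\<close>
lemma AE_slice_sym_grad:
  fixes \<Omega> :: "(real^'n::finite) set" and u u' :: "real \<times> (real^'n) \<Rightarrow> real^'n" and E E' :: "real \<times> (real^'n) \<Rightarrow> real^'n^'n"
  assumes I: "open I" and \<Omega>: "open \<Omega>"
    and E: "has_sym_grad space_dirs (I \<times> \<Omega>) u E"
    and meas: "u \<in> borel_measurable (lebesgue_on (I \<times> \<Omega>))" "E \<in> borel_measurable (lebesgue_on (I \<times> \<Omega>))"
    and int: "integrable lborel u'" "integrable lborel E'"
    and zero: "\<And>z. z \<notin> I \<times> \<Omega> \<Longrightarrow> u' z = 0" "\<And>z. z \<notin> I \<times> \<Omega> \<Longrightarrow> E' z = 0"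
    and uu': "AE z in lebesgue_on (I \<times> \<Omega>). u z = u' z" and EE': "AE z in lebesgue_on (I \<times> \<Omega>). E z = E' z"
  shows "AE t in lborel. t \<in> I \<longrightarrow> (\<forall>F. has_sym_grad dirs \<Omega> (\<lambda>x. u (t, x)) F \<longrightarrow>
    (\<lambda>x. u (t, x)) \<in> borel_measurable (lebesgue_on \<Omega>) \<longrightarrow> (AE x in lebesgue_on \<Omega>. F x = E' (t, x)))"
proof -
  let ?D = "\<lambda>\<beta> l x. frechet_derivative \<beta> (at x) (dirs l)"
  let ?eq = "\<lambda>\<beta> i j t. (LINT x|lborel. E' (t, x) $ i $ j * \<beta> x
      + (u' (t, x) $ i * ?D \<beta> j x + u' (t, x) $ j * ?D \<beta> i x) / 2) = 0"
  define \<D> :: "(real^'n \<Rightarrow> real) set" where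
    "\<D> = {bump a b m | a b m. a \<in> rational_points \<and> b \<in> rational_points \<and> cbox a b \<subseteq> \<Omega>}"
  have "\<D> \<subseteq> (\<lambda>(a, b, m). bump a b m) ` (rational_points \<times> rational_points \<times> UNIV)"
  proof
    fix \<beta> assume "\<beta> \<in> \<D>"
    then obtain a b m where "\<beta> = bump a b m" "a \<in> rational_points" "b \<in> rational_points"
      unfolding \<D>_def by blast
    then show "\<beta> \<in> (\<lambda>(a, b, m). bump a b m) ` (rational_points \<times> rational_points \<times> UNIV)"
      by (intro image_eqI[of _ _ "(a, b, m)"]) auto
  qed
  moreover have "countable ((\<lambda>(a, b, m). bump a b m) ` (rational_points \<times> rational_points \<times> UNIV) :: (real^'n \<Rightarrow> real) set)"
    by (intro countable_image countable_SIGMA countable_rational_points) auto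
  ultimately have "countable \<D>" by (rule countable_subset)
  have \<D>_test: "\<beta> \<in> test_functions \<Omega>" if "\<beta> \<in> \<D>" for \<beta>
    using that bump_test_function unfolding \<D>_def by blast
  have "\<forall>\<beta>\<in>\<D>. AE t in lebesgue_on I. \<forall>i j. ?eq \<beta> i j t"
    by (intro ballI eventually_all_finite
        AE_slice_weak_equation[OF I \<Omega> E meas int zero uu' EE'] \<D>_test)
  then have "AE t in lebesgue_on I. \<forall>\<beta>\<in>\<D>. \<forall>i j. ?eq \<beta> i j t"
    by (subst AE_ball_countable[OF \<open>countable \<D>\<close>])
  then have 1: "AE t in lborel. t \<in> I \<longrightarrow> (\<forall>\<beta>\<in>\<D>. \<forall>i j. ?eq \<beta> i j t)"
    using I by (subst (asm) AE_restrict_space_iff) (auto simp: AE_completion_iff)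
  have int': "integrable (lborel \<Otimes>\<^sub>M lborel) u'" "integrable (lborel \<Otimes>\<^sub>M lborel) E'"
    using int by (simp_all add: lborel_prod)
  note 2 = lborel_pair.AE_integrable_fst'[OF int'(1)] lborel_pair.AE_integrable_fst'[OF int'(2)]
  have 3: "AE t in lborel. t \<in> I \<longrightarrow> (AE x in lebesgue_on \<Omega>. u (t, x) = u' (t, x))"
    by (rule AE_slices[OF _ _ uu']) (use I \<Omega> in auto)
  from 1 2 3 show ?thesis
  proof eventually_elim
    case (elim t)
    show ?case
    proof (intro impI allI)
      fix F
      assume t: "t \<in> I" and F: "has_sym_grad dirs \<Omega> (\<lambda>x. u (t, x)) F"
        and um: "(\<lambda>x. u (t, x)) \<in> borel_measurable (lebesgue_on \<Omega>)"
      have eq: "?eq \<beta> i j t" if "\<beta> \<in> \<D>" for \<beta> i j using elim(1) t that by blast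
      have ut: "AE x in lebesgue_on \<Omega>. u (t, x) = u' (t, x)" using elim(4) t by blast
      have \<Omega>L: "\<Omega> \<in> sets lebesgue" using \<Omega> by auto
      have Ei: "integrable lborel (\<lambda>x. E' (t, x) $ i $ j)" for i j
        by (rule integrable_bounded_linear[OF bounded_linear_matrix_entry elim(3)])
      have ui: "integrable lborel (\<lambda>x. u' (t, x) $ l)" for l
        by (rule integrable_bounded_linear[OF bounded_linear_vec_nth elim(2)])
      have zt: "u' (t, x) = 0" "E' (t, x) = 0" if "x \<notin> \<Omega>" for x
        using zero that by auto
      show "AE x in lebesgue_on \<Omega>. F x = E' (t, x)"
      proof (rule matrix_AE_eqI)
        fix i j
        have liF: "locally_integrable \<Omega> (\<lambda>x. F x $ i $ j)"
          using F by (auto simp: has_sym_grad_def intro: locally_integrable_linear[OF _ bounded_linear_matrix_entry])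
        have liE: "locally_integrable \<Omega> (\<lambda>x. E' (t, x) $ i $ j)"
          by (rule integrable_lborel_imp_locally_integrable[OF Ei])
        have "AE x in lebesgue_on \<Omega>. F x $ i $ j - E' (t, x) $ i $ j = 0"
        proof (rule AE_zero_of_bumps[OF \<Omega> locally_integrable_diff[OF liF liE]])
          fix a b :: "real^'n" and m
          assume "a \<in> rational_points" "b \<in> rational_points" "cbox a b \<subseteq> \<Omega>"
          then have \<beta>\<D>: "bump a b m \<in> \<D>" unfolding \<D>_def by blast
          let ?\<beta> = "bump a b m"
          have \<beta>: "?\<beta> \<in> test_functions \<Omega>" by (rule \<D>_test[OF \<beta>\<D>])
          obtain K where K: "compact K" "K \<subseteq> \<Omega>" "\<And>x. x \<notin> K \<Longrightarrow> ?\<beta> x = 0" using test_function_supportE[OF \<beta>] by blast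
          have c\<beta>: "continuous_on UNIV ?\<beta>" using test_functions_Ck[OF \<beta>, of 0] by simp
          have cD: "continuous_on UNIV (?D ?\<beta> l)" for l
            using test_functions_Ck[OF \<beta>, of 1] by (simp add: dirs_def axis_in_Basis_iff)
          have zD: "?D ?\<beta> l x = 0" if "x \<notin> K" for l x
            using frechet_derivative_zero_outside[OF compact_imp_closed[OF K(1)] K(3) that] by simp
          have Di: "integrable lborel (\<lambda>x. u' (t, x) $ k * ?D ?\<beta> l x)" for k l
          proof -
            obtain M where "\<And>x. norm (?D ?\<beta> l x) \<le> M"
              using bounded_of_compact_support[OF cD[of l] K(1) zD] by blast
            then show ?thesis by (intro integrable_mult_bounded_continuous[OF ui cD]) auto
          qed
          have E\<beta>i: "integrable lborel (\<lambda>x. E' (t, x) $ i $ j * ?\<beta> x)"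
            by (rule integrable_mult_bounded_continuous[OF Ei c\<beta>, where M = 1]) (simp add: bump_bounds)
          have E\<beta>: "(LINT x|lebesgue_on \<Omega>. E' (t, x) $ i $ j * ?\<beta> x) = (LINT x|lborel. E' (t, x) $ i $ j * ?\<beta> x)"
            using borel_measurable_integrable[OF E\<beta>i] zt(2) by (intro integral_lebesgue_on_eq_lborel[OF \<Omega>L]) auto
          have dd: "dist_deriv \<Omega> (dirs l) (\<lambda>x. u (t, x) $ k) ?\<beta> = - (LINT x|lborel. u' (t, x) $ k * ?D ?\<beta> l x)" for k l
          proof -
            have "(LINT x|lebesgue_on \<Omega>. u (t, x) $ k * ?D ?\<beta> l x) = (LINT x|lborel. u' (t, x) $ k * ?D ?\<beta> l x)"
            proof (rule integral_lebesgue_on_eq_lborel_AE[OF \<Omega>L])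
              have uk: "(\<lambda>x. u (t, x) $ k) \<in> borel_measurable (lebesgue_on \<Omega>)"
                by (rule measurable_compose[OF um bounded_linear_borel_measurable[OF bounded_linear_vec_nth]])
              show "(\<lambda>x. u (t, x) $ k * ?D ?\<beta> l x) \<in> borel_measurable (lebesgue_on \<Omega>)"
                by (rule borel_measurable_times[OF uk measurable_restrict_space1[OF continuous_imp_lebesgue_measurable[OF cD]]])
              show "(\<lambda>x. u' (t, x) $ k * ?D ?\<beta> l x) \<in> borel_measurable borel"
                using borel_measurable_integrable[OF Di] by simp
              show "u' (t, x) $ k * ?D ?\<beta> l x = 0" if "x \<notin> \<Omega>" for x using zt(1)[OF that] by simp
              show "AE x in lebesgue_on \<Omega>. u (t, x) $ k * ?D ?\<beta> l x = u' (t, x) $ k * ?D ?\<beta> l x"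
                using ut by eventually_elim simp
            qed
            then show ?thesis by (simp add: dist_deriv_def)
          qed
          have "0 = (LINT x|lborel. E' (t, x) $ i $ j * ?\<beta> x + (u' (t, x) $ i * ?D ?\<beta> j x + u' (t, x) $ j * ?D ?\<beta> i x) / 2)"
            using eq[OF \<beta>\<D>, of i j] by simp
          also have "\<dots> = (LINT x|lborel. E' (t, x) $ i $ j * ?\<beta> x)
            + ((LINT x|lborel. u' (t, x) $ i * ?D ?\<beta> j x) + (LINT x|lborel. u' (t, x) $ j * ?D ?\<beta> i x)) / 2"
            by (simp add: Bochner_Integration.integral_add Di E\<beta>i)
          finally have 4: "0 = (LINT x|lborel. E' (t, x) $ i $ j * ?\<beta> x)
            + ((LINT x|lborel. u' (t, x) $ i * ?D ?\<beta> j x) + (LINT x|lborel. u' (t, x) $ j * ?D ?\<beta> i x)) / 2" .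
          have arith: "0 = A + (X + Y) / 2 \<Longrightarrow> L = (- X + - Y) / 2 \<Longrightarrow> L = A" for L A X Y :: real
            by (simp add: field_simps)
          have FE: "(LINT x|lebesgue_on \<Omega>. F x $ i $ j * ?\<beta> x) = (LINT x|lborel. E' (t, x) $ i $ j * ?\<beta> x)"
            using 4 has_sym_gradD[OF F \<beta>, of i j, unfolded dist_sym_grad_def dd] by (rule arith)
          have "(LINT x|lebesgue_on \<Omega>. (F x $ i $ j - E' (t, x) $ i $ j) * ?\<beta> x)
            = (LINT x|lebesgue_on \<Omega>. F x $ i $ j * ?\<beta> x) - (LINT x|lebesgue_on \<Omega>. E' (t, x) $ i $ j * ?\<beta> x)"
            unfolding left_diff_distrib
            by (intro Bochner_Integration.integral_diff integrable_mult_test_function[OF \<Omega> _ \<beta>] liF liE)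
          then show "(LINT x|lebesgue_on \<Omega>. (F x $ i $ j - E' (t, x) $ i $ j) * ?\<beta> x) = 0"
            by (simp add: FE E\<beta>)
        qed
        then show "AE x in lebesgue_on \<Omega>. F x $ i $ j = E' (t, x) $ i $ j" by simp
      qed
    qed
  qed
qed

section \<open>The modular estimate and the embedding\<close>

text \<open>Finiteness of \<open>Y_esssup\<close> and positivity of the measure of \<open>I\<close> ensure that the conversion of the
  essential supremum to a real number is faithful.\<close>
lemma Y_inf_norm_bounds:
  assumes u: "u \<in> Y_inf_space I \<Omega>" and I: "open I" "I \<noteq> {}"
  shows "0 \<le> Y_inf_norm I \<Omega> u" "AE t in lebesgue_on I. L2_norm \<Omega> (\<lambda>x. u (t, x)) \<le> Y_inf_norm I \<Omega> u"
proof -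
  let ?N = "\<lambda>t. L2_norm \<Omega> (\<lambda>x. u (t, x))"
  have ae: "AE t in lebesgue_on I. ereal (?N t) \<le> Y_esssup I \<Omega> u"
    unfolding Y_esssup_def by (rule esssup_AE)
  have nz: "\<not> (AE t in lebesgue_on I. False)"
  proof
    assume "AE t in lebesgue_on I. False"
    then have "AE t in lebesgue. t \<in> I \<longrightarrow> False" using I by (subst (asm) AE_restrict_space_iff) auto
    then have "I \<in> null_sets lebesgue" using I by (subst (asm) AE_iff_null) (auto simp: null_sets_def)
    then show False using open_not_negligible[OF I] by (simp add: negligible_iff_null_sets)
  qed
  have "Y_esssup I \<Omega> u < \<infinity>" using u by (simp add: Y_inf_space_def)
  moreover have "0 \<le> Y_esssup I \<Omega> u"
  proof (rule ccontr)
    assume "\<not> 0 \<le> Y_esssup I \<Omega> u"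
    then have neg: "Y_esssup I \<Omega> u < 0" by simp
    have "AE t in lebesgue_on I. False"
      using ae
    proof eventually_elim
      case (elim t)
      have "ereal (?N t) < 0" by (rule order.strict_trans1[OF elim neg])
      moreover have "0 \<le> ?N t" by (simp add: L2_norm_def)
      ultimately show False by simp
    qed
    then show False using nz by simp
  qed
  ultimately have Y: "Y_esssup I \<Omega> u = ereal (Y_inf_norm I \<Omega> u)"
    unfolding Y_inf_norm_def by (cases "Y_esssup I \<Omega> u") auto
  then show "0 \<le> Y_inf_norm I \<Omega> u" using \<open>0 \<le> Y_esssup I \<Omega> u\<close> by simp
  show "AE t in lebesgue_on I. ?N t \<le> Y_inf_norm I \<Omega> u" using ae by (simp add: Y)
qed

text \<open>For a continuous function an almost everywhere bound on an open set holds everywhere, because nonempty open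
  sets are not null.\<close>
lemma ess_inf_gt_imp_ge:
  fixes p :: "'a::euclidean_space \<Rightarrow> real"
  assumes G: "open G" and p: "continuous_on G p" and e: "ess_inf G p > ereal a" and z: "z \<in> G"
  shows "a \<le> p z"
proof (rule ccontr)
  assume "\<not> a \<le> p z"
  define N where "N = {y \<in> G. p y < a}"
  have "open N"
  proof -
    have "N = G \<inter> p -` {..<a}" by (auto simp: N_def)
    then show ?thesis using continuous_open_preimage[OF p G open_lessThan] by simp
  qed
  have "AE y in lebesgue_on G. ereal (- p y) \<le> esssup (lebesgue_on G) (\<lambda>x. ereal (- p x))"
    by (rule esssup_AE)
  moreover have "esssup (lebesgue_on G) (\<lambda>x. ereal (- p x)) < ereal (- a)"
    using e unfolding ess_inf_def by (cases "esssup (lebesgue_on G) (\<lambda>x. ereal (- p x))") auto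
  ultimately have "AE y in lebesgue_on G. \<not> p y < a"
    by (auto elim!: eventually_mono dest: order.strict_trans1)
  then have "AE y in lebesgue. y \<in> G \<longrightarrow> \<not> p y < a"
    using G by (subst (asm) AE_restrict_space_iff) auto
  then have "AE y in lebesgue. y \<notin> N" by eventually_elim (auto simp: N_def)
  then have "N \<in> null_sets lebesgue" using \<open>open N\<close> by (subst (asm) AE_iff_null) (auto simp: null_sets_def)
  moreover have "N \<noteq> {}" using z \<open>\<not> a \<le> p z\<close> by (auto simp: N_def)
  ultimately show False using open_not_negligible[OF \<open>open N\<close>] by (simp add: negligible_iff_null_sets)
qed

lemma integrable_representative:
  fixes f f' :: "'a::euclidean_space \<Rightarrow> 'b::euclidean_space"
  assumes U: "U \<in> sets lebesgue" and f': "f' \<in> borel_measurable borel" "\<And>x. x \<notin> U \<Longrightarrow> f' x = 0"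
    "AE x in lebesgue_on U. f x = f' x" and fin: "(\<integral>\<^sup>+x. ennreal (norm (f x)) \<partial>lebesgue_on U) < \<infinity>"
  shows "integrable lborel f'"
proof (rule integrableI_bounded)
  have "(\<integral>\<^sup>+x. ennreal (norm (f' x)) \<partial>lborel) = (\<integral>\<^sup>+x. ennreal (norm (f x)) \<partial>lebesgue_on U)"
    using f'(2,3) by (intro nn_integral_lborel_eq_lebesgue_on[OF U]) (auto elim: eventually_mono)
  then show "(\<integral>\<^sup>+x. ennreal (norm (f' x)) \<partial>lborel) < \<infinity>" using fin by simp
qed (use f' in auto)

text \<open>The homogeneity of the ray bound allows the normalisation of the \<open>L\<^sup>2\<close> norm by \<open>l\<close>.\<close>
lemma slice_modular_bound:
  fixes \<Omega> :: "(real^'n::finite) set" and f f' :: "real^'n \<Rightarrow> real^'n" and E' :: "real^'n \<Rightarrow> real^'n^'n"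
    and p :: "real \<times> (real^'n) \<Rightarrow> real"
  assumes \<Omega>: "open \<Omega>" "bounded \<Omega>"
    and pc: "continuous_on \<Omega> (\<lambda>x. p (t, x))"
    and q: "\<And>x. x \<in> \<Omega> \<Longrightarrow> 1 \<le> p (t, x)" "\<And>x. x \<in> \<Omega> \<Longrightarrow> p (t, x) \<le> P"
      "\<And>x y. x \<in> \<Omega> \<Longrightarrow> y \<in> \<Omega> \<Longrightarrow> dist x y < R \<Longrightarrow> p (t, x) - p (t, y) \<le> 1 / CARD('n)"
    and f: "f \<in> X_slice \<Omega> p t"
    and [measurable]: "f' \<in> borel_measurable borel" "E' \<in> borel_measurable borel"
    and zero: "\<And>x. x \<notin> \<Omega> \<Longrightarrow> f' x = 0" "\<And>x. x \<notin> \<Omega> \<Longrightarrow> E' x = 0"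
    and ff': "AE x in lebesgue_on \<Omega>. f x = f' x"
    and EE': "AE x in lebesgue_on \<Omega>. sym_grad dirs \<Omega> f x = E' x"
    and R: "0 < R" "R \<le> 1" and c: "c = R / 4 * measure lborel (ball (0::real^'n) (R / 4))"
    and B: "B = measure lborel (ball (0::real^'n) R)"
    and L: "L = max 1 (((2 * B + 2) / c) powr P)"
    and l: "0 < l" "L2_norm \<Omega> f \<le> l"
  shows "(\<integral>\<^sup>+x. ennreal (norm (f' x /\<^sub>R l) powr p (t, x)) * indicator \<Omega> x \<partial>lborel)
    \<le> emeasure lborel \<Omega> + ennreal L * (emeasure lborel \<Omega> + 1)
      + ennreal L * (2 * (ennreal B + 1) * (emeasure lborel \<Omega> +
          (\<integral>\<^sup>+x. ennreal (norm (E' x /\<^sub>R l) powr p (t, x)) * indicator \<Omega> x \<partial>lborel)))"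
proof -
  define v where "v x = norm (f' x /\<^sub>R l)" for x
  define g where "g x = norm (E' x /\<^sub>R l)" for x
  define q' where "q' x = indicator \<Omega> x *\<^sub>R p (t, x)" for x
  have vg[measurable]: "v \<in> borel_measurable borel" "g \<in> borel_measurable borel"
    unfolding v_def[abs_def] g_def[abs_def] by measurable
  have \<Omega>B[measurable]: "\<Omega> \<in> sets borel" using \<Omega> by simp
  have q'm[measurable]: "q' \<in> borel_measurable borel"
    unfolding q'_def[abs_def] by (rule borel_measurable_continuous_on_indicator) (use pc in auto)
  have \<Omega>L: "\<Omega> \<in> sets lebesgue" using \<Omega> by auto
  have qm: "(\<lambda>x. p (t, x)) \<in> borel_measurable (lebesgue_on \<Omega>)"
    by (rule continuous_imp_measurable_on_sets_lebesgue[OF pc \<Omega>L])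
  have c0: "0 < c" unfolding c using R content_ball_pos[of "R / 4" "0::real^'n"] by simp
  have fL2: "f \<in> L2_space \<Omega>" using f by (auto simp: X_slice_def L2p_space_def)
  have "(\<integral>\<^sup>+x. ennreal ((v x)\<^sup>2) \<partial>lborel) = (\<integral>\<^sup>+x. ennreal ((norm (f x /\<^sub>R l))\<^sup>2) \<partial>lebesgue_on \<Omega>)"
  proof (rule nn_integral_lborel_eq_lebesgue_on[OF \<Omega>L])
    show "AE x in lebesgue_on \<Omega>. ennreal ((v x)\<^sup>2) = ennreal ((norm (f x /\<^sub>R l))\<^sup>2)"
      using ff' by eventually_elim (simp add: v_def)
  qed (simp add: v_def zero(1))
  then have v2: "(\<integral>\<^sup>+x. ennreal ((v x)\<^sup>2) \<partial>lborel) \<le> 1"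
    using nn_integral_L2_scaled[OF fL2 l] by simp
  have bnd: "AE x in lborel. ennreal (c * v x) \<le> near_int R (\<lambda>x. ennreal (v x)) x + ray_int R (\<lambda>x. ennreal (g x)) x"
    using X_slice_ray_bound[OF \<Omega> qm q(1,2) f _ _ zero ff' EE' R c, simplified]
  proof eventually_elim
    case (elim x)
    have "ennreal (c * v x) = ennreal (inverse l) * ennreal (c * norm (f' x))"
      using l c0 by (simp add: v_def mult_ac flip: ennreal_mult)
    also have "\<dots> \<le> ennreal (inverse l) * (near_int R (\<lambda>y. ennreal (norm (f' y))) x + ray_int R (\<lambda>y. ennreal (norm (E' y))) x)"
      using elim by (intro mult_left_mono) auto
    also have "\<dots> = near_int R (\<lambda>y. ennreal (inverse l) * ennreal (norm (f' y))) x
       + ray_int R (\<lambda>y. ennreal (inverse l) * ennreal (norm (E' y))) x"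
      by (simp add: near_int_cmult ray_int_cmult distrib_left)
    also have "\<dots> = near_int R (\<lambda>x. ennreal (v x)) x + ray_int R (\<lambda>x. ennreal (g x)) x"
      using l by (simp add: v_def g_def ennreal_mult)
    finally show ?case .
  qed
  have Bfin: "emeasure lborel (ball (0::real^'n) R) = ennreal B" "0 \<le> B"
    using emeasure_bounded_finite[OF bounded_ball, of "0::real^'n" R]
    unfolding B by (auto intro!: emeasure_eq_ennreal_measure)
  have "(\<integral>\<^sup>+x. ennreal (v x powr q' x) * indicator \<Omega> x \<partial>lborel)
    \<le> emeasure lborel \<Omega> + ennreal L * (emeasure lborel \<Omega> + 1)
      + ennreal L * (2 * (ennreal B + 1) * (emeasure lborel \<Omega> + (\<integral>\<^sup>+x. ennreal (g x powr q' x) * indicator \<Omega> x \<partial>lborel)))"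
    by (rule modular_le_of_ray_bound[OF vg q'm \<Omega>B _ _ _ v2 bnd c0 _ _ _ Bfin L])
      (use q zero(2) in \<open>auto simp: v_def g_def q'_def\<close>)
  moreover have "ennreal (r powr q' x) * indicator \<Omega> x = ennreal (r powr p (t, x)) * indicator \<Omega> x" for x r
    by (simp add: q'_def indicator_def)
  ultimately show ?thesis by (simp only: v_def g_def)
qed


text \<open>The radius \<open>R\<close> comes from the uniform continuity of \<open>p\<close> on the compact closure, hence is the same for all
  times, and with it all constants of the slice estimate; integrating this estimate over \<open>I\<close> gives the claim.\<close>
lemma parabolic_modular_estimate:
  fixes \<Omega> :: "(real^'n::finite) set" and p :: "real \<times> (real^'n) \<Rightarrow> real"
  assumes I: "open I" "bounded I" "I \<noteq> {}" and \<Omega>: "open \<Omega>" "bounded \<Omega>"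
    and p: "continuous_on (closure (I \<times> \<Omega>)) p" and p1: "\<And>z. z \<in> I \<times> \<Omega> \<Longrightarrow> 1 \<le> p z"
  obtains C P where "1 \<le> C" "\<And>z. z \<in> I \<times> \<Omega> \<Longrightarrow> p z \<le> P"
    "\<And>u l. u \<in> X_space I \<Omega> p \<Longrightarrow> u \<in> Y_inf_space I \<Omega> \<Longrightarrow>
      Lp_norm (I \<times> \<Omega>) p (sym_grad space_dirs (I \<times> \<Omega>) u) + Y_inf_norm I \<Omega> u < l \<Longrightarrow>
      modular (I \<times> \<Omega>) p (\<lambda>z. u z /\<^sub>R l) \<le> ennreal C"
proof -
  let ?Q = "I \<times> \<Omega>"
  have Q: "open ?Q" "bounded ?Q" using I \<Omega> by (auto intro: open_Times bounded_Times)
  have QL: "?Q \<in> sets lebesgue" and QB: "?Q \<in> sets borel" using Q by auto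
  have \<Omega>L: "\<Omega> \<in> sets lebesgue" and \<Omega>B: "\<Omega> \<in> sets borel" using \<Omega> by auto
  have IB: "I \<in> sets borel" using I by auto
  have cQ: "compact (closure ?Q)" using Q(2) by (simp add: compact_closure)
  have pQ: "continuous_on ?Q p" using p closure_subset by (rule continuous_on_subset)
  have pm: "p \<in> borel_measurable (lebesgue_on ?Q)"
    by (rule continuous_imp_measurable_on_sets_lebesgue[OF pQ QL])
  have "bounded (p ` closure ?Q)" by (intro compact_imp_bounded compact_continuous_image p cQ)
  then obtain P where P0: "\<And>z. z \<in> closure ?Q \<Longrightarrow> \<bar>p z\<bar> \<le> P" by (auto simp: bounded_iff)
  have P: "p z \<le> P" if "z \<in> ?Q" for z
    using P0[of z] that closure_subset[of ?Q] by force
  have "uniformly_continuous_on (closure ?Q) p" by (rule compact_uniformly_continuous[OF p cQ])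
  then obtain r where r: "0 < r" "\<And>y z. y \<in> closure ?Q \<Longrightarrow> z \<in> closure ?Q \<Longrightarrow> dist z y < r \<Longrightarrow> dist (p z) (p y) < 1 / CARD('n)"
    unfolding uniformly_continuous_on_def by (metis zero_less_card_finite of_nat_0_less_iff zero_less_divide_1_iff)
  define R where "R = min 1 r"
  have R: "0 < R" "R \<le> 1" using r(1) by (auto simp: R_def)
  have osc: "p (t, x) - p (t, y) \<le> 1 / CARD('n)" if "t \<in> I" "x \<in> \<Omega>" "y \<in> \<Omega>" "dist x y < R" for t x y
  proof -
    have "(t, x) \<in> closure ?Q" "(t, y) \<in> closure ?Q" using that closure_subset[of ?Q] by auto
    moreover have "dist (t, x) (t, y) < r" using that(4) by (simp add: dist_Pair_Pair R_def)
    ultimately have "dist (p (t, x)) (p (t, y)) < 1 / CARD('n)" using r(2) by blast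
    then show ?thesis by (simp add: dist_real_def)
  qed
  define c where "c = R / 4 * measure lborel (ball (0::real^'n) (R / 4))"
  define B where "B = measure lborel (ball (0::real^'n) R)"
  define L where "L = max 1 (((2 * B + 2) / c) powr P)"
  define V where "V = measure lborel \<Omega>"
  define T where "T = measure lborel I"
  define K1 where "K1 = L * (2 * (B + 1))"
  define K0 where "K0 = V + L * (V + 1) + K1 * V"
  have nn: "0 \<le> B" "0 \<le> L" "0 \<le> V" "0 \<le> T" by (auto simp: B_def L_def V_def T_def)
  have K: "0 \<le> K1" "0 \<le> K0" using nn by (simp_all add: K1_def K0_def)
  have V: "emeasure lborel \<Omega> = ennreal V" and T: "emeasure lborel I = ennreal T"
    unfolding V_def T_def by (rule bounded_open_emeasure(1); fact)+
  have K1e: "ennreal K1 = ennreal L * (2 * (ennreal B + 1))"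
    using nn by (simp add: K1_def ennreal_mult ennreal_plus)
  have K0e: "ennreal K0 = ennreal V + ennreal L * (ennreal V + 1) + ennreal K1 * ennreal V"
    using nn K(1) by (simp add: K0_def ennreal_mult ennreal_plus)
  have RHS: "emeasure lborel \<Omega> + ennreal L * (emeasure lborel \<Omega> + 1) + ennreal L * (2 * (ennreal B + 1) * (emeasure lborel \<Omega> + X))
    = ennreal K0 + ennreal K1 * X" for X
  proof -
    have "ennreal L * (2 * (ennreal B + 1) * (ennreal V + X)) = ennreal K1 * (ennreal V + X)"
      unfolding K1e by (simp only: mult.assoc)
    then show ?thesis by (simp only: V K0e distrib_left add.assoc)
  qed
  show ?thesis
  proof (rule that)
    show "1 \<le> max 1 (K0 * T + K1)" by simp
    show "p z \<le> P" if "z \<in> ?Q" for z by (rule P[OF that])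
    fix u l
    assume uX: "u \<in> X_space I \<Omega> p" and uY: "u \<in> Y_inf_space I \<Omega>"
      and l: "Lp_norm ?Q p (sym_grad space_dirs ?Q u) + Y_inf_norm I \<Omega> u < l"
    from uX obtain E0 where E0: "E0 \<in> Lp_space ?Q p" "has_sym_grad space_dirs ?Q u E0" and uL2: "u \<in> L2_space ?Q"
      by (auto simp: X_space_def L2p_space_def)
    have E0m: "E0 \<in> borel_measurable (lebesgue_on ?Q)" using E0(1) by (simp add: Lp_space_def)
    have um: "u \<in> borel_measurable (lebesgue_on ?Q)" using uL2 by (simp add: L2_space_def)
    have normE: "Lp_norm ?Q p (sym_grad space_dirs ?Q u) = Lp_norm ?Q p E0"
      by (rule Lp_norm_cong_AE[OF sym_grad_AE_eq[OF Q(1) E0(2)]])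
    have Ynn: "0 \<le> Y_inf_norm I \<Omega> u" and Yae: "AE t in lebesgue_on I. L2_norm \<Omega> (\<lambda>x. u (t, x)) \<le> Y_inf_norm I \<Omega> u"
      using Y_inf_norm_bounds[OF uY I(1,3)] by blast+
    have Enn: "0 \<le> Lp_norm ?Q p E0" by (rule Lp_norm_nonneg[OF E0(1) pm p1])
    have l0: "0 < l" "Lp_norm ?Q p E0 < l" "Y_inf_norm I \<Omega> u < l" using l Ynn Enn normE by linarith+
    obtain l1 where l1: "0 < l1" "l1 < l" "modular ?Q p (\<lambda>z. E0 z /\<^sub>R l1) \<le> 1"
      by (rule Lp_norm_lessE[OF E0(1) pm p1 l0(2)])
    have modE: "modular ?Q p (\<lambda>z. E0 z /\<^sub>R l) \<le> 1"
      by (rule order_trans[OF modular_antimono_scale[OF l1(1) less_imp_le[OF l1(2)] p1] l1(3)])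
    obtain u' where u': "u' \<in> borel_measurable borel" "\<And>z. z \<notin> ?Q \<Longrightarrow> u' z = 0" "AE z in lebesgue_on ?Q. u z = u' z"
      using ex_borel_representative[OF QB um] by blast
    obtain E' where E': "E' \<in> borel_measurable borel" "\<And>z. z \<notin> ?Q \<Longrightarrow> E' z = 0" "AE z in lebesgue_on ?Q. E0 z = E' z"
      using ex_borel_representative[OF QB E0m] by blast
    note [measurable] = u'(1) E'(1)
    have Qfin: "emeasure (lebesgue_on ?Q) ?Q + 1 < \<infinity>"
      using bounded_open_emeasure(2)[OF Q] by simp
    have "(\<integral>\<^sup>+z. ennreal (norm (u z)) \<partial>lebesgue_on ?Q) \<le> ennreal (L2_norm ?Q u + 1) * (emeasure (lebesgue_on ?Q) ?Q + 1)"
      by (rule nn_integral_norm_le_of_L2[OF uL2]) (auto simp: L2_norm_def intro: add_nonneg_pos)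
    also have "\<dots> < \<infinity>" using Qfin by (simp add: ennreal_mult_less_top)
    finally have u_fin: "(\<integral>\<^sup>+z. ennreal (norm (u z)) \<partial>lebesgue_on ?Q) < \<infinity>" .
    have iu: "integrable lborel u'"
      by (rule integrable_representative[OF QL u'(1) _ u'(3) u_fin]) (rule u'(2))
    have "(\<integral>\<^sup>+z. ennreal (norm (E0 z)) \<partial>lebesgue_on ?Q) \<le> ennreal l1 * (emeasure (lebesgue_on ?Q) ?Q + 1)"
      by (rule nn_integral_norm_le_of_modular[OF E0m pm p1 l1(1,3)])
    also have "\<dots> < \<infinity>" using Qfin by (simp add: ennreal_mult_less_top)
    finally have E_fin: "(\<integral>\<^sup>+z. ennreal (norm (E0 z)) \<partial>lebesgue_on ?Q) < \<infinity>" .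
    have iE: "integrable lborel E'"
      by (rule integrable_representative[OF QL E'(1) _ E'(3) E_fin]) (rule E'(2))
    \<comment> \<open>The exponent is cut off as well, since \<open>p\<close> is only known to be measurable on \<open>I \<times> \<Omega>\<close>.\<close>
    define \<Phi> where "\<Phi> h z = ennreal (h z powr (indicator ?Q z *\<^sub>R p z)) * indicator ?Q z" for h :: "real \<times> (real^'n) \<Rightarrow> real" and z
    let ?U = "\<Phi> (\<lambda>z. norm (u' z /\<^sub>R l))" and ?G = "\<Phi> (\<lambda>z. norm (E' z /\<^sub>R l))"
    have p'm: "(\<lambda>z. indicator ?Q z *\<^sub>R p z) \<in> borel_measurable borel"
      by (rule borel_measurable_continuous_on_indicator[OF QB pQ])
    have \<Phi>m: "\<Phi> h \<in> borel_measurable borel" if [measurable]: "h \<in> borel_measurable borel" for h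
    proof -
      note [measurable] = p'm QB
      show ?thesis unfolding \<Phi>_def[abs_def] by measurable
    qed
    have UG[measurable]: "?U \<in> borel_measurable borel" "?G \<in> borel_measurable borel" by (rule \<Phi>m; measurable)+
    have UG': "?U \<in> borel_measurable (lborel \<Otimes>\<^sub>M lborel)" "?G \<in> borel_measurable (lborel \<Otimes>\<^sub>M lborel)"
      unfolding lborel_prod using UG by simp_all
    have slices: "(\<integral>\<^sup>+x. \<Phi> h (t, x) \<partial>lborel) = (\<integral>\<^sup>+x. ennreal (h (t, x) powr p (t, x)) * indicator \<Omega> x \<partial>lborel)"
      if "t \<in> I" for t h
      using that by (intro nn_integral_cong) (auto simp: \<Phi>_def indicator_def)
    have slice0: "(\<integral>\<^sup>+x. \<Phi> h (t, x) \<partial>lborel) = 0" if "t \<notin> I" for t h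
      using that by (simp add: \<Phi>_def)
    have Iae: "AE t in lborel. t \<in> I \<longrightarrow> R t" if "AE t in lebesgue_on I. R t" for R
      using that I by (subst (asm) AE_restrict_space_iff) (auto simp: AE_completion_iff)
    have X: "AE t in lborel. t \<in> I \<longrightarrow> (\<lambda>x. u (t, x)) \<in> X_slice \<Omega> p t"
      using uX by (intro Iae) (simp add: X_space_def)
    have SG: "AE t in lborel. t \<in> I \<longrightarrow> (\<forall>F. has_sym_grad dirs \<Omega> (\<lambda>x. u (t, x)) F \<longrightarrow>
        (\<lambda>x. u (t, x)) \<in> borel_measurable (lebesgue_on \<Omega>) \<longrightarrow> (AE x in lebesgue_on \<Omega>. F x = E' (t, x)))"
      by (rule AE_slice_sym_grad[OF I(1) \<Omega>(1) E0(2) um E0m iu iE _ _ u'(3) E'(3)]) (fact u'(2) E'(2))+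
    have "AE t in lborel. (\<integral>\<^sup>+x. ?U (t, x) \<partial>lborel) \<le> ennreal K0 * indicator I t + ennreal K1 * (\<integral>\<^sup>+x. ?G (t, x) \<partial>lborel)"
      using X Iae[OF Yae] AE_slices[OF IB \<Omega>B u'(3)] SG
    proof eventually_elim
      case (elim t)
      show ?case
      proof (cases "t \<in> I")
        case True
        let ?f = "\<lambda>x. u (t, x)"
        have f: "?f \<in> X_slice \<Omega> p t" using elim(1) True by blast
        then obtain F where "has_sym_grad dirs \<Omega> ?f F" and fL2: "?f \<in> L2_space \<Omega>"
          by (auto simp: X_slice_def L2p_space_def)
        then have F: "has_sym_grad dirs \<Omega> ?f (sym_grad dirs \<Omega> ?f)" by (simp add: has_sym_grad_sym_grad)
        have "?f \<in> borel_measurable (lebesgue_on \<Omega>)" using fL2 by (simp add: L2_space_def)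
        then have E: "AE x in lebesgue_on \<Omega>. sym_grad dirs \<Omega> ?f x = E' (t, x)" using elim(4) True F by blast
        have "(\<lambda>x. u' (t, x)) \<in> borel_measurable borel" "(\<lambda>x. E' (t, x)) \<in> borel_measurable borel"
          by (rule measurable_compose[OF _ u'(1)] measurable_compose[OF _ E'(1)],
              simp add: borel_measurable_continuous_onI continuous_on_Pair)+
        moreover have "continuous_on \<Omega> (\<lambda>x. p (t, x))"
          by (rule continuous_on_compose2[OF pQ]) (use True in \<open>auto intro!: continuous_intros\<close>)
        ultimately have "(\<integral>\<^sup>+x. ennreal (norm (u' (t, x) /\<^sub>R l) powr p (t, x)) * indicator \<Omega> x \<partial>lborel)
          \<le> emeasure lborel \<Omega> + ennreal L * (emeasure lborel \<Omega> + 1)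
            + ennreal L * (2 * (ennreal B + 1) * (emeasure lborel \<Omega> +
              (\<integral>\<^sup>+x. ennreal (norm (E' (t, x) /\<^sub>R l) powr p (t, x)) * indicator \<Omega> x \<partial>lborel)))"
          using True elim(2,3) l0(3)
          by (intro slice_modular_bound[OF \<Omega> _ _ _ _ f _ _ _ _ _ E R c_def B_def L_def l0(1)])
            (auto intro: p1 P osc u'(2) E'(2))
        then show ?thesis using True by (simp only: RHS slices[OF True]) (simp add: slices[OF True])
      qed (simp add: slice0)
    qed
    then have "(\<integral>\<^sup>+t. (\<integral>\<^sup>+x. ?U (t, x) \<partial>lborel) \<partial>lborel)
      \<le> (\<integral>\<^sup>+t. ennreal K0 * indicator I t + ennreal K1 * (\<integral>\<^sup>+x. ?G (t, x) \<partial>lborel) \<partial>lborel)"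
      by (rule nn_integral_mono_AE)
    also have "\<dots> = ennreal K0 * emeasure lborel I + ennreal K1 * (\<integral>\<^sup>+t. (\<integral>\<^sup>+x. ?G (t, x) \<partial>lborel) \<partial>lborel)"
    proof -
      have "(\<lambda>t. \<integral>\<^sup>+x. ?G (t, x) \<partial>lborel) \<in> borel_measurable lborel"
        using lborel.borel_measurable_nn_integral_fst[OF UG'(2)] .
      then show ?thesis using IB by (simp add: nn_integral_add nn_integral_cmult nn_integral_cmult_indicator)
    qed
    also have "(\<integral>\<^sup>+t. (\<integral>\<^sup>+x. ?G (t, x) \<partial>lborel) \<partial>lborel) = (\<integral>\<^sup>+z. ?G z \<partial>lborel)"
      using lborel.nn_integral_fst[OF UG'(2)] by (simp add: lborel_prod)
    also have "(\<integral>\<^sup>+t. (\<integral>\<^sup>+x. ?U (t, x) \<partial>lborel) \<partial>lborel) = (\<integral>\<^sup>+z. ?U z \<partial>lborel)"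
      using lborel.nn_integral_fst[OF UG'(1)] by (simp add: lborel_prod)
    also have "(\<integral>\<^sup>+z. ?U z \<partial>lborel) = modular ?Q p (\<lambda>z. u z /\<^sub>R l)"
      unfolding modular_def
    proof (rule nn_integral_lborel_eq_lebesgue_on[OF QL])
      have "AE z in lebesgue_on ?Q. z \<in> ?Q" using AE_space[of "lebesgue_on ?Q"] by simp
      with u'(3) show "AE z in lebesgue_on ?Q. ?U z = ennreal (norm (u z /\<^sub>R l) powr p z)"
        by eventually_elim (simp add: \<Phi>_def)
    qed (simp add: \<Phi>_def)
    also have "(\<integral>\<^sup>+z. ?G z \<partial>lborel) = modular ?Q p (\<lambda>z. E0 z /\<^sub>R l)"
      unfolding modular_def
    proof (rule nn_integral_lborel_eq_lebesgue_on[OF QL])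
      have "AE z in lebesgue_on ?Q. z \<in> ?Q" using AE_space[of "lebesgue_on ?Q"] by simp
      with E'(3) show "AE z in lebesgue_on ?Q. ?G z = ennreal (norm (E0 z /\<^sub>R l) powr p z)"
        by eventually_elim (simp add: \<Phi>_def)
    qed (simp add: \<Phi>_def)
    finally have "modular ?Q p (\<lambda>z. u z /\<^sub>R l) \<le> ennreal K0 * emeasure lborel I + ennreal K1 * modular ?Q p (\<lambda>z. E0 z /\<^sub>R l)" .
    also have "\<dots> \<le> ennreal K0 * ennreal T + ennreal K1 * 1"
      unfolding T by (intro add_left_mono mult_left_mono modE) simp
    also have "\<dots> = ennreal (K0 * T + K1)" using K nn by (simp add: ennreal_plus ennreal_mult)
    also have "\<dots> \<le> ennreal (max 1 (K0 * T + K1))" by (intro ennreal_leI) simp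
    finally show "modular ?Q p (\<lambda>z. u z /\<^sub>R l) \<le> ennreal (max 1 (K0 * T + K1))" .
  qed
qed

theorem proposition5p9:
  fixes \<Omega> :: "(real^'n::finite) set"
    and T :: real
    and p :: "real \<times> (real^'n) \<Rightarrow> real"
  defines "I \<equiv> {0<..<T}"
  assumes "CARD('n) \<ge> 2"
    and "open \<Omega>" and "connected \<Omega>" and "\<Omega> \<noteq> {}" and "bounded \<Omega>"
    and "0 < T"
    and "continuous_on (closure (I \<times> \<Omega>)) p"
    and "ess_inf (I \<times> \<Omega>) p > 1"
  shows "\<exists>c>0. \<forall>u \<in> X_space I \<Omega> p \<inter> Y_inf_space I \<Omega>.
    u \<in> Lp_space (I \<times> \<Omega>) p \<and>
    Lp_norm (I \<times> \<Omega>) p u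
      \<le> c * (Lp_norm (I \<times> \<Omega>) p (sym_grad space_dirs (I \<times> \<Omega>) u) + Y_inf_norm I \<Omega> u)"
proof -
  let ?Q = "I \<times> \<Omega>"
  have I: "open I" "bounded I" "I \<noteq> {}" using \<open>0 < T\<close> by (auto simp: I_def)
  have Q: "open ?Q" using I(1) \<open>open \<Omega>\<close> by (rule open_Times)
  have pQ: "continuous_on ?Q p"
    using \<open>continuous_on (closure ?Q) p\<close> closure_subset by (rule continuous_on_subset)
  have pm: "p \<in> borel_measurable (lebesgue_on ?Q)"
    by (rule continuous_imp_measurable_on_sets_lebesgue[OF pQ]) (use Q in auto)
  have "ess_inf ?Q p > ereal 1" using \<open>ess_inf ?Q p > 1\<close> by (simp add: one_ereal_def)
  then have p1: "1 \<le> p z" if "z \<in> ?Q" for z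
    by (rule ess_inf_gt_imp_ge[OF Q pQ _ that])
  obtain C P where C: "1 \<le> C" and P: "\<And>z. z \<in> ?Q \<Longrightarrow> p z \<le> P"
    and mod: "\<And>u l. u \<in> X_space I \<Omega> p \<Longrightarrow> u \<in> Y_inf_space I \<Omega> \<Longrightarrow>
      Lp_norm ?Q p (sym_grad space_dirs ?Q u) + Y_inf_norm I \<Omega> u < l \<Longrightarrow> modular ?Q p (\<lambda>z. u z /\<^sub>R l) \<le> ennreal C"
    using parabolic_modular_estimate[OF I \<open>open \<Omega>\<close> \<open>bounded \<Omega>\<close> \<open>continuous_on (closure ?Q) p\<close> p1] by blast
  show ?thesis
  proof (intro exI[of _ C] conjI ballI)
    show "0 < C" using C by simp
    fix u assume "u \<in> X_space I \<Omega> p \<inter> Y_inf_space I \<Omega>"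
    then have uX: "u \<in> X_space I \<Omega> p" and uY: "u \<in> Y_inf_space I \<Omega>" by auto
    let ?l = "Lp_norm ?Q p (sym_grad space_dirs ?Q u) + Y_inf_norm I \<Omega> u"
    from uX obtain E0 where E0: "E0 \<in> Lp_space ?Q p" "has_sym_grad space_dirs ?Q u E0" and uL2: "u \<in> L2_space ?Q"
      by (auto simp: X_space_def L2p_space_def)
    have um: "u \<in> borel_measurable (lebesgue_on ?Q)" using uL2 by (simp add: L2_space_def)
    have "0 \<le> Lp_norm ?Q p (sym_grad space_dirs ?Q u)"
      using Lp_norm_nonneg[OF E0(1) pm p1] Lp_norm_cong_AE[OF sym_grad_AE_eq[OF Q E0(2)]] by simp
    then have l0: "0 \<le> ?l" using Y_inf_norm_bounds(1)[OF uY I(1,3)] by simp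
    show "u \<in> Lp_space ?Q p"
    proof -
      define l where "l = max 1 (?l + 1)"
      have l: "1 \<le> l" "?l < l" by (auto simp: l_def)
      have "modular ?Q p u \<le> (\<integral>\<^sup>+z. ennreal (l powr P) * ennreal (norm (u z /\<^sub>R l) powr p z) \<partial>lebesgue_on ?Q)"
        unfolding modular_def
      proof (rule nn_integral_mono)
        fix z assume "z \<in> space (lebesgue_on ?Q)"
        then have z: "z \<in> ?Q" by simp
        have "norm (u z) = l * norm (u z /\<^sub>R l)" using l(1) by (simp add: field_simps)
        then have "norm (u z) powr p z = (l * norm (u z /\<^sub>R l)) powr p z" by (rule arg_cong)
        also have "\<dots> = l powr p z * norm (u z /\<^sub>R l) powr p z" by (rule powr_mult)
        also have "\<dots> \<le> l powr P * norm (u z /\<^sub>R l) powr p z"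
          using P[OF z] l by (intro mult_right_mono powr_mono) auto
        finally have "ennreal (norm (u z) powr p z) \<le> ennreal (l powr P * norm (u z /\<^sub>R l) powr p z)" by (rule ennreal_leI)
        then show "ennreal (norm (u z) powr p z) \<le> ennreal (l powr P) * ennreal (norm (u z /\<^sub>R l) powr p z)"
          by (simp only: ennreal_mult powr_ge_zero)
      qed
      also have "\<dots> = ennreal (l powr P) * modular ?Q p (\<lambda>z. u z /\<^sub>R l)"
        unfolding modular_def by (rule nn_integral_cmult[OF norm_scaled_measurable[OF um pm]])
      also have "\<dots> \<le> ennreal (l powr P) * ennreal C"
        by (intro mult_left_mono mod[OF uX uY l(2)]) auto
      also have "\<dots> < \<infinity>" by (simp add: ennreal_mult_less_top)
      finally show ?thesis using um by (simp add: Lp_space_def)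
    qed
    show "Lp_norm ?Q p u \<le> C * ?l"
    proof (rule field_le_epsilon)
      fix e :: real assume e: "0 < e"
      \<comment> \<open>The norms on the right may all vanish, so the scaling uses a slightly larger positive number.\<close>
      define l where "l = ?l + e / C"
      have l: "0 < l" "?l < l" using l0 e C by (auto simp: l_def intro: add_nonneg_pos)
      have ulm: "(\<lambda>z. u z /\<^sub>R l) \<in> borel_measurable (lebesgue_on ?Q)" using um by simp
      have "modular ?Q p (\<lambda>z. (u z /\<^sub>R l) /\<^sub>R C) \<le> 1"
        by (rule modular_scaled_le_one[OF ulm pm p1 mod[OF uX uY l(2)] C])
      moreover have "(\<lambda>z. (u z /\<^sub>R l) /\<^sub>R C) = (\<lambda>z. u z /\<^sub>R (C * l))"
        by (simp add: mult.commute)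
      ultimately have "Lp_norm ?Q p u \<le> C * l"
        using C l(1) by (intro Lp_norm_le) auto
      also have "C * l = C * ?l + e" using C by (simp add: l_def field_simps)
      finally show "Lp_norm ?Q p u \<le> C * ?l + e" .
    qed
  qed
qed

end
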